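(* Let $\{(X_i,a_i)\}_{i\ge0}$ be a controlled Markov chain with finite state space $\mathcal S$, $|\mathcal S|=d$, and finite action space $\mathcal A$, $|\mathcal A|=k$. Let $\{M^{(l)}_{s,t}\}_{(s,l,t)\in\mathcal S\times\mathcal A\times\mathcal S}$ be a fixed hypothesized transition kernel, and consider the null hypothesis $$H_0:\quad\mathbb P(X_{i+1}=t\mid X_i=s,a_i=l)=M^{(l)}_{s,t}\quad\text{for all }(s,l,t)\in\mathcal S\times\mathcal A\times\mathcal S.$$ Suppose that $H_0$ holds and that the following two conditions hold. (1) For all $(s,l)\in\mathcal S\times\mathcal A$ there exist $0<\alpha<1$ and a deterministic sequence $(T_i)_{i\ge1}$ with $T_i=O(i^{\alpha})$ such that for all $i\ge1$, $\mathbb E\big[\tau^{(i)}_{s,l}\mid\mathcal F_{\sum_{p=1}^{i-1}\tau^{(p)}_{s,l}}\big]\le T_i$ almost surely. (2) There exists a constant $C_\Delta>1$ independent of $n$ such that $\|\Delta_n\|:=\max_{1\le i\le n}\big(1+\bar\eta_{i,i+1}(n)+\dots+\bar\eta_{i,n}(n)\big)\le C_\Delta$ for all $n$. Then, for any $(s,l)\in\mathcal S\times\mathcal A$, as $n\to\infty$, $$\sum_{t\in\mathcal S}\frac{\big(N^{(l)}_{s,t}-N^{(l)}_sM^{(l)}_{s,t}\big)^2}{N^{(l)}_sM^{(l)}_{s,t}}\overset{d}{\rightarrow}\chi^2_{d_{(s,l)}-1},$$ where $\chi^2_{d_{(s,l)}-1}$ is the chi-square distribution with $d_{(s,l)}-1$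 degrees of freedom and $d_{(s,l)}=\sum_{t\in\mathcal S}\mathbb 1[M^{(l)}_{s,t}>0]$. Furthermore, these $dk$ chi-square statistics, indexed by $(s,l)\in\mathcal S\times\mathcal A$, are asymptotically independent, and $$\sum_{(s,l)\in\mathcal S\times\mathcal A,\ t\in\mathcal S}\frac{\big(N^{(l)}_{s,t}-N^{(l)}_sM^{(l)}_{s,t}\big)^2}{N^{(l)}_sM^{(l)}_{s,t}}\overset{d}{\rightarrow}\chi^2_{\sum_{(s,l)\in\mathcal S\times\mathcal A}d_{(s,l)}-dk}.$$
   Context: Controlled Markov chain (CMC): let $\mathcal F_j=\sigma(X_0,a_0,\dots,X_j,a_j)$. A CMC is a process $\{(X_i,a_i)\}_{i\ge0}$ with values in $\mathcal S\times\mathcal A$ such that for all times $i$ and all histories $(s_0,l_0,\dots,s_i,l_i)$ of positive probability, $\mathbb P(X_{i+1}=t\mid X_0=s_0,a_0=l_0,\dots,X_i=s_i,a_i=l_i)=\mathbb P(X_{i+1}=t\mid X_i=s_i,a_i=l_i)$, and the latter does not depend on $i$. The law of $a_i$ given $(X_0,a_0,\dots,X_{i-1},a_{i-1},X_i)$ may be history-dependent and time-inhomogeneous. Counts from data $(X_0,a_0),\dots,(X_n,a_n)$: $N_s^{(l)}=\sum_{i=0}^{n-1}\mathbb 1[X_i=s,a_i=l]$, $N_{s,t}^{(l)}=\sum_{i=0}^{n-1}\mathbb 1[X_i=s,X_{i+1}=t,a_i=l]$. In the statistics, terms with $M^{(l)}_{s,t}=0$, or with $N^{(l)}_s=0$,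 (of the form $0/0$) are taken to be $0$; $\chi^2_0$ is the point mass at $0$. Return times: $\tau^{(1)}_{s,l}=\min\{i>0:X_i=s,a_i=l\}$ and, for $i\ge2$, $\tau^{(i)}_{s,l}=\min\{m>0: X_{\sum_{j=1}^{i-1}\tau^{(j)}_{s,l}+m}=s,\ a_{\sum_{j=1}^{i-1}\tau^{(j)}_{s,l}+m}=l\}$. $\mathcal F_{\sum_{p=1}^{i-1}\tau^{(p)}_{s,l}}$ is the $\sigma$-algebra of the corresponding stopping time. Weak mixing coefficients: for $i<j\le n$, $\bar\eta_{i,j}(n)=\sup\big|\mathbb P((X_j,a_j,\dots,X_n,a_n)\in\mathcal T\mid X_i=s_1,a_i=l_1,\mathcal H_0^{i-1}=h)-\mathbb P((X_j,a_j,\dots,X_n,a_n)\in\mathcal T\mid X_i=s_2,a_i=l_2,\mathcal H_0^{i-1}=h)\big|$, where $\mathcal H_0^{i-1}=((X_0,a_0),\dots,(X_{i-1},a_{i-1}))$ and the supremum is over $\mathcal T\subseteq(\mathcal S\times\mathcal A)^{n-j+1}$, $s_1,s_2\in\mathcal S$, $l_1,l_2\in\mathcal A$, $h\in(\mathcal S\times\mathcal A)^i$ such that both conditioning events have positive probability. Asymptotic independence means that the vector of the $dk$ statistics converges jointly in distribution to a vector of independent random variables. *)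

theory Defs
  imports "HOL-Probability.Probability" "HOL-Library.Landau_Symbols"
begin

definition trajectory :: "(nat \<Rightarrow> 'w \<Rightarrow> 's) \<Rightarrow> (nat \<Rightarrow> 'w \<Rightarrow> 'a) \<Rightarrow> nat \<Rightarrow> nat \<Rightarrow> 'w \<Rightarrow> ('s \<times> 'a) list" where
  "trajectory X A i j \<omega> = map (\<lambda>m. (X m \<omega>, A m \<omega>)) [i..<j]"

text \<open>No condition is put on the law of \<open>A i\<close> given the past: it may depend on the whole
  history and on \<open>i\<close>. Since \<^const>\<open>cond_prob\<close> is a quotient of probabilities, it is only
  constrained where the conditioning event has positive probability.\<close>

locale controlled_markov_chain = prob_space P
  for P :: "'w measure" +
  fixes X :: "nat \<Rightarrow> 'w \<Rightarrow> 's::finite" and A :: "nat \<Rightarrow> 'w \<Rightarrow> 'a::finite"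
  assumes X_measurable: "\<And>i. X i \<in> P \<rightarrow>\<^sub>M count_space UNIV"
    and A_measurable: "\<And>i. A i \<in> P \<rightarrow>\<^sub>M count_space UNIV"
    and markov: "\<And>i h s l t.
      \<P>(\<omega> in P. trajectory X A 0 i \<omega> = h \<and> X i \<omega> = s \<and> A i \<omega> = l) > 0 \<Longrightarrow>
      \<P>(\<omega> in P. X (Suc i) \<omega> = t \<bar> trajectory X A 0 i \<omega> = h \<and> X i \<omega> = s \<and> A i \<omega> = l)
        = \<P>(\<omega> in P. X (Suc i) \<omega> = t \<bar> X i \<omega> = s \<and> A i \<omega> = l)"
    and homogeneous: "\<And>i j s l t.
      \<P>(\<omega> in P. X i \<omega> = s \<and> A i \<omega> = l) > 0 \<Longrightarrow> \<P>(\<omega> in P. X j \<omega> = s \<and> A j \<omega> = l) > 0 \<Longrightarrow>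
      \<P>(\<omega> in P. X (Suc i) \<omega> = t \<bar> X i \<omega> = s \<and> A i \<omega> = l)
        = \<P>(\<omega> in P. X (Suc j) \<omega> = t \<bar> X j \<omega> = s \<and> A j \<omega> = l)"

definition transition_kernel :: "('s::finite \<Rightarrow> 'a \<Rightarrow> 's \<Rightarrow> real) \<Rightarrow> bool" where
  "transition_kernel M \<longleftrightarrow> (\<forall>s l. (\<forall>t. 0 \<le> M s l t) \<and> (\<Sum>t\<in>UNIV. M s l t) = 1)"

definition null_hypothesis ::
  "'w measure \<Rightarrow> (nat \<Rightarrow> 'w \<Rightarrow> 's) \<Rightarrow> (nat \<Rightarrow> 'w \<Rightarrow> 'a) \<Rightarrow> ('s \<Rightarrow> 'a \<Rightarrow> 's \<Rightarrow> real) \<Rightarrow> bool" where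
  "null_hypothesis P X A M \<longleftrightarrow>
    (\<forall>i s l t. \<P>(\<omega> in P. X i \<omega> = s \<and> A i \<omega> = l) > 0 \<longrightarrow>
      \<P>(\<omega> in P. X (Suc i) \<omega> = t \<bar> X i \<omega> = s \<and> A i \<omega> = l) = M s l t)"

definition visits ::
  "(nat \<Rightarrow> 'w \<Rightarrow> 's) \<Rightarrow> (nat \<Rightarrow> 'w \<Rightarrow> 'a) \<Rightarrow> 's \<Rightarrow> 'a \<Rightarrow> nat \<Rightarrow> 'w \<Rightarrow> nat" where
  "visits X A s l n \<omega> = (\<Sum>i<n. of_bool (X i \<omega> = s \<and> A i \<omega> = l))"

definition transitions ::
  "(nat \<Rightarrow> 'w \<Rightarrow> 's) \<Rightarrow> (nat \<Rightarrow> 'w \<Rightarrow> 'a) \<Rightarrow> 's \<Rightarrow> 'a \<Rightarrow> 's \<Rightarrow> nat \<Rightarrow> 'w \<Rightarrow> nat" where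
  "transitions X A s l t n \<omega> =
    (\<Sum>i<n. of_bool (X i \<omega> = s \<and> X (Suc i) \<omega> = t \<and> A i \<omega> = l))"

text \<open>Terms with \<open>M s l t = 0\<close> or without visits to \<open>(s, l)\<close> have denominator \<open>0\<close> and
  therefore contribute \<open>0\<close>, because \<open>x / 0 = 0\<close>.\<close>

definition chi_square_statistic ::
  "(nat \<Rightarrow> 'w \<Rightarrow> 's::finite) \<Rightarrow> (nat \<Rightarrow> 'w \<Rightarrow> 'a) \<Rightarrow> ('s \<Rightarrow> 'a \<Rightarrow> 's \<Rightarrow> real)
    \<Rightarrow> 's \<Rightarrow> 'a \<Rightarrow> nat \<Rightarrow> 'w \<Rightarrow> real" where
  "chi_square_statistic X A M s l n \<omega> =
    (\<Sum>t\<in>UNIV. (real (transitions X A s l t n \<omega>) - real (visits X A s l n \<omega>) * M s l t)\<^sup>2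
      / (real (visits X A s l n \<omega>) * M s l t))"

definition support_size :: "('s::finite \<Rightarrow> 'a \<Rightarrow> 's \<Rightarrow> real) \<Rightarrow> 's \<Rightarrow> 'a \<Rightarrow> nat" where
  "support_size M s l = (\<Sum>t\<in>UNIV. of_bool (M s l t > 0))"

text \<open>The \<open>i\<close>-th return time for \<open>i \<ge> 1\<close>; the value at \<open>i = 0\<close> is not used. For \<open>i = 1\<close> the
  sum is empty, so it is counted from time \<open>0\<close>. The return time is \<open>\<infinity>\<close> if there is no
  further visit.\<close>

fun return_time ::
  "(nat \<Rightarrow> 'w \<Rightarrow> 's) \<Rightarrow> (nat \<Rightarrow> 'w \<Rightarrow> 'a) \<Rightarrow> 's \<Rightarrow> 'a \<Rightarrow> nat \<Rightarrow> 'w \<Rightarrow> enat" where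
  "return_time X A s l i \<omega> =
    (case (\<Sum>j\<in>{1..<i}. return_time X A s l j \<omega>) of
       enat v \<Rightarrow> Inf {enat m |m. 0 < m \<and> X (v + m) \<omega> = s \<and> A (v + m) \<omega> = l}
     | \<infinity> \<Rightarrow> \<infinity>)"

declare return_time.simps [simp del]

definition visit_time ::
  "(nat \<Rightarrow> 'w \<Rightarrow> 's) \<Rightarrow> (nat \<Rightarrow> 'w \<Rightarrow> 'a) \<Rightarrow> 's \<Rightarrow> 'a \<Rightarrow> nat \<Rightarrow> 'w \<Rightarrow> enat" where
  "visit_time X A s l i \<omega> = (\<Sum>p\<in>{1..i}. return_time X A s l p \<omega>)"

text \<open>The filtration generated by the pairs \<open>(X i, A i)\<close>. The index type \<^typ>\<open>enat\<close> adds the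
  \<open>\<sigma>\<close>-algebra generated by the whole process at \<open>\<infinity>\<close>, as visit times may be infinite.\<close>

definition history_filtration ::
  "'w measure \<Rightarrow> (nat \<Rightarrow> 'w \<Rightarrow> 's) \<Rightarrow> (nat \<Rightarrow> 'w \<Rightarrow> 'a) \<Rightarrow> enat \<Rightarrow> 'w measure" where
  "history_filtration P X A j =
    sigma (space P) {{\<omega> \<in> space P. X i \<omega> = s \<and> A i \<omega> = l} |i s l. enat i \<le> j}"

lemma filtration_history_filtration: "filtration (space P) (history_filtration P X A)"
proof
  show "space (history_filtration P X A i) = space P" for i
    unfolding history_filtration_def by (subst space_measure_of_conv) simp
  show "sets (history_filtration P X A i) \<subseteq> sets (history_filtration P X A j)" if "i \<le> j" for i j
  proof -
    have "{{\<omega> \<in> space P. X k \<omega> = s \<and> A k \<omega> = l} |k s l. enat k \<le> j} \<subseteq> Pow (space P)" for j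
      by auto
    then show ?thesis
      unfolding history_filtration_def using that
      by (auto simp: sets_measure_of intro!: sigma_sets_subseteq) (metis order_trans)
  qed
qed

definition return_time_condition ::
  "'w measure \<Rightarrow> (nat \<Rightarrow> 'w \<Rightarrow> 's) \<Rightarrow> (nat \<Rightarrow> 'w \<Rightarrow> 'a) \<Rightarrow> bool" where
  "return_time_condition P X A \<longleftrightarrow>
    (\<forall>s l. \<exists>\<alpha> T. 0 < \<alpha> \<and> \<alpha> < 1 \<and> T \<in> O(\<lambda>i. real i powr \<alpha>) \<and>
      (\<forall>i\<ge>1. AE \<omega> in P.
        nn_cond_exp P
          (filtration.pre_sigma (space P) (history_filtration P X A) (visit_time X A s l (i - 1)))
          (\<lambda>\<omega>. ennreal_of_enat (return_time X A s l i \<omega>)) \<omega>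
        \<le> ennreal (T i)))"

definition weak_mixing_coeff ::
  "'w measure \<Rightarrow> (nat \<Rightarrow> 'w \<Rightarrow> 's) \<Rightarrow> (nat \<Rightarrow> 'w \<Rightarrow> 'a) \<Rightarrow> nat \<Rightarrow> nat \<Rightarrow> nat \<Rightarrow> real" where
  "weak_mixing_coeff P X A n i j =
    Sup {\<bar>\<P>(\<omega> in P. trajectory X A j (Suc n) \<omega> \<in> \<T> \<bar> X i \<omega> = s1 \<and> A i \<omega> = l1 \<and> trajectory X A 0 i \<omega> = h)
          - \<P>(\<omega> in P. trajectory X A j (Suc n) \<omega> \<in> \<T> \<bar> X i \<omega> = s2 \<and> A i \<omega> = l2 \<and> trajectory X A 0 i \<omega> = h)\<bar>
         |\<T> s1 s2 l1 l2 h.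
           \<T> \<subseteq> {x. length x = n - j + 1} \<and> length h = i \<and>
           \<P>(\<omega> in P. X i \<omega> = s1 \<and> A i \<omega> = l1 \<and> trajectory X A 0 i \<omega> = h) > 0 \<and>
           \<P>(\<omega> in P. X i \<omega> = s2 \<and> A i \<omega> = l2 \<and> trajectory X A 0 i \<omega> = h) > 0}"

definition mixing_norm ::
  "'w measure \<Rightarrow> (nat \<Rightarrow> 'w \<Rightarrow> 's) \<Rightarrow> (nat \<Rightarrow> 'w \<Rightarrow> 'a) \<Rightarrow> nat \<Rightarrow> real" where
  "mixing_norm P X A n = Max ((\<lambda>i. 1 + (\<Sum>j\<in>{i<..n}. weak_mixing_coeff P X A n i j)) ` {1..n})"

text \<open>The law of the sum of squares of \<open>r\<close> independent standard normal variables; in particular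
  the point mass at \<open>0\<close> for \<open>r = 0\<close>.\<close>

definition chi_square_distribution :: "nat \<Rightarrow> real measure" where
  "chi_square_distribution r =
    distr (\<Pi>\<^sub>M i\<in>{..<r}. std_normal_distribution) borel (\<lambda>z. \<Sum>i<r. (z i)\<^sup>2)"

text \<open>The library notion \<^const>\<open>weak_conv_m\<close> is restricted to measures on the real line. For
  random vectors, weak convergence is tested on bounded continuous functions.\<close>

definition weak_conv_vec :: "(nat \<Rightarrow> (real ^ 'i::finite) measure) \<Rightarrow> (real ^ 'i) measure \<Rightarrow> bool" where
  "weak_conv_vec \<mu> \<nu> \<longleftrightarrow>
    (\<forall>f :: real ^ 'i \<Rightarrow> real. continuous_on UNIV f \<and> bounded (range f) \<longrightarrow>
      (\<lambda>n. integral\<^sup>L (\<mu> n) f) \<longlonglongrightarrow> integral\<^sup>L \<nu> f)"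

text \<open>\<open>\<nu>\<close> is the law of the limiting vector, which is realised by the coordinate maps on
  \<open>\<nu>\<close> itself.\<close>

definition asymptotically_independent ::
  "'w measure \<Rightarrow> (nat \<Rightarrow> 'w \<Rightarrow> real ^ 'i::finite) \<Rightarrow> bool" where
  "asymptotically_independent P Z \<longleftrightarrow>
    (\<exists>\<nu> :: (real ^ 'i) measure. prob_space \<nu> \<and> sets \<nu> = sets borel \<and>
      prob_space.indep_vars \<nu> (\<lambda>_. borel) (\<lambda>i z. z $ i) UNIV \<and>
      weak_conv_vec (\<lambda>n. distr P borel (Z n)) \<nu>)"

end

theory Submission
  imports Defs "HOL-Real_Asymp.Real_Asymp"
begin

text \<open>The mixing norm ignores the time \<open>0\<close>, so the argument conditions on the value of
  \<open>(X 0, A 0)\<close>. Martingale differences along the history then give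
  \<open>Var (N n) \<le> n C\<^sup>2\<close> for the number \<open>N n\<close> of visits to a pair \<open>(s, l)\<close>, while the return
  times give \<open>E (N n) \<ge> c n powr (1 / (1 + \<alpha>))\<close>, which is of larger order than \<open>sqrt n\<close>. Hence
  \<open>N n / E (N n)\<close> tends to \<open>1\<close> in mean, under each of the conditioned measures.

  For the central limit theorem, the transitions out of each pair \<open>p\<close> are cut off after \<open>K p\<close>
  visits, and the missing ones are replaced by the mean of their exponential factor. The resulting
  product has exactly the expectation that independent transitions would give, and since
  \<open>N n / E (N n)\<close> tends to \<open>1\<close>, the padding is asymptotically deterministic and can be divided out.

  A reflection taking the vector of the \<open>sqrt (M s l t)\<close> to a coordinate vector turns the
  standardised residuals into asymptotically independent standard normal variables, one fewer than
  the support of \<open>M s l\<close>; the statistic is the sum of their squares times \<open>E (N n) / N n\<close>.\<close>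

section \<open>Characteristic functions and weak convergence on Euclidean spaces\<close>

text \<open>The number of transitions out of a pair is random and depends on the same path, and all
  that is known of it is that its ratio to its mean tends to 1 in mean. Dividing the exponential of
  the counts by the conditional means of its factors would give a product of expectation 1, but
  these means may vanish and their inverse powers need not be bounded. Padding up to a cap avoids
  every inverse: the product stays in the unit disc, where convergence in mean suffices. The cap is
  about twice the expected number of visits, so it is exceeded only on a relative deviation of at
  least 1; the padding then tends to a positive constant and the whole product to the square of that
  constant. Conditioning on the initial pair is a real obstacle: a policy may remember
  \<open>(X 0, A 0)\<close> forever, and then the visits, divided by their unconditional mean, may
  keep a random limit. The limit of the statistics is the same for every initial pair, so averaging
  over the initial law does no harm. The statistics are quotients, so residuals and visit ratios
  have to converge jointly; hence the preparation on Euclidean spaces.\<close>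

inductive trig_poly :: "('b::euclidean_space \<Rightarrow> complex) \<Rightarrow> bool" where
  cis: "trig_poly (\<lambda>x. c * cis (u \<bullet> x))"
| add: "trig_poly f \<Longrightarrow> trig_poly g \<Longrightarrow> trig_poly (\<lambda>x. f x + g x)"

lemma trig_poly_const: "trig_poly (\<lambda>x::'b::euclidean_space. c)"
  using trig_poly.cis[of c "0::'b"] by simp

lemma trig_poly_mult:
  assumes "trig_poly f" "trig_poly g"
  shows "trig_poly (\<lambda>x. f x * g x)"
  using assms
proof (induction arbitrary: g)
  case (cis c u)
  from cis show ?case
  proof (induction g)
    case (cis d v)
    have "(\<lambda>x. c * cis (u \<bullet> x) * (d * cis (v \<bullet> x))) = (\<lambda>x. c * d * cis ((u + v) \<bullet> x))"
      by (auto simp: inner_add_left cis_mult[symmetric])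
    then show ?case by (simp only: trig_poly.cis)
  next
    case (add f g)
    then show ?case unfolding distrib_left by (intro trig_poly.add)
  qed
next
  case (add f1 f2)
  show ?case unfolding distrib_right by (intro trig_poly.add add.IH add.prems)
qed

lemma trig_poly_scale: "trig_poly f \<Longrightarrow> trig_poly (\<lambda>x. c * f x)"
  using trig_poly_mult[OF trig_poly_const] .

lemma trig_poly_sum: "(\<And>i. i \<in> I \<Longrightarrow> trig_poly (f i)) \<Longrightarrow> trig_poly (\<lambda>x. \<Sum>i\<in>I. f i x)"
  by (induction I rule: infinite_finite_induct) (simp_all add: trig_poly.add trig_poly_const)

lemma trig_poly_sin: "trig_poly (\<lambda>x. complex_of_real (sin (u \<bullet> x)))"
proof -
  have "(\<lambda>x. complex_of_real (sin (u \<bullet> x)))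
      = (\<lambda>x. (- \<i> / 2) * cis (u \<bullet> x) + (\<i> / 2) * cis ((- u) \<bullet> x))"
    by (auto simp: complex_eq_iff)
  then show ?thesis by (simp only: trig_poly.add trig_poly.cis)
qed

lemma trig_poly_continuous: "trig_poly f \<Longrightarrow> continuous_on UNIV f"
  by (induction rule: trig_poly.induct) (auto intro!: continuous_intros)

lemma trig_poly_bounded: "trig_poly f \<Longrightarrow> \<exists>B. \<forall>x. norm (f x) \<le> B"
proof (induction rule: trig_poly.induct)
  case (cis c u)
  then show ?case by (auto simp: norm_mult)
next
  case (add f g)
  then obtain B C where "\<forall>x. norm (f x) \<le> B" "\<forall>x. norm (g x) \<le> C" by auto
  then show ?case by (intro exI[of _ "B + C"]) (auto intro: norm_triangle_mono)
qed

text \<open>Replacing coordinates by sines turns a polynomial, which is unbounded in general, into a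
  bounded member of the class whose integrals are governed by characteristic functions. Closure of
  that class under products does the work.\<close>

lemma trig_poly_real_polynomial_sin:
  fixes p :: "'b::euclidean_space \<Rightarrow> real"
  assumes "real_polynomial_function p"
  shows "trig_poly (\<lambda>x. complex_of_real (p (\<Sum>b\<in>Basis. sin (x \<bullet> b / L) *\<^sub>R b)))"
  using assms
proof induction
  case (linear f)
  have "(\<lambda>x. complex_of_real (f (\<Sum>b\<in>Basis. sin (x \<bullet> b / L) *\<^sub>R b)))
      = (\<lambda>x. \<Sum>b\<in>Basis. complex_of_real (f b) * complex_of_real (sin ((b /\<^sub>R L) \<bullet> x)))"
    by (simp add: linear_sum[OF bounded_linear.linear[OF linear]]
        linear_scale[OF bounded_linear.linear[OF linear]] inner_commute divide_inverse mult.commute)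
  then show ?case
    by (simp only: trig_poly_sum trig_poly_scale trig_poly_sin)
next
  case (const c)
  show ?case by (rule trig_poly_const)
next
  case (add f g)
  then show ?case unfolding of_real_add by (intro trig_poly.add)
next
  case (mult f g)
  then show ?case unfolding of_real_mult by (intro trig_poly_mult)
qed

lemma integrable_bounded_continuous:
  fixes f :: "'b::euclidean_space \<Rightarrow> 'c::{banach, second_countable_topology}"
  assumes "prob_space \<mu>" "sets \<mu> = sets borel" "continuous_on UNIV f" "\<And>x. norm (f x) \<le> B"
  shows "integrable \<mu> f"
proof -
  interpret prob_space \<mu> by fact
  have [measurable_cong]: "sets \<mu> = sets borel" by fact
  show ?thesis
    using assms(3,4) borel_measurable_continuous_onI[OF assms(3)]
    by (intro integrable_const_bound[of _ B]) (auto simp: measurable_cong_sets[OF assms(2) refl])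
qed

lemma trig_poly_integral_tendsto:
  fixes \<mu> :: "nat \<Rightarrow> 'b::euclidean_space measure"
  assumes \<mu>: "\<And>n. prob_space (\<mu> n)" "\<And>n. sets (\<mu> n) = sets borel"
    and \<nu>: "prob_space \<nu>" "sets \<nu> = sets borel"
    and chf: "\<And>u. (\<lambda>n. \<integral>x. cis (u \<bullet> x) \<partial>\<mu> n) \<longlonglongrightarrow> (\<integral>x. cis (u \<bullet> x) \<partial>\<nu>)"
    and "trig_poly f"
  shows "(\<lambda>n. \<integral>x. f x \<partial>\<mu> n) \<longlonglongrightarrow> (\<integral>x. f x \<partial>\<nu>)"
  using \<open>trig_poly f\<close>
proof induction
  case (cis c u)
  then show ?case using chf by (auto intro: tendsto_intros)
next
  case (add f g)
  have i: "integrable m h" if "prob_space m" "sets m = sets borel" "trig_poly h" for m and h :: "'b \<Rightarrow> complex"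
    using trig_poly_bounded[OF that(3)] trig_poly_continuous[OF that(3)]
      integrable_bounded_continuous[OF that(1,2)] by blast
  from add show ?case
    by (simp add: i \<mu> \<nu> tendsto_add)
qed

text \<open>A continuous substitute for the indicator of \<open>\<bar>t\<bar> > R + 1\<close>, so
  that bounds on tail masses pass to weak limits.\<close>

definition tail_cutoff :: "real \<Rightarrow> real \<Rightarrow> real" where
  "tail_cutoff R t = min 1 (max 0 (\<bar>t\<bar> - R))"

lemma tail_cutoff_bounds: "0 \<le> tail_cutoff R t" "tail_cutoff R t \<le> 1"
  by (auto simp: tail_cutoff_def)

lemma continuous_on_tail_cutoff [continuous_intros]:
  "continuous_on S f \<Longrightarrow> continuous_on S (\<lambda>x. tail_cutoff R (f x))"
  unfolding tail_cutoff_def by (intro continuous_intros)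

lemma tail_cutoff_integral_tendsto:
  fixes \<nu> :: "'b::euclidean_space measure"
  assumes "prob_space \<nu>" "sets \<nu> = sets borel"
  shows "(\<lambda>k. \<integral>x. tail_cutoff (real k) (x \<bullet> b) \<partial>\<nu>) \<longlonglongrightarrow> 0"
proof -
  interpret prob_space \<nu> by fact
  have [measurable_cong]: "sets \<nu> = sets borel" by fact
  have "(\<lambda>k. \<integral>x. tail_cutoff (real k) (x \<bullet> b) \<partial>\<nu>) \<longlonglongrightarrow> (\<integral>x. 0 \<partial>\<nu>)"
  proof (rule integral_dominated_convergence[where w="\<lambda>_. 1"])
    show "(\<lambda>x. tail_cutoff (real k) (x \<bullet> b)) \<in> borel_measurable \<nu>" for k
      by (auto intro!: borel_measurable_continuous_onI continuous_intros
          simp: measurable_cong_sets[OF assms(2) refl])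
    show "AE x in \<nu>. (\<lambda>k. tail_cutoff (real k) (x \<bullet> b)) \<longlonglongrightarrow> 0"
    proof (rule AE_I2, rule tendsto_eventually)
      fix x
      show "\<forall>\<^sub>F k in sequentially. tail_cutoff (real k) (x \<bullet> b) = 0"
        using eventually_ge_at_top[of "nat \<lceil>\<bar>x \<bullet> b\<bar>\<rceil>"]
        by eventually_elim (simp add: tail_cutoff_def nat_le_iff ceiling_le_iff)
    qed
  qed (auto simp: tail_cutoff_bounds abs_of_nonneg)
  then show ?thesis by simp
qed

text \<open>The characteristic function of \<open>x \<bullet> b\<close> at \<open>t\<close> is that
  of the vector at \<open>t *\<^sub>R b\<close>, so the theorem on the real line applies to each
  projection. Applied to tail cutoffs of the coordinates, this supplies tightness.\<close>

lemma levy_continuity_marginal: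
  fixes \<mu> :: "nat \<Rightarrow> 'b::euclidean_space measure"
  assumes \<mu>: "\<And>n. prob_space (\<mu> n)" "\<And>n. sets (\<mu> n) = sets borel"
    and \<nu>: "prob_space \<nu>" "sets \<nu> = sets borel"
    and chf: "\<And>u. (\<lambda>n. \<integral>x. cis (u \<bullet> x) \<partial>\<mu> n) \<longlonglongrightarrow> (\<integral>x. cis (u \<bullet> x) \<partial>\<nu>)"
    and g: "continuous_on UNIV (g :: real \<Rightarrow> real)" "\<And>t. \<bar>g t\<bar> \<le> B"
  shows "(\<lambda>n. \<integral>x. g (x \<bullet> b) \<partial>\<mu> n) \<longlonglongrightarrow> (\<integral>x. g (x \<bullet> b) \<partial>\<nu>)"
proof -
  let ?d = "\<lambda>m. distr m borel (\<lambda>x. x \<bullet> b)"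
  have meas: "(\<lambda>x. x \<bullet> b) \<in> borel_measurable m" if "sets m = sets borel" for m :: "'b measure"
    using that by (simp add: measurable_cong_sets[OF that refl])
  have rd: "real_distribution (?d m)" if "prob_space m" "sets m = sets borel" for m
    using prob_space.real_distribution_distr[OF that(1) meas[OF that(2)]] .
  have ch: "char (?d m) t = (\<integral>x. cis ((t *\<^sub>R b) \<bullet> x) \<partial>m)" if "sets m = sets borel" for m t
    unfolding char_def cis_conv_exp[symmetric]
    by (subst integral_distr[OF meas[OF that]])
      (auto simp: inner_commute intro!: borel_measurable_continuous_onI continuous_intros)
  have "weak_conv_m (\<lambda>n. ?d (\<mu> n)) (?d \<nu>)"
    by (rule levy_continuity) (simp_all only: ch \<mu> \<nu> rd chf)
  then have "(\<lambda>n. integral\<^sup>L (?d (\<mu> n)) g) \<longlonglongrightarrow> integral\<^sup>L (?d \<nu>) g"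
    using g by (intro weak_conv_imp_integral_bdd_continuous_conv[where B=B])
      (auto simp: rd \<mu> \<nu> continuous_on_eq_continuous_at)
  then show ?thesis
    using g(1) by (simp add: integral_distr meas \<mu> \<nu> borel_measurable_continuous_onI)
qed

lemma norm_diff_integral_le:
  fixes f q \<psi> :: "'b::euclidean_space \<Rightarrow> real"
  assumes m: "prob_space m" "integrable m f" "integrable m q" "integrable m \<psi>"
    and le: "\<And>x. \<bar>f x - q x\<bar> \<le> e + c * \<psi> x"
  shows "\<bar>(\<integral>x. f x \<partial>m) - (\<integral>x. q x \<partial>m)\<bar> \<le> e + c * (\<integral>x. \<psi> x \<partial>m)"
proof -
  interpret prob_space m by fact
  have "\<bar>(\<integral>x. f x \<partial>m) - (\<integral>x. q x \<partial>m)\<bar> = \<bar>\<integral>x. f x - q x \<partial>m\<bar>"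
    using m by simp
  also have "\<dots> \<le> (\<integral>x. \<bar>f x - q x\<bar> \<partial>m)"
    by (rule integral_abs_bound)
  also have "\<dots> \<le> (\<integral>x. e + c * \<psi> x \<partial>m)"
    using m le by (intro integral_mono) auto
  also have "\<dots> = e + c * (\<integral>x. \<psi> x \<partial>m)"
    using m by (simp add: prob_space)
  finally show ?thesis .
qed

text \<open>A polynomial in the sines of the rescaled coordinates approximates the test function on a
  large cube, and by periodicity it stays bounded by \<open>B + e\<close> outside.\<close>

lemma trig_poly_approximation:
  fixes f :: "'b::euclidean_space \<Rightarrow> real"
  assumes f: "continuous_on UNIV f" "\<And>x. \<bar>f x\<bar> \<le> B" and e: "0 < e" and R: "0 \<le> R"
  obtains q where "trig_poly (\<lambda>x. complex_of_real (q x))"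
    "\<And>x. \<bar>f x - q x\<bar> \<le> e + (2 * B + e) * (\<Sum>b\<in>Basis. tail_cutoff R (x \<bullet> b))"
    "\<And>x. \<bar>q x\<bar> \<le> B + e" "continuous_on UNIV q"
proof -
  \<comment> \<open>The cutoff at \<open>R\<close> equals 1 from \<open>R + 1\<close> on: within the
    cube of half side \<open>L\<close> the polynomial itself must be close, beyond it the cutoff
    term pays.\<close>
  define L where "L = R + 1"
  have L: "L > 0" using R by (simp add: L_def)
  define S where "S = cbox (- One) (One :: 'b)"
  have inS: "y \<in> S \<longleftrightarrow> (\<forall>b\<in>Basis. -1 \<le> y \<bullet> b \<and> y \<bullet> b \<le> 1)" for y
    by (simp add: S_def mem_box)
  let ?k = "\<lambda>y. \<Sum>b\<in>Basis. (L * arcsin (y \<bullet> b)) *\<^sub>R b"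
  let ?s = "\<lambda>x::'b. \<Sum>b\<in>Basis. sin (x \<bullet> b / L) *\<^sub>R b"
  have "continuous_on S (\<lambda>y. f (?k y))"
  proof (rule continuous_on_compose2[OF f(1)])
    show "continuous_on S ?k"
      by (intro continuous_intros) (auto simp: inS)
  qed auto
  then obtain p where p: "real_polynomial_function p" "\<And>y. y \<in> S \<Longrightarrow> \<bar>f (?k y) - p y\<bar> < e"
    using Stone_Weierstrass_real_polynomial_function[of S "\<lambda>y. f (?k y)" e] e
    by (auto simp: S_def)
  have sS: "?s x \<in> S" for x
    by (auto simp: inS)
  define q where "q = (\<lambda>x. p (?s x))"
  have q_bd: "\<bar>q x\<bar> \<le> B + e" for x
    using p(2)[OF sS[of x]] f(2)[of "?k (?s x)"] by (simp add: q_def)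
  have le: "\<bar>f x - q x\<bar> \<le> e + (2 * B + e) * (\<Sum>b\<in>Basis. tail_cutoff R (x \<bullet> b))" for x
  proof (cases "\<forall>b\<in>Basis. \<bar>x \<bullet> b\<bar> \<le> L")
    case True
    have "?k (?s x) = (\<Sum>b\<in>Basis. (x \<bullet> b) *\<^sub>R b)"
    proof (rule sum.cong[OF refl])
      fix b :: 'b assume b: "b \<in> Basis"
      then have "\<bar>x \<bullet> b / L\<bar> \<le> 1" using True L by (simp add: abs_divide)
      then have "- 1 \<le> x \<bullet> b / L" "x \<bullet> b / L \<le> 1" by linarith+
      then have "arcsin (sin (x \<bullet> b / L)) = x \<bullet> b / L"
        using pi_ge_two by (intro arcsin_sin) linarith+
      then show "(L * arcsin (?s x \<bullet> b)) *\<^sub>R b = (x \<bullet> b) *\<^sub>R b"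
        using L b by simp
    qed
    then have "\<bar>f x - q x\<bar> < e"
      using p(2)[OF sS[of x]] by (simp add: q_def euclidean_representation)
    moreover have "0 \<le> (2 * B + e) * (\<Sum>b\<in>Basis. tail_cutoff R (x \<bullet> b))"
      using f(2)[of 0] e by (intro mult_nonneg_nonneg sum_nonneg) (auto simp: tail_cutoff_bounds)
    ultimately show ?thesis by linarith
  next
    case False
    then obtain b0 where b0: "b0 \<in> Basis" "\<bar>x \<bullet> b0\<bar> > L" by force
    then have "1 = tail_cutoff R (x \<bullet> b0)" by (simp add: tail_cutoff_def L_def)
    also have "\<dots> \<le> (\<Sum>b\<in>Basis. tail_cutoff R (x \<bullet> b))"
      using b0 by (intro member_le_sum) (auto simp: tail_cutoff_bounds)
    finally have "(2 * B + e) * 1 \<le> (2 * B + e) * (\<Sum>b\<in>Basis. tail_cutoff R (x \<bullet> b))"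
      using f(2)[of 0] e by (intro mult_left_mono) auto
    moreover have "\<bar>f x - q x\<bar> \<le> e + (2 * B + e) * 1"
      using f(2)[of x] q_bd[of x] e abs_triangle_ineq4[of "f x" "q x"] by simp
    ultimately show ?thesis by linarith
  qed
  have "continuous_on UNIV (\<lambda>x. Re (complex_of_real (q x)))"
    using trig_poly_continuous[OF trig_poly_real_polynomial_sin[OF p(1), of L]]
    unfolding q_def by (intro continuous_on_Re)
  then show ?thesis
    using that[of q] trig_poly_real_polynomial_sin[OF p(1), of L] le q_bd by (simp add: q_def)
qed

text \<open>The test function is exchanged for a trigonometric polynomial under both measures. The
  error is small up to a tail term, and tails are controlled by the convergence of the
  one-dimensional projections, so tightness need not be assumed.\<close>

theorem levy_continuity_euclidean:
  fixes \<mu> :: "nat \<Rightarrow> 'b::euclidean_space measure"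
  assumes \<mu>: "\<And>n. prob_space (\<mu> n)" "\<And>n. sets (\<mu> n) = sets borel"
    and \<nu>: "prob_space \<nu>" "sets \<nu> = sets borel"
    and chf: "\<And>u. (\<lambda>n. \<integral>x. cis (u \<bullet> x) \<partial>\<mu> n) \<longlonglongrightarrow> (\<integral>x. cis (u \<bullet> x) \<partial>\<nu>)"
    and f: "continuous_on UNIV f" "\<And>x. \<bar>f x\<bar> \<le> B"
  shows "(\<lambda>n. \<integral>x. f x \<partial>\<mu> n) \<longlonglongrightarrow> (\<integral>x. f x \<partial>\<nu> :: real)"
proof (rule LIMSEQ_I)
  fix r :: real assume r: "0 < r"
  have B: "0 \<le> B" using f(2)[of 0] by linarith
  \<comment> \<open>The errors add up to \<open>e * (4 * B + 5)\<close>: once \<open>e\<close> for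
    the trigonometric polynomial, and twice \<open>e + (2 * B + 1) * e\<close> for passing to it.
    The minimum with 1 bounds \<open>2 * B + e\<close> by \<open>2 * B + 1\<close>.\<close>
  define e where "e = min 1 (r / (2 * (2 * B + 3)))"
  have e: "0 < e" "e \<le> 1" "e * (2 * (2 * B + 3)) \<le> r"
  proof -
    have "e \<le> r / (2 * (2 * B + 3))" by (simp add: e_def)
    then show "e * (2 * (2 * B + 3)) \<le> r"
      using B by (subst (asm) pos_le_divide_eq) auto
  qed (use r B in \<open>auto simp: e_def\<close>)
  let ?\<psi> = "\<lambda>R x::'b. \<Sum>b\<in>Basis. tail_cutoff R (x \<bullet> b)"
  have i_tail: "integrable m (\<lambda>x. tail_cutoff R (x \<bullet> b))"
    if "prob_space m" "sets m = sets borel" for m :: "'b measure" and R b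
    using that by (rule integrable_bounded_continuous[where B=1])
      (auto intro!: continuous_intros simp: tail_cutoff_bounds abs_of_nonneg)
  have "(\<lambda>k. \<integral>x. ?\<psi> (real k) x \<partial>\<nu>) \<longlonglongrightarrow> (\<Sum>b\<in>(Basis::'b set). 0)"
    by (simp only: Bochner_Integration.integral_sum i_tail \<nu>, intro tendsto_sum)
      (use tail_cutoff_integral_tendsto \<nu> in auto)
  then have "\<forall>\<^sub>F k in sequentially. (\<integral>x. ?\<psi> (real k) x \<partial>\<nu>) < e"
    using e by (intro order_tendstoD) auto
  then obtain k where k: "(\<integral>x. ?\<psi> (real k) x \<partial>\<nu>) < e"
    by (auto simp: eventually_sequentially)
  define \<psi> where "\<psi> = ?\<psi> (real k)"
  obtain q where q: "trig_poly (\<lambda>x. complex_of_real (q x))"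
    "\<And>x. \<bar>f x - q x\<bar> \<le> e + (2 * B + e) * \<psi> x"
    "\<And>x. \<bar>q x\<bar> \<le> B + e" "continuous_on UNIV q"
    unfolding \<psi>_def using trig_poly_approximation[OF f e(1), of "real k"] by auto
  have i\<psi>: "integrable m \<psi>" if "prob_space m" "sets m = sets borel" for m :: "'b measure"
    unfolding \<psi>_def using that i_tail by auto
  have dist: "\<bar>(\<integral>x. f x \<partial>m) - (\<integral>x. q x \<partial>m)\<bar> \<le> e + (2 * B + e) * (\<integral>x. \<psi> x \<partial>m)"
    if "prob_space m" "sets m = sets borel" for m
    using that q f i\<psi> by (intro norm_diff_integral_le)
      (auto intro: integrable_bounded_continuous[where B=B] integrable_bounded_continuous[where B="B + e"])
  have "(\<lambda>n. \<integral>x. complex_of_real (q x) \<partial>\<mu> n) \<longlonglongrightarrow> (\<integral>x. complex_of_real (q x) \<partial>\<nu>)"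
    by (rule trig_poly_integral_tendsto[OF \<mu> \<nu> chf q(1)])
  then have "(\<lambda>n. \<integral>x. q x \<partial>\<mu> n) \<longlonglongrightarrow> (\<integral>x. q x \<partial>\<nu>)"
    by (simp add: tendsto_of_real_iff)
  then have ev1: "\<forall>\<^sub>F n in sequentially. \<bar>(\<integral>x. q x \<partial>\<mu> n) - (\<integral>x. q x \<partial>\<nu>)\<bar> < e"
    using e(1) by (auto simp: tendsto_iff dist_real_def)
  \<comment> \<open>The cube was chosen for the limit law alone; convergence of the marginals makes
    it large enough for all \<open>\<mu> n\<close> with \<open>n\<close> large.\<close>
  have "(\<lambda>n. \<Sum>b\<in>Basis. \<integral>x. tail_cutoff (real k) (x \<bullet> b) \<partial>\<mu> n)
      \<longlonglongrightarrow> (\<Sum>b\<in>Basis. \<integral>x. tail_cutoff (real k) (x \<bullet> b) \<partial>\<nu>)"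
    by (intro tendsto_sum levy_continuity_marginal[OF \<mu> \<nu> chf, where B=1])
      (auto intro!: continuous_intros simp: tail_cutoff_bounds abs_of_nonneg)
  then have "(\<lambda>n. \<integral>x. \<psi> x \<partial>\<mu> n) \<longlonglongrightarrow> (\<integral>x. \<psi> x \<partial>\<nu>)"
    unfolding \<psi>_def by (simp add: i_tail \<mu> \<nu>)
  then have ev2: "\<forall>\<^sub>F n in sequentially. (\<integral>x. \<psi> x \<partial>\<mu> n) < e"
    using k by (intro order_tendstoD(2)) (auto simp: \<psi>_def)
  from ev1 ev2 have "\<forall>\<^sub>F n in sequentially. norm ((\<integral>x. f x \<partial>\<mu> n) - (\<integral>x. f x \<partial>\<nu>)) < r"
  proof eventually_elim
    case (elim n)
    have *: "\<bar>(\<integral>x. f x \<partial>m) - (\<integral>x. q x \<partial>m)\<bar> \<le> e + (2 * B + 1) * e"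
      if "prob_space m" "sets m = sets borel" "(\<integral>x. \<psi> x \<partial>m) < e" for m
    proof -
      have "(2 * B + e) * (\<integral>x. \<psi> x \<partial>m) \<le> (2 * B + 1) * e"
        using that e B by (intro mult_mono Bochner_Integration.integral_nonneg)
          (auto intro!: sum_nonneg simp: \<psi>_def tail_cutoff_bounds)
      then show ?thesis using dist[OF that(1,2)] by linarith
    qed
    have "\<bar>(\<integral>x. f x \<partial>\<mu> n) - (\<integral>x. f x \<partial>\<nu>)\<bar> < e + 2 * (e + (2 * B + 1) * e)"
      using elim(1) *[OF \<mu> elim(2)] *[OF \<nu> k[folded \<psi>_def]]
      unfolding abs_if by (auto split: if_splits)
    also have "\<dots> \<le> r"
      using e B by (simp add: algebra_simps)
    finally show ?case by simp
  qed
  then show "\<exists>no. \<forall>n\<ge>no. norm ((\<integral>x. f x \<partial>\<mu> n) - (\<integral>x. f x \<partial>\<nu>)) < r"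
    by (simp add: eventually_sequentially)
qed

section \<open>Transitions of a controlled Markov chain\<close>

lemma trajectory_Suc: "i \<le> j \<Longrightarrow> trajectory X A i (Suc j) \<omega> = trajectory X A i j \<omega> @ [(X j \<omega>, A j \<omega>)]"
  by (simp add: trajectory_def)

lemma length_trajectory [simp]: "length (trajectory X A i j \<omega>) = j - i"
  by (simp add: trajectory_def)

lemma nth_trajectory: "m < j - i \<Longrightarrow> trajectory X A i j \<omega> ! m = (X (i + m) \<omega>, A (i + m) \<omega>)"
  by (simp add: trajectory_def)

lemma trajectory_eq_iff:
  "trajectory X A i j \<omega> = trajectory X A i j \<omega>' \<longleftrightarrow>
    (\<forall>m. i \<le> m \<and> m < j \<longrightarrow> X m \<omega> = X m \<omega>' \<and> A m \<omega> = A m \<omega>')"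
  by (auto simp: trajectory_def)

lemma finite_histories: "finite {h :: 'c::finite list. length h = m}"
  using finite_lists_length_eq[of "UNIV :: 'c set" m] by simp

text \<open>Only measurability is required, so that the results hold for the measures conditioned on
  the initial pair as well as for the original one.\<close>

locale observed_process = prob_space P
  for P :: "'w measure" +
  fixes X :: "nat \<Rightarrow> 'w \<Rightarrow> 's::finite" and A :: "nat \<Rightarrow> 'w \<Rightarrow> 'a::finite"
  assumes measurable_X [measurable]: "\<And>i. X i \<in> P \<rightarrow>\<^sub>M count_space UNIV"
    and measurable_A [measurable]: "\<And>i. A i \<in> P \<rightarrow>\<^sub>M count_space UNIV"
begin

abbreviation "history m \<equiv> trajectory X A 0 m"

text \<open>A pointwise form of adaptedness. Since there are finitely many histories of a given
  length, such functions are measurable and integrable without further hypotheses.\<close>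

definition history_determined :: "nat \<Rightarrow> ('w \<Rightarrow> 'c) \<Rightarrow> bool" where
  "history_determined m U \<longleftrightarrow> (\<forall>\<omega> \<omega>'. history m \<omega> = history m \<omega>' \<longrightarrow> U \<omega> = U \<omega>')"

lemma measurable_trajectory [measurable]: "trajectory X A i j \<in> P \<rightarrow>\<^sub>M count_space UNIV"
proof (rule measurable_count_space_eq_countable[THEN iffD2])
  show "countable (UNIV :: ('s \<times> 'a) list set)" by simp
  have "trajectory X A i j -` {h} \<inter> space P
      = {\<omega> \<in> space P. length h = j - i \<and> (\<forall>m < j - i. X (i + m) \<omega> = fst (h ! m) \<and> A (i + m) \<omega> = snd (h ! m))}" for h
    by (auto simp: list_eq_iff_nth_eq nth_trajectory prod_eq_iff)
  also have "\<dots> h \<in> sets P" for h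
    by measurable
  finally show "trajectory X A i j \<in> space P \<rightarrow> UNIV \<and> (\<forall>h\<in>UNIV. trajectory X A i j -` {h} \<inter> space P \<in> sets P)"
    by auto
qed

lemma history_determinedD:
  "history_determined m U \<Longrightarrow> history m \<omega> = history m \<omega>' \<Longrightarrow> U \<omega> = U \<omega>'"
  unfolding history_determined_def by blast

lemma history_determined_comp: "history_determined m U \<Longrightarrow> history_determined m (\<lambda>\<omega>. f (U \<omega>))"
  unfolding history_determined_def by (intro allI impI arg_cong[where f=f]) blast

lemma history_determinedE:
  assumes "history_determined m U"
  obtains u where "U = (\<lambda>\<omega>. u (history m \<omega>))"
proof
  show "U = (\<lambda>\<omega>. (\<lambda>h. U (SOME \<omega>'. history m \<omega>' = h)) (history m \<omega>))"
  proof
    fix \<omega>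
    have "history m (SOME \<omega>'. history m \<omega>' = history m \<omega>) = history m \<omega>"
      by (rule someI[of _ \<omega>]) simp
    then show "U \<omega> = U (SOME \<omega>'. history m \<omega>' = history m \<omega>)"
      using history_determinedD[OF assms] by metis
  qed
qed

lemma measurable_history_determined:
  "history_determined m U \<Longrightarrow> range U \<subseteq> space N \<Longrightarrow> U \<in> P \<rightarrow>\<^sub>M N"
proof (erule history_determinedE)
  fix u assume u: "U = (\<lambda>\<omega>. u (history m \<omega>))" and N: "range U \<subseteq> space N"
  \<comment> \<open>Lists that are no history are sent to some value of \<open>U\<close>, which
    keeps the map within \<open>space N\<close>.\<close>
  let ?V = "\<lambda>h. if h \<in> range (history m) then u h else U undefined"
  have "?V \<in> count_space UNIV \<rightarrow>\<^sub>M N"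
    using N by (auto simp: u image_subset_iff)
  then have "(\<lambda>\<omega>. ?V (history m \<omega>)) \<in> P \<rightarrow>\<^sub>M N"
    by measurable
  then show "U \<in> P \<rightarrow>\<^sub>M N" using u by simp
qed

lemma integral_finite_range:
  fixes u :: "'c \<Rightarrow> 'b::{banach, second_countable_topology}"
  assumes [measurable]: "V \<in> P \<rightarrow>\<^sub>M count_space UNIV" and S: "finite S" "\<And>\<omega>. V \<omega> \<in> S"
  shows "integrable P (\<lambda>\<omega>. u (V \<omega>))"
    and "(\<integral>\<omega>. u (V \<omega>) \<partial>P) = (\<Sum>v\<in>S. prob {\<omega> \<in> space P. V \<omega> = v} *\<^sub>R u v)"
proof -
  have eq: "u (V \<omega>) = (\<Sum>v\<in>S. indicator {\<omega> \<in> space P. V \<omega> = v} \<omega> *\<^sub>R u v)" if "\<omega> \<in> space P" for \<omega>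
  proof -
    have "(\<Sum>v\<in>S. indicator {\<omega> \<in> space P. V \<omega> = v} \<omega> *\<^sub>R u v) = (\<Sum>v\<in>S. if v = V \<omega> then u v else 0)"
      using that by (intro sum.cong) (auto simp: indicator_def)
    then show ?thesis using S by simp
  qed
  have i: "integrable P (\<lambda>\<omega>. \<Sum>v\<in>S. indicator {\<omega> \<in> space P. V \<omega> = v} \<omega> *\<^sub>R u v)"
    by (intro Bochner_Integration.integrable_sum integrable_scaleR_left integrable_real_indicator)
      (auto simp: emeasure_eq_measure)
  show "integrable P (\<lambda>\<omega>. u (V \<omega>))"
    using i by (subst Bochner_Integration.integrable_cong[OF refl eq])
  have "(\<integral>\<omega>. u (V \<omega>) \<partial>P) = (\<integral>\<omega>. (\<Sum>v\<in>S. indicator {\<omega> \<in> space P. V \<omega> = v} \<omega> *\<^sub>R u v) \<partial>P)"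
    by (intro Bochner_Integration.integral_cong eq refl)
  also have "\<dots> = (\<Sum>v\<in>S. prob {\<omega> \<in> space P. V \<omega> = v} *\<^sub>R u v)"
    by (subst Bochner_Integration.integral_sum)
      (auto intro!: integrable_scaleR_left integrable_real_indicator sum.cong simp: emeasure_eq_measure)
  finally show "(\<integral>\<omega>. u (V \<omega>) \<partial>P) = (\<Sum>v\<in>S. prob {\<omega> \<in> space P. V \<omega> = v} *\<^sub>R u v)" .
qed

lemma integrable_history_determined:
  fixes U :: "'w \<Rightarrow> 'b::{banach, second_countable_topology}"
  assumes "history_determined m U"
  shows "integrable P U"
proof -
  obtain u where u: "U = (\<lambda>\<omega>. u (history m \<omega>))"
    using assms by (rule history_determinedE)
  show ?thesis
    unfolding u by (rule integral_finite_range(1)[OF _ finite_histories[of m]]) auto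
qed

lemma history_determined_visits: "n \<le> m \<Longrightarrow> history_determined m (visits X A s l n)"
  unfolding history_determined_def visits_def trajectory_eq_iff
  by (intro allI impI sum.cong) auto

lemma history_determined_transitions: "n < m \<Longrightarrow> history_determined m (transitions X A s l t n)"
  unfolding history_determined_def transitions_def trajectory_eq_iff
  by (intro allI impI sum.cong) auto

lemma integrable_visits_deviation: "integrable P (\<lambda>\<omega>. \<bar>real (visits X A s l n \<omega>) / v - 1\<bar>)"
  by (rule integrable_history_determined[OF history_determined_comp[OF history_determined_visits[OF order_refl]]])

lemma measurable_visits [measurable]: "visits X A s l n \<in> P \<rightarrow>\<^sub>M count_space UNIV"
  by (rule measurable_history_determined[OF history_determined_visits[OF order_refl]]) auto

lemma measurable_transitions [measurable]: "transitions X A s l t n \<in> P \<rightarrow>\<^sub>M count_space UNIV"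
  by (rule measurable_history_determined[OF history_determined_transitions[OF lessI]]) auto

end

text \<open>The Markov property and the null hypothesis in a single identity. In product form it
  also holds for histories of probability 0, and conditioning on the initial pair merely rescales
  both sides.\<close>

locale kernel_process = observed_process P X A
  for P :: "'w measure" and X :: "nat \<Rightarrow> 'w \<Rightarrow> 's::finite" and A :: "nat \<Rightarrow> 'w \<Rightarrow> 'a::finite" +
  fixes M :: "'s \<Rightarrow> 'a \<Rightarrow> 's \<Rightarrow> real"
  assumes kernel: "transition_kernel M"
    and history_transition: "\<And>m h t. length h = Suc m \<Longrightarrow>
      \<P>(\<omega> in P. history (Suc m) \<omega> = h \<and> X (Suc m) \<omega> = t)
        = \<P>(\<omega> in P. history (Suc m) \<omega> = h) * M (fst (last h)) (snd (last h)) t"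
begin

lemma M_nonneg: "0 \<le> M s l t" and M_sum: "(\<Sum>t\<in>UNIV. M s l t) = 1"
  using kernel by (auto simp: transition_kernel_def)

text \<open>The conditional law of the next state given the history, tested against functions of
  that history; a finite sum over histories replaces conditional expectations.\<close>

lemma integral_transition:
  fixes U :: "'w \<Rightarrow> complex"
  assumes "history_determined (Suc m) U"
  shows "(\<integral>\<omega>. U \<omega> * of_bool (X (Suc m) \<omega> = t) \<partial>P) = (\<integral>\<omega>. U \<omega> * M (X m \<omega>) (A m \<omega>) t \<partial>P)"
proof -
  obtain u where u: "U = (\<lambda>\<omega>. u (history (Suc m) \<omega>))"
    using assms by (rule history_determinedE)
  let ?S = "{h :: ('s \<times> 'a) list. length h = Suc m}"
  let ?V = "\<lambda>\<omega>. (history (Suc m) \<omega>, X (Suc m) \<omega>)"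
  have V: "?V \<in> P \<rightarrow>\<^sub>M count_space UNIV"
    by (rule measurable_compose_countable'[where I="UNIV" and g="history (Suc m)" and f="\<lambda>h \<omega>. (h, X (Suc m) \<omega>)"])
      auto
  have "(\<integral>\<omega>. U \<omega> * of_bool (X (Suc m) \<omega> = t) \<partial>P)
      = (\<integral>\<omega>. (\<lambda>(h, x). u h * of_bool (x = t)) (?V \<omega>) \<partial>P)"
    by (simp add: u)
  also have "\<dots> = (\<Sum>v\<in>?S \<times> UNIV. prob {\<omega> \<in> space P. ?V \<omega> = v} *\<^sub>R (\<lambda>(h, x). u h * of_bool (x = t)) v)"
    by (rule integral_finite_range(2)[OF V]) (auto simp: finite_histories)
  also have "\<dots> = (\<Sum>h\<in>?S. \<Sum>x\<in>UNIV. prob {\<omega> \<in> space P. ?V \<omega> = (h, x)} *\<^sub>R (u h * of_bool (x = t)))"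
    by (subst sum.cartesian_product) (auto intro!: sum.cong)
  also have "\<dots> = (\<Sum>h\<in>?S. prob {\<omega> \<in> space P. history (Suc m) \<omega> = h \<and> X (Suc m) \<omega> = t} *\<^sub>R u h)"
  proof (rule sum.cong[OF refl])
    fix h
    show "(\<Sum>x\<in>UNIV. prob {\<omega> \<in> space P. ?V \<omega> = (h, x)} *\<^sub>R (u h * of_bool (x = t)))
        = prob {\<omega> \<in> space P. history (Suc m) \<omega> = h \<and> X (Suc m) \<omega> = t} *\<^sub>R u h"
      by (subst sum.remove[of _ t]) auto
  qed
  also have "\<dots> = (\<Sum>h\<in>?S. prob {\<omega> \<in> space P. history (Suc m) \<omega> = h} *\<^sub>R
      (u h * M (fst (last h)) (snd (last h)) t))"
    by (intro sum.cong) (auto simp: history_transition scaleR_conv_of_real)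
  also have "\<dots> = (\<integral>\<omega>. (\<lambda>h. u h * M (fst (last h)) (snd (last h)) t) (history (Suc m) \<omega>) \<partial>P)"
    by (subst integral_finite_range(2)[OF _ finite_histories[of "Suc m"]]) auto
  also have "\<dots> = (\<integral>\<omega>. U \<omega> * M (X m \<omega>) (A m \<omega>) t \<partial>P)"
    by (simp add: u trajectory_Suc)
  finally show ?thesis .
qed

end

section \<open>The padded exponential of the transition counts\<close>

locale padded_exponential = kernel_process P X A M
  for P :: "'w measure" and X :: "nat \<Rightarrow> 'w \<Rightarrow> 's::finite" and A :: "nat \<Rightarrow> 'w \<Rightarrow> 'a::finite" and M +
  fixes \<theta> :: "'s \<Rightarrow> 'a \<Rightarrow> 's \<Rightarrow> real" and K :: "'s \<times> 'a \<Rightarrow> nat"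
begin

abbreviation "N p n \<omega> \<equiv> visits X A (fst p) (snd p) n \<omega>"

definition step_chf :: "'s \<times> 'a \<Rightarrow> complex" where
  "step_chf p = (\<Sum>t\<in>UNIV. M (fst p) (snd p) t * cis (\<theta> (fst p) (snd p) t))"

text \<open>The visit at time \<open>i\<close> itself is not yet counted in \<open>N\<close>, so the
  strict inequality admits exactly the first \<open>K p\<close> transitions out of
  \<open>p\<close>.\<close>

definition capped_factor :: "nat \<Rightarrow> 'w \<Rightarrow> complex" where
  "capped_factor i \<omega> = (if N (X i \<omega>, A i \<omega>) i \<omega> < K (X i \<omega>, A i \<omega>)
    then cis (\<theta> (X i \<omega>) (A i \<omega>) (X (Suc i) \<omega>)) else 1)"

text \<open>Only the first \<open>K p\<close> transitions out of \<open>p\<close> contribute, and the missing ones are replaced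
  by the mean of their factor; the truncated subtraction is intended. Each step replaces one such
  mean by a factor with this conditional mean, so the expectation does not depend on \<open>n\<close>.\<close>

definition padded :: "nat \<Rightarrow> 'w \<Rightarrow> complex" where
  "padded n \<omega> = (\<Prod>i<n. capped_factor i \<omega>) * (\<Prod>p\<in>UNIV. step_chf p ^ (K p - N p n \<omega>))"

lemma norm_step_chf: "norm (step_chf p) \<le> 1"
proof -
  have "norm (step_chf p) \<le> (\<Sum>t\<in>UNIV. M (fst p) (snd p) t)"
    unfolding step_chf_def by (rule sum_norm_le) (simp add: norm_mult M_nonneg)
  then show ?thesis by (simp add: M_sum)
qed

lemma norm_capped_factor [simp]: "norm (capped_factor i \<omega>) = 1"
  by (simp add: capped_factor_def)

lemma visits_Suc: "visits X A s l (Suc n) \<omega> = visits X A s l n \<omega> + of_bool (X n \<omega> = s \<and> A n \<omega> = l)"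
  by (simp add: visits_def)

text \<open>The visit at time \<open>m\<close> uses up one reserved mean of the current pair, and no
  other exponent moves.\<close>

lemma padding_step:
  assumes "N (X m \<omega>, A m \<omega>) m \<omega> < K (X m \<omega>, A m \<omega>)"
  shows "(\<Prod>p\<in>UNIV. step_chf p ^ (K p - N p m \<omega>))
    = step_chf (X m \<omega>, A m \<omega>) * (\<Prod>p\<in>UNIV. step_chf p ^ (K p - N p (Suc m) \<omega>))"
proof -
  let ?q = "(X m \<omega>, A m \<omega>)"
  have "step_chf p ^ (K p - N p m \<omega>)
      = (if p = ?q then step_chf ?q else 1) * step_chf p ^ (K p - N p (Suc m) \<omega>)" for p
  proof (cases "p = ?q")
    case True
    then have "K p - N p m \<omega> = Suc (K p - N p (Suc m) \<omega>)"
      using assms by (simp add: visits_Suc)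
    then show ?thesis using True by simp
  next
    case False
    then have "N p (Suc m) \<omega> = N p m \<omega>"
      by (auto simp: visits_Suc prod_eq_iff)
    then show ?thesis using False by simp
  qed
  then show ?thesis
    by (simp add: prod.distrib)
qed

text \<open>At the cap, truncated subtraction makes the exponent of the current pair 0 both before
  and after the visit.\<close>

lemma padding_step_capped:
  assumes "\<not> N (X m \<omega>, A m \<omega>) m \<omega> < K (X m \<omega>, A m \<omega>)"
  shows "(\<Prod>p\<in>UNIV. step_chf p ^ (K p - N p m \<omega>)) = (\<Prod>p\<in>UNIV. step_chf p ^ (K p - N p (Suc m) \<omega>))"
proof (rule prod.cong[OF refl])
  fix p
  have "K p - N p m \<omega> = K p - N p (Suc m) \<omega>"
    using assms by (cases p) (auto simp: visits_Suc)
  then show "step_chf p ^ (K p - N p m \<omega>) = step_chf p ^ (K p - N p (Suc m) \<omega>)"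
    by simp
qed

lemma capped_factor_cong:
  assumes "i < m" and eq: "history (Suc m) \<omega> = history (Suc m) \<omega>'"
  shows "capped_factor i \<omega> = capped_factor i \<omega>'"
proof -
  have "visits X A s l i \<omega> = visits X A s l i \<omega>'" for s l
    using \<open>i < m\<close> by (intro history_determinedD[OF history_determined_visits eq]) simp
  moreover have "X i \<omega> = X i \<omega>'" "A i \<omega> = A i \<omega>'" "X (Suc i) \<omega> = X (Suc i) \<omega>'"
    using eq \<open>i < m\<close> by (auto simp: trajectory_eq_iff)
  ultimately show ?thesis
    by (simp add: capped_factor_def)
qed

lemma integrable_padded: "integrable P (padded m)"
proof (rule integrable_history_determined)
  \<comment> \<open>The index is \<open>Suc m\<close> because the last factor of the product
    involves \<open>X m\<close>.\<close>
  show "history_determined (Suc m) (padded m)"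
    unfolding history_determined_def
  proof (intro allI impI)
    fix \<omega> \<omega>' assume eq: "history (Suc m) \<omega> = history (Suc m) \<omega>'"
    have "visits X A s l m \<omega> = visits X A s l m \<omega>'" for s l
      by (intro history_determinedD[OF history_determined_visits eq]) simp
    moreover have "(\<Prod>i<m. capped_factor i \<omega>) = (\<Prod>i<m. capped_factor i \<omega>')"
      using capped_factor_cong[OF _ eq] by (intro prod.cong) auto
    ultimately show "padded m \<omega> = padded m \<omega>'"
      by (simp add: padded_def)
  qed
qed

lemma integral_padded_Suc: "(\<integral>\<omega>. padded (Suc m) \<omega> \<partial>P) = (\<integral>\<omega>. padded m \<omega> \<partial>P)"
proof -
  \<comment> \<open>This is \<open>padded (Suc m)\<close> with the next state frozen at
    \<open>t\<close>. The visit counts at \<open>Suc m\<close> already depend on the pairs up to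
    time \<open>m\<close> only, so the next state enters through the last factor alone.\<close>
  define U where "U t \<omega> = (\<Prod>i<m. capped_factor i \<omega>) * (\<Prod>p\<in>UNIV. step_chf p ^ (K p - N p (Suc m) \<omega>))
    * (if N (X m \<omega>, A m \<omega>) m \<omega> < K (X m \<omega>, A m \<omega>) then cis (\<theta> (X m \<omega>) (A m \<omega>) t) else 1)" for t \<omega>
  have U_cong: "U t \<omega> = U t \<omega>'" "X m \<omega> = X m \<omega>'" "A m \<omega> = A m \<omega>'"
    if eq: "history (Suc m) \<omega> = history (Suc m) \<omega>'" for t \<omega> \<omega>'
  proof -
    have v: "visits X A s l i \<omega> = visits X A s l i \<omega>'" if "i \<le> Suc m" for s l i
      by (rule history_determinedD[OF history_determined_visits[OF that] eq])
    show XA: "X m \<omega> = X m \<omega>'" "A m \<omega> = A m \<omega>'"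
      using eq by (auto simp: trajectory_eq_iff)
    moreover have "(\<Prod>i<m. capped_factor i \<omega>) = (\<Prod>i<m. capped_factor i \<omega>')"
      using capped_factor_cong[OF _ eq] by (intro prod.cong) auto
    ultimately show "U t \<omega> = U t \<omega>'"
      by (simp add: U_def v)
  qed
  have det: "history_determined (Suc m) (U t)" for t
    unfolding history_determined_def by (intro allI impI U_cong(1))
  have det': "history_determined (Suc m) (\<lambda>\<omega>. U t \<omega> * M (X m \<omega>) (A m \<omega>) t)" for t
    unfolding history_determined_def
  proof (intro allI impI)
    fix \<omega> \<omega>' assume eq: "history (Suc m) \<omega> = history (Suc m) \<omega>'"
    show "U t \<omega> * M (X m \<omega>) (A m \<omega>) t = U t \<omega>' * M (X m \<omega>') (A m \<omega>') t"
      by (simp only: U_cong[OF eq])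
  qed
  have det'': "history_determined (Suc (Suc m)) (\<lambda>\<omega>. U t \<omega> * of_bool (X (Suc m) \<omega> = t))" for t
    unfolding history_determined_def
  proof (intro allI impI)
    fix \<omega> \<omega>' assume eq: "history (Suc (Suc m)) \<omega> = history (Suc (Suc m)) \<omega>'"
    then have eq: "history (Suc m) \<omega> = history (Suc m) \<omega>'" and X_eq: "X (Suc m) \<omega> = X (Suc m) \<omega>'"
      by (auto simp: trajectory_eq_iff)
    show "U t \<omega> * of_bool (X (Suc m) \<omega> = t) = U t \<omega>' * of_bool (X (Suc m) \<omega>' = t)"
      by (simp only: U_cong[OF eq] X_eq)
  qed
  have mean: "(\<Sum>t\<in>UNIV. U t \<omega> * M (X m \<omega>) (A m \<omega>) t) = padded m \<omega>" for \<omega>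
  proof (cases "N (X m \<omega>, A m \<omega>) m \<omega> < K (X m \<omega>, A m \<omega>)")
    case True
    then have "(\<Sum>t\<in>UNIV. U t \<omega> * M (X m \<omega>) (A m \<omega>) t)
      = (\<Prod>i<m. capped_factor i \<omega>) * (\<Prod>p\<in>UNIV. step_chf p ^ (K p - N p (Suc m) \<omega>)) * step_chf (X m \<omega>, A m \<omega>)"
      by (simp add: U_def step_chf_def[of "(X m \<omega>, A m \<omega>)"] sum_distrib_left mult_ac)
    then show ?thesis
      by (simp add: padded_def padding_step[OF True])
  next
    case False
    have "(\<Sum>t\<in>UNIV. complex_of_real (M (X m \<omega>) (A m \<omega>) t)) = 1"
      by (simp add: M_sum flip: of_real_sum)
    then show ?thesis
      using False by (simp add: U_def padded_def padding_step_capped[OF False] flip: sum_distrib_left)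
  qed
  have "padded (Suc m) \<omega> = (\<Sum>t\<in>UNIV. U t \<omega> * of_bool (X (Suc m) \<omega> = t))" for \<omega>
    by (subst sum.remove[of _ "X (Suc m) \<omega>"]) (auto simp: padded_def U_def capped_factor_def)
  then have "(\<integral>\<omega>. padded (Suc m) \<omega> \<partial>P)
      = (\<integral>\<omega>. (\<Sum>t\<in>UNIV. U t \<omega> * of_bool (X (Suc m) \<omega> = t)) \<partial>P)"
    by (simp only:)
  also have "\<dots> = (\<Sum>t\<in>UNIV. \<integral>\<omega>. U t \<omega> * of_bool (X (Suc m) \<omega> = t) \<partial>P)"
    by (rule Bochner_Integration.integral_sum) (rule integrable_history_determined[OF det''])
  also have "\<dots> = (\<integral>\<omega>. (\<Sum>t\<in>UNIV. U t \<omega> * M (X m \<omega>) (A m \<omega>) t) \<partial>P)"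
    by (subst Bochner_Integration.integral_sum)
      (simp_all only: integrable_history_determined[OF det'] integral_transition[OF det])
  also have "\<dots> = (\<integral>\<omega>. padded m \<omega> \<partial>P)"
    by (simp only: mean)
  finally show ?thesis .
qed

lemma integral_padded: "(\<integral>\<omega>. padded n \<omega> \<partial>P) = (\<Prod>p\<in>UNIV. step_chf p ^ K p)"
  by (induction n) (simp_all add: integral_padded_Suc, simp add: padded_def visits_def prob_space)

definition exponent :: "nat \<Rightarrow> 'w \<Rightarrow> real" where
  "exponent n \<omega> = (\<Sum>i<n. \<theta> (X i \<omega>) (A i \<omega>) (X (Suc i) \<omega>))"

lemma exponent_eq: "exponent n \<omega> = (\<Sum>p\<in>UNIV. \<Sum>t\<in>UNIV. \<theta> (fst p) (snd p) t * transitions X A (fst p) (snd p) t n \<omega>)"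
proof -
  have "(\<Sum>p\<in>UNIV. \<Sum>t\<in>UNIV. \<theta> (fst p) (snd p) t * transitions X A (fst p) (snd p) t n \<omega>)
      = (\<Sum>q\<in>UNIV. \<Sum>i<n. \<theta> (fst (fst q)) (snd (fst q)) (snd q) *
          of_bool (X i \<omega> = fst (fst q) \<and> X (Suc i) \<omega> = snd q \<and> A i \<omega> = snd (fst q)))"
    by (simp add: sum.cartesian_product transitions_def sum_distrib_left split_def
        del: sum_of_bool_eq)
  also have "\<dots> = (\<Sum>i<n. \<Sum>q\<in>UNIV. \<theta> (fst (fst q)) (snd (fst q)) (snd q) *
          of_bool (X i \<omega> = fst (fst q) \<and> X (Suc i) \<omega> = snd q \<and> A i \<omega> = snd (fst q)))"
    by (rule sum.swap)
  also have "\<dots> = exponent n \<omega>"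
    unfolding exponent_def
  proof (rule sum.cong[OF refl])
    fix i
    show "(\<Sum>q\<in>UNIV. \<theta> (fst (fst q)) (snd (fst q)) (snd q) *
          of_bool (X i \<omega> = fst (fst q) \<and> X (Suc i) \<omega> = snd q \<and> A i \<omega> = snd (fst q)))
        = \<theta> (X i \<omega>) (A i \<omega>) (X (Suc i) \<omega>)"
      by (subst sum.remove[of _ "((X i \<omega>, A i \<omega>), X (Suc i) \<omega>)"])
        (auto intro!: sum.neutral simp: prod_eq_iff)
  qed
  finally show ?thesis by simp
qed

lemma padded_eq:
  assumes "\<And>p. N p n \<omega> \<le> K p"
  shows "padded n \<omega> = cis (exponent n \<omega>) * (\<Prod>p\<in>UNIV. step_chf p ^ (K p - N p n \<omega>))"
proof -
  have less: "N (X i \<omega>, A i \<omega>) i \<omega> < K (X i \<omega>, A i \<omega>)" if "i < n" for i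
  proof -
    have "N (X i \<omega>, A i \<omega>) i \<omega> < N (X i \<omega>, A i \<omega>) (Suc i) \<omega>"
      by (simp add: visits_Suc)
    also have "\<dots> \<le> N (X i \<omega>, A i \<omega>) n \<omega>"
      unfolding visits_def using that by (intro sum_mono2) auto
    also note assms
    finally show ?thesis .
  qed
  have "(\<Prod>i<n. capped_factor i \<omega>) = (\<Prod>i<n. cis (\<theta> (X i \<omega>) (A i \<omega>) (X (Suc i) \<omega>)))"
    by (intro prod.cong) (auto simp: capped_factor_def less[simplified])
  also have "\<dots> = cis (exponent n \<omega>)"
    unfolding exponent_def by (induction n) (auto simp: cis_mult add.commute)
  finally show ?thesis by (simp add: padded_def)
qed

end

section \<open>Characteristic functions of the centred transition counts\<close>

lemma abs_exp_minus_diff_le: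
  fixes x y :: real
  assumes "0 \<le> x" "0 \<le> y"
  shows "\<bar>exp (- x) - exp (- y)\<bar> \<le> \<bar>x - y\<bar>"
proof -
  have *: "exp (- a) - exp (- b) \<le> b - a" if "0 \<le> a" "a \<le> b" for a b :: real
  proof -
    have "exp (- a) - exp (- b) = exp (- a) * (1 - exp (- (b - a)))"
      by (simp add: algebra_simps flip: exp_add)
    also have "\<dots> \<le> 1 * (b - a)"
    proof (rule mult_mono)
      show "1 - exp (- (b - a)) \<le> b - a"
        using exp_ge_add_one_self[of "- (b - a)"] by linarith
    qed (use that in auto)
    finally show ?thesis by simp
  qed
  show ?thesis
    using *[of x y] *[of y x] assms by (cases x y rule: linorder_cases) auto
qed

lemma norm_cis_diff_le: "norm (cis x - cis y) \<le> \<bar>x - y\<bar>"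
proof -
  have "cis x - cis y = cis y * (cis (x - y) - 1)"
    by (simp add: algebra_simps cis_mult)
  then show ?thesis
    using iexp_approx1[of "x - y" 0] by (simp add: norm_mult cis_conv_exp)
qed

lemma abs_exp_minus_taylor_le:
  fixes x :: real
  assumes "0 \<le> x"
  shows "\<bar>exp (- x) - (1 - x)\<bar> \<le> x\<^sup>2"
proof -
  have "exp (- x) \<le> 1 / (1 + x)"
    using exp_ge_add_one_self[of x] assms by (simp add: exp_minus field_simps)
  also have "\<dots> \<le> 1 - x + x\<^sup>2"
  proof -
    have "1 \<le> (1 - x + x\<^sup>2) * (1 + x)"
      using assms by (simp add: algebra_simps power2_eq_square)
    then show ?thesis using assms by (simp add: pos_divide_le_eq)
  qed
  finally show ?thesis
    using exp_ge_add_one_self[of "- x"] by simp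
qed

lemma norm_cis_taylor_le: "norm (cis y - (1 + \<i> * y - y\<^sup>2 / 2)) \<le> \<bar>y\<bar> ^ 3 / 6"
proof -
  have "(\<Sum>k\<le>2. (\<i> * complex_of_real y) ^ k / fact k) = 1 + \<i> * y - y\<^sup>2 / 2"
    by (simp add: numeral_2_eq_2 complex_eq_iff)
  then show ?thesis
    using iexp_approx1[of y 2] by (simp add: cis_conv_exp eval_nat_numeral)
qed

context padded_exponential
begin

text \<open>Two replacements. Both bases lie in the unit disc, so \<open>j\<close>-th powers differ
  by at most \<open>j\<close> times the difference of the bases; and the \<open>j\<close>-th power
  of the Gaussian factor has exponent proportional to \<open>j / v\<close>, to be compared with
  \<open>c\<close>. The padding uses \<open>c = 1\<close>, the full power \<open>K p\<close> uses
  \<open>c = 2\<close>.\<close>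

lemma step_chf_power_approx:
  assumes "0 < v" "0 \<le> \<sigma>" "0 \<le> c" "j \<le> K p"
  shows "norm (step_chf p ^ j - complex_of_real (exp (- (\<sigma> / 2 * c))))
    \<le> K p * norm (step_chf p - complex_of_real (exp (- (\<sigma> / (2 * v))))) + \<sigma> / 2 * \<bar>j / v - c\<bar>"
proof -
  let ?g = "complex_of_real (exp (- (\<sigma> / (2 * v))))"
  have "norm (step_chf p ^ j - ?g ^ j) \<le> j * norm (step_chf p - ?g)"
    using assms by (intro norm_power_diff norm_step_chf) simp
  also have "\<dots> \<le> K p * norm (step_chf p - ?g)"
    using assms by (intro mult_right_mono) auto
  finally have 1: "norm (step_chf p ^ j - ?g ^ j) \<le> K p * norm (step_chf p - ?g)" .
  have "?g ^ j = complex_of_real (exp (- (\<sigma> / 2 * (j / v))))"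
    by (simp flip: of_real_power exp_of_nat_mult)
  then have "norm (?g ^ j - complex_of_real (exp (- (\<sigma> / 2 * c))))
      = \<bar>exp (- (\<sigma> / 2 * (j / v))) - exp (- (\<sigma> / 2 * c))\<bar>"
    by (simp flip: of_real_diff)
  also have "\<dots> \<le> \<bar>\<sigma> / 2 * (j / v) - \<sigma> / 2 * c\<bar>"
    using assms by (intro abs_exp_minus_diff_le) auto
  also have "\<dots> = \<sigma> / 2 * \<bar>j / v - c\<bar>"
    using assms by (simp only: abs_mult abs_of_nonneg divide_nonneg_nonneg flip: right_diff_distrib)
  finally have 2: "norm (?g ^ j - complex_of_real (exp (- (\<sigma> / 2 * c)))) \<le> \<sigma> / 2 * \<bar>j / v - c\<bar>" .
  show ?thesis
    using norm_triangle_ineq[of "step_chf p ^ j - ?g ^ j" "?g ^ j - complex_of_real (exp (- (\<sigma> / 2 * c)))"] 1 2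
    by simp
qed

lemma norm_padded: "norm (padded n \<omega>) \<le> 1"
proof -
  have "norm (\<Prod>p\<in>UNIV. step_chf p ^ (K p - N p n \<omega>)) \<le> 1"
    unfolding prod_norm[symmetric] norm_power
    by (intro prod_le_1 conjI power_le_one norm_step_chf) auto
  then show ?thesis
    by (simp add: padded_def norm_mult flip: prod_norm)
qed

lemma integrable_cis_exponent: "integrable P (\<lambda>\<omega>. cis (exponent n \<omega>))"
proof (rule integrable_history_determined)
  show "history_determined (Suc n) (\<lambda>\<omega>. cis (exponent n \<omega>))"
    unfolding history_determined_def exponent_def trajectory_eq_iff
    by (intro allI impI arg_cong[where f=cis] sum.cong) auto
qed

text \<open>With \<open>K p\<close> about \<open>2 * v p\<close> and about \<open>v p\<close>
  visits, roughly \<open>v p\<close> reserved means remain. They make up \<open>a\<close>, while the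
  exact expectation of the padded product is close to \<open>a\<^sup>2\<close>. Here
  \<open>e p\<close> collects the deterministic errors, from the step and from rounding the cap, and
  \<open>\<delta> p\<close> the random one.\<close>

lemma cis_exponent_bound:
  fixes v \<sigma> :: "'s \<times> 'a \<Rightarrow> real" and n :: nat
  assumes v: "\<And>p. 0 < v p" and K: "\<And>p. 2 * v p \<le> K p" and \<sigma>: "\<And>p. 0 \<le> \<sigma> p"
  defines "a \<equiv> \<Prod>p\<in>UNIV. complex_of_real (exp (- (\<sigma> p / 2)))"
  defines "e \<equiv> \<lambda>p. K p * norm (step_chf p - complex_of_real (exp (- (\<sigma> p / (2 * v p))))) + \<sigma> p / 2 * \<bar>K p / v p - 2\<bar>"
  defines "\<delta> \<equiv> \<lambda>p. (\<integral>\<omega>. \<bar>N p n \<omega> / v p - 1\<bar> \<partial>P)"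
  shows "norm ((\<integral>\<omega>. cis (exponent n \<omega>) \<partial>P) * a - a\<^sup>2)
    \<le> (\<Sum>p\<in>UNIV. 2 * e p + (2 + \<sigma> p / 2) * \<delta> p)"
proof -
  have a: "norm a \<le> 1"
    using \<sigma> by (auto simp: a_def simp flip: prod_norm intro!: prod_le_1)
  have e_nonneg: "0 \<le> e p" for p
    using \<sigma>[of p] by (simp add: e_def)
  have pointwise: "norm (cis (exponent n \<omega>) * a - padded n \<omega>)
      \<le> (\<Sum>p\<in>UNIV. e p + (2 + \<sigma> p / 2) * \<bar>N p n \<omega> / v p - 1\<bar>)" for \<omega>
  proof (cases "\<forall>p. N p n \<omega> \<le> K p")
    case True
    have "norm (a - (\<Prod>p\<in>UNIV. step_chf p ^ (K p - N p n \<omega>)))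
        \<le> (\<Sum>p\<in>UNIV. norm (complex_of_real (exp (- (\<sigma> p / 2))) - step_chf p ^ (K p - N p n \<omega>)))"
      unfolding a_def
      by (intro norm_prod_diff) (auto simp: norm_power \<sigma> intro!: power_le_one norm_step_chf)
    also have "\<dots> \<le> (\<Sum>p\<in>UNIV. e p + (2 + \<sigma> p / 2) * \<bar>N p n \<omega> / v p - 1\<bar>)"
    proof (rule sum_mono)
      fix p
      have "norm (complex_of_real (exp (- (\<sigma> p / 2))) - step_chf p ^ (K p - N p n \<omega>))
          \<le> K p * norm (step_chf p - complex_of_real (exp (- (\<sigma> p / (2 * v p)))))
            + \<sigma> p / 2 * \<bar>real (K p - N p n \<omega>) / v p - 1\<bar>" (is "_ \<le> ?b + _")
        using step_chf_power_approx[OF v \<sigma>, of 1 "K p - N p n \<omega>" p p] by (simp add: norm_minus_commute)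
      moreover have "\<sigma> p / 2 * \<bar>real (K p - N p n \<omega>) / v p - 1\<bar>
          \<le> \<sigma> p / 2 * (\<bar>K p / v p - 2\<bar> + \<bar>N p n \<omega> / v p - 1\<bar>)"
      proof (rule mult_left_mono)
        have "real (K p - N p n \<omega>) / v p - 1 = (K p / v p - 2) - (N p n \<omega> / v p - 1)"
          using True[rule_format, of p] by (simp add: of_nat_diff diff_divide_distrib)
        then show "\<bar>real (K p - N p n \<omega>) / v p - 1\<bar> \<le> \<bar>K p / v p - 2\<bar> + \<bar>N p n \<omega> / v p - 1\<bar>"
          by (metis abs_triangle_ineq4)
      qed (use \<sigma>[of p] in simp)
      ultimately show "norm (complex_of_real (exp (- (\<sigma> p / 2))) - step_chf p ^ (K p - N p n \<omega>))
          \<le> e p + (2 + \<sigma> p / 2) * \<bar>N p n \<omega> / v p - 1\<bar>"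
        unfolding e_def distrib_left distrib_right using abs_ge_zero[of "N p n \<omega> / v p - 1"] by linarith
    qed
    finally have "norm (a - (\<Prod>p\<in>UNIV. step_chf p ^ (K p - N p n \<omega>)))
        \<le> (\<Sum>p\<in>UNIV. e p + (2 + \<sigma> p / 2) * \<bar>N p n \<omega> / v p - 1\<bar>)" .
    then show ?thesis
      unfolding padded_eq[OF True[rule_format]] right_diff_distrib[symmetric] norm_mult by simp
  next
    case False
    then obtain q where q: "K q < N q n \<omega>" by (meson not_le)
    have "norm (cis (exponent n \<omega>) * a - padded n \<omega>) \<le> 1 + 1"
      using a norm_padded[of n \<omega>] by (intro norm_triangle_le_diff) (auto simp: norm_mult)
    \<comment> \<open>A pair above its cap has at least \<open>2 * v q\<close> visits, hence a
      deviation of at least 1, which pays for the trivial bound 2. This is the origin of the 2 in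
      \<open>2 + \<sigma> p / 2\<close>.\<close>
    also have "\<dots> \<le> 2 * \<bar>N q n \<omega> / v q - 1\<bar>"
    proof -
      have "2 * v q \<le> N q n \<omega>" using q K[of q] by linarith
      then have "2 \<le> N q n \<omega> / v q" using v[of q] by (simp add: pos_le_divide_eq)
      then show ?thesis by simp
    qed
    also have "\<dots> \<le> e q + (2 + \<sigma> q / 2) * \<bar>N q n \<omega> / v q - 1\<bar>"
      using e_nonneg[of q] \<sigma>[of q] by (simp add: distrib_right)
    also have "\<dots> \<le> (\<Sum>p\<in>UNIV. e p + (2 + \<sigma> p / 2) * \<bar>N p n \<omega> / v p - 1\<bar>)"
      using e_nonneg \<sigma> by (intro member_le_sum) (auto intro!: add_nonneg_nonneg mult_nonneg_nonneg)
    finally show ?thesis .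
  qed
  have "norm ((\<integral>\<omega>. cis (exponent n \<omega>) \<partial>P) * a - (\<integral>\<omega>. padded n \<omega> \<partial>P))
      = norm (\<integral>\<omega>. cis (exponent n \<omega>) * a - padded n \<omega> \<partial>P)"
    using integrable_cis_exponent[of n] integrable_padded[of n] by simp
  also have "\<dots> \<le> (\<integral>\<omega>. norm (cis (exponent n \<omega>) * a - padded n \<omega>) \<partial>P)"
    by (rule integral_norm_bound)
  also have "\<dots> \<le> (\<integral>\<omega>. (\<Sum>p\<in>UNIV. e p + (2 + \<sigma> p / 2) * \<bar>N p n \<omega> / v p - 1\<bar>) \<partial>P)"
    using integrable_cis_exponent[of n] integrable_padded[of n] integrable_visits_deviation
    by (intro integral_mono pointwise integrable_norm Bochner_Integration.integrable_diff
        Bochner_Integration.integrable_sum Bochner_Integration.integrable_add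
        integrable_mult_right integrable_mult_left) auto
  also have "\<dots> = (\<Sum>p\<in>UNIV. e p + (2 + \<sigma> p / 2) * \<delta> p)"
    by (simp add: integrable_visits_deviation \<delta>_def prob_space)
  finally have 1: "norm ((\<integral>\<omega>. cis (exponent n \<omega>) \<partial>P) * a - (\<Prod>p\<in>UNIV. step_chf p ^ K p))
      \<le> (\<Sum>p\<in>UNIV. e p + (2 + \<sigma> p / 2) * \<delta> p)"
    by (simp only: integral_padded)
  have a2: "a\<^sup>2 = (\<Prod>p\<in>UNIV. complex_of_real (exp (- (\<sigma> p / 2 * 2))))"
    unfolding a_def prod_power_distrib by (intro prod.cong) (simp_all flip: of_real_power exp_double)
  have "norm ((\<Prod>p\<in>UNIV. step_chf p ^ K p) - a\<^sup>2)
      \<le> (\<Sum>p\<in>UNIV. norm (step_chf p ^ K p - complex_of_real (exp (- (\<sigma> p / 2 * 2)))))"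
    unfolding a2
  proof (rule norm_prod_diff)
    fix p
    show "norm (step_chf p ^ K p) \<le> 1"
      unfolding norm_power by (intro power_le_one norm_step_chf) simp
    show "norm (complex_of_real (exp (- (\<sigma> p / 2 * 2)))) \<le> 1"
      using \<sigma>[of p] by simp
  qed
  also have "\<dots> \<le> (\<Sum>p\<in>UNIV. e p)"
  proof (rule sum_mono)
    fix p
    show "norm (step_chf p ^ K p - complex_of_real (exp (- (\<sigma> p / 2 * 2)))) \<le> e p"
      unfolding e_def by (rule step_chf_power_approx[OF v \<sigma>]) auto
  qed
  finally have 2: "norm ((\<Prod>p\<in>UNIV. step_chf p ^ K p) - a\<^sup>2) \<le> (\<Sum>p\<in>UNIV. e p)" .
  have "norm ((\<integral>\<omega>. cis (exponent n \<omega>) \<partial>P) * a - a\<^sup>2)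
      \<le> (\<Sum>p\<in>UNIV. e p + (2 + \<sigma> p / 2) * \<delta> p) + (\<Sum>p\<in>UNIV. e p)"
    using norm_triangle_mono[OF 1 2] by simp
  also have "\<dots> = (\<Sum>p\<in>UNIV. 2 * e p + (2 + \<sigma> p / 2) * \<delta> p)"
    by (simp add: sum.distrib sum_distrib_left)
  finally show ?thesis .
qed

end

section \<open>Gaussian limits for linear functionals of the counts\<close>

lemma sum_transitions:
  "(\<Sum>t\<in>UNIV. transitions X A s l t n \<omega>) = visits X A (s::'s::finite) l n \<omega>"
proof -
  have "(\<Sum>t\<in>UNIV. transitions X A s l t n \<omega>)
      = (\<Sum>i<n. \<Sum>t\<in>UNIV. of_bool (X i \<omega> = s \<and> X (Suc i) \<omega> = t \<and> A i \<omega> = l))"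
    unfolding transitions_def by (rule sum.swap)
  also have "\<dots> = visits X A s l n \<omega>"
    unfolding visits_def
  proof (rule sum.cong[OF refl])
    fix i
    show "(\<Sum>t\<in>UNIV. of_bool (X i \<omega> = s \<and> X (Suc i) \<omega> = t \<and> A i \<omega> = l)) = (of_bool (X i \<omega> = s \<and> A i \<omega> = l) :: nat)"
      by (subst sum.remove[of _ "X (Suc i) \<omega>"]) (auto intro!: sum.neutral)
  qed
  finally show ?thesis .
qed

context kernel_process
begin

definition weighted_mean :: "('s \<Rightarrow> 'a \<Rightarrow> 's \<Rightarrow> real) \<Rightarrow> 's \<times> 'a \<Rightarrow> real" where
  "weighted_mean c p = (\<Sum>t\<in>UNIV. M (fst p) (snd p) t * c (fst p) (snd p) t)"

definition weighted_variance :: "('s \<Rightarrow> 'a \<Rightarrow> 's \<Rightarrow> real) \<Rightarrow> 's \<times> 'a \<Rightarrow> real" where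
  "weighted_variance c p = (\<Sum>t\<in>UNIV. M (fst p) (snd p) t * (c (fst p) (snd p) t - weighted_mean c p)\<^sup>2)"

lemma weighted_variance_nonneg: "0 \<le> weighted_variance c p"
  unfolding weighted_variance_def by (intro sum_nonneg mult_nonneg_nonneg M_nonneg) auto

lemma weighted_variance_eq:
  "weighted_variance c p = (\<Sum>t\<in>UNIV. M (fst p) (snd p) t * (c (fst p) (snd p) t)\<^sup>2) - (weighted_mean c p)\<^sup>2"
proof -
  let ?m = "weighted_mean c p"
  have "weighted_variance c p = (\<Sum>t\<in>UNIV. M (fst p) (snd p) t * (c (fst p) (snd p) t)\<^sup>2
      - 2 * ?m * (M (fst p) (snd p) t * c (fst p) (snd p) t) + ?m\<^sup>2 * M (fst p) (snd p) t)"
    unfolding weighted_variance_def by (simp add: power2_diff algebra_simps)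
  also have "\<dots> = (\<Sum>t\<in>UNIV. M (fst p) (snd p) t * (c (fst p) (snd p) t)\<^sup>2) - 2 * ?m * ?m + ?m\<^sup>2"
    by (simp add: sum.distrib sum_subtractf M_sum flip: sum_distrib_left weighted_mean_def)
  finally show ?thesis by (simp add: power2_eq_square)
qed

lemma sum_M_centered:
  "(\<Sum>t\<in>UNIV. M (fst p) (snd p) t * (c (fst p) (snd p) t - weighted_mean c p)) = 0"
  by (simp add: right_diff_distrib sum_subtractf weighted_mean_def M_sum flip: sum_distrib_right)

text \<open>Taylor expansion to second order, in which the linear term vanishes by centring. The
  remainders are of order \<open>v powr (- 3 / 2)\<close> and \<open>v powr (- 2)\<close>, hence
  still negligible after multiplication by a cap of order \<open>v\<close>.\<close>

lemma step_chf_expansion: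
  assumes v: "0 < v"
  shows "norm ((\<Sum>t\<in>UNIV. M (fst p) (snd p) t * cis ((c (fst p) (snd p) t - weighted_mean c p) / sqrt v))
      - complex_of_real (exp (- (weighted_variance c p / (2 * v)))))
    \<le> (\<Sum>t\<in>UNIV. M (fst p) (snd p) t * \<bar>c (fst p) (snd p) t - weighted_mean c p\<bar> ^ 3) / (v * sqrt v)
      + (weighted_variance c p)\<^sup>2 / v\<^sup>2"
proof -
  let ?M = "\<lambda>t. M (fst p) (snd p) t" and ?d = "\<lambda>t. c (fst p) (snd p) t - weighted_mean c p"
  let ?\<sigma> = "weighted_variance c p"
  let ?x = "\<lambda>t. ?d t / sqrt v"
  have "(\<Sum>t\<in>UNIV. ?M t * (1 - (?x t)\<^sup>2 / 2)) = (\<Sum>t\<in>UNIV. ?M t) - (\<Sum>t\<in>UNIV. ?M t * (?d t)\<^sup>2) / (2 * v)"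
    using v by (simp add: right_diff_distrib sum_subtractf sum_divide_distrib power_divide mult.commute)
  then have re: "(\<Sum>t\<in>UNIV. ?M t * (1 - (?x t)\<^sup>2 / 2)) = 1 - ?\<sigma> / (2 * v)"
    by (simp only: M_sum weighted_variance_def)
  have im: "(\<Sum>t\<in>UNIV. ?M t * ?x t) = 0"
    using sum_M_centered[of p c] by (simp flip: sum_divide_distrib)
  have "(\<Sum>t\<in>UNIV. ?M t * (1 + \<i> * (?d t / sqrt v) - (?d t / sqrt v)\<^sup>2 / 2))
      = (\<Sum>t\<in>UNIV. complex_of_real (?M t * (1 - (?x t)\<^sup>2 / 2)) + \<i> * complex_of_real (?M t * ?x t))"
    by (intro sum.cong) (auto simp: algebra_simps)
  also have "\<dots> = complex_of_real (\<Sum>t\<in>UNIV. ?M t * (1 - (?x t)\<^sup>2 / 2)) + \<i> * complex_of_real (\<Sum>t\<in>UNIV. ?M t * ?x t)"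
    by (simp only: sum.distrib of_real_sum sum_distrib_left)
  also have "\<dots> = complex_of_real (1 - ?\<sigma> / (2 * v))"
    by (simp only: re im) simp
  finally have main: "(\<Sum>t\<in>UNIV. ?M t * (1 + \<i> * (?d t / sqrt v) - (?d t / sqrt v)\<^sup>2 / 2))
      = complex_of_real (1 - ?\<sigma> / (2 * v))" .
  have "norm ((\<Sum>t\<in>UNIV. ?M t * cis (?d t / sqrt v))
        - (\<Sum>t\<in>UNIV. ?M t * (1 + \<i> * (?d t / sqrt v) - (?d t / sqrt v)\<^sup>2 / 2)))
      = norm (\<Sum>t\<in>UNIV. ?M t * (cis (?d t / sqrt v) - (1 + \<i> * (?d t / sqrt v) - (?d t / sqrt v)\<^sup>2 / 2)))"
    by (simp only: sum_subtractf right_diff_distrib)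
  also have "\<dots> \<le> (\<Sum>t\<in>UNIV. ?M t * \<bar>?d t\<bar> ^ 3 / (v * sqrt v))"
  proof (rule sum_norm_le)
    fix t
    let ?x = "?d t / sqrt v"
    have "norm (cis ?x - (1 + \<i> * ?x - ?x\<^sup>2 / 2)) \<le> \<bar>?x\<bar> ^ 3 / 6"
      using norm_cis_taylor_le[of ?x] by (simp only: of_real_divide)
    also have "\<dots> \<le> \<bar>?x\<bar> ^ 3" by simp
    also have "\<bar>?x\<bar> ^ 3 = \<bar>?d t\<bar> ^ 3 / (v * sqrt v)"
      using v by (simp add: power_divide eval_nat_numeral)
    finally show "norm (?M t * (cis ?x - (1 + \<i> * ?x - ?x\<^sup>2 / 2))) \<le> ?M t * \<bar>?d t\<bar> ^ 3 / (v * sqrt v)"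
      using mult_left_mono[OF _ M_nonneg] by (fastforce simp: norm_mult M_nonneg)
  qed
  finally have 1: "norm ((\<Sum>t\<in>UNIV. ?M t * cis (?d t / sqrt v)) - complex_of_real (1 - ?\<sigma> / (2 * v)))
      \<le> (\<Sum>t\<in>UNIV. ?M t * \<bar>?d t\<bar> ^ 3) / (v * sqrt v)"
    by (simp only: main sum_divide_distrib)
  have "\<bar>exp (- (?\<sigma> / (2 * v))) - (1 - ?\<sigma> / (2 * v))\<bar> \<le> (?\<sigma> / (2 * v))\<^sup>2"
    using v weighted_variance_nonneg[of c p] by (intro abs_exp_minus_taylor_le) auto
  also have "\<dots> \<le> (?\<sigma> / v)\<^sup>2"
    using v weighted_variance_nonneg[of c p] by (intro power_mono divide_left_mono) auto
  finally have 2: "norm (complex_of_real (1 - ?\<sigma> / (2 * v)) - complex_of_real (exp (- (?\<sigma> / (2 * v)))))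
      \<le> ?\<sigma>\<^sup>2 / v\<^sup>2"
    by (simp add: power_divide abs_minus_commute flip: of_real_diff)
  show ?thesis
    using norm_triangle_mono[OF 1 2] by simp
qed

lemma cis_sum_tendsto:
  fixes c :: "'s \<Rightarrow> 'a \<Rightarrow> 's \<Rightarrow> real" and v :: "nat \<Rightarrow> 's \<times> 'a \<Rightarrow> real"
  assumes v: "\<And>p. filterlim (\<lambda>n. v n p) at_top sequentially"
    and lln: "\<And>p. (\<lambda>n. \<integral>\<omega>. \<bar>visits X A (fst p) (snd p) n \<omega> / v n p - 1\<bar> \<partial>P) \<longlonglongrightarrow> 0"
  shows "(\<lambda>n. \<integral>\<omega>. cis (\<Sum>p\<in>UNIV. \<Sum>t\<in>UNIV. c (fst p) (snd p) t *
      ((transitions X A (fst p) (snd p) t n \<omega> - visits X A (fst p) (snd p) n \<omega> * M (fst p) (snd p) t) / sqrt (v n p))) \<partial>P)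
    \<longlonglongrightarrow> (\<Prod>p\<in>UNIV. complex_of_real (exp (- (weighted_variance c p / 2))))"
proof -
  \<comment> \<open>Centring the coefficients instead of the counts gives the same sum, since the
    transitions out of a pair add up to its visits.\<close>
  define \<theta> where "\<theta> n s l t = (c s l t - weighted_mean c (s, l)) / sqrt (v n (s, l))" for n s l t
  define K where "K n p = nat \<lceil>2 * v n p\<rceil>" for n and p :: "'s \<times> 'a"
  have loc: "padded_exponential P X A M" ..
  let ?S = "\<lambda>n. padded_exponential.exponent X A (\<theta> n) n"
  let ?\<sigma> = "weighted_variance c"
  define a where "a = (\<Prod>p\<in>UNIV. complex_of_real (exp (- (?\<sigma> p / 2))))"
  define D where "D p = (\<Sum>t\<in>UNIV. M (fst p) (snd p) t * \<bar>c (fst p) (snd p) t - weighted_mean c p\<bar> ^ 3)" for p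
  \<comment> \<open>An upper bound for half of the deterministic error of a pair, as a function of
    \<open>v n p\<close> alone: rounding gives \<open>K n p \<le> 2 * v n p + 1\<close> and a defect
    of at most \<open>1 / v n p\<close> in the ratio.\<close>
  define E where "E x p = (2 * x + 1) * (D p / (x * sqrt x) + (?\<sigma> p)\<^sup>2 / x\<^sup>2) + ?\<sigma> p / 2 * (1 / x)" for x p
  have a_nonzero: "a \<noteq> 0" by (simp add: a_def)
  have S: "?S n \<omega> = (\<Sum>p\<in>UNIV. \<Sum>t\<in>UNIV. c (fst p) (snd p) t *
      ((transitions X A (fst p) (snd p) t n \<omega> - visits X A (fst p) (snd p) n \<omega> * M (fst p) (snd p) t) / sqrt (v n p)))"
    for n \<omega>
    unfolding padded_exponential.exponent_eq[OF loc]
  proof (rule sum.cong[OF refl])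
    fix p :: "'s \<times> 'a"
    let ?T = "\<lambda>t. real (transitions X A (fst p) (snd p) t n \<omega>)" and ?N = "real (visits X A (fst p) (snd p) n \<omega>)"
    let ?c = "c (fst p) (snd p)" and ?M = "M (fst p) (snd p)"
    have "(\<Sum>t\<in>UNIV. \<theta> n (fst p) (snd p) t * ?T t)
        = ((\<Sum>t\<in>UNIV. ?c t * ?T t) - weighted_mean c p * (\<Sum>t\<in>UNIV. ?T t)) / sqrt (v n p)"
      by (simp add: \<theta>_def left_diff_distrib diff_divide_distrib sum_subtractf sum_divide_distrib sum_distrib_left)
    also have "(\<Sum>t\<in>UNIV. ?T t) = ?N"
      by (simp flip: sum_transitions of_nat_sum)
    also have "(\<Sum>t\<in>UNIV. ?c t * ?T t) - weighted_mean c p * ?N = (\<Sum>t\<in>UNIV. ?c t * (?T t - ?N * ?M t))"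
      by (simp add: weighted_mean_def right_diff_distrib sum_subtractf sum_distrib_left sum_distrib_right mult_ac)
    finally show "(\<Sum>t\<in>UNIV. \<theta> n (fst p) (snd p) t * ?T t) = (\<Sum>t\<in>UNIV. ?c t * ((?T t - ?N * ?M t) / sqrt (v n p)))"
      by (simp add: sum_divide_distrib)
  qed
  have "\<forall>\<^sub>F n in sequentially. \<forall>p\<in>UNIV. 0 < v n p"
    by (intro eventually_ball_finite ballI filterlim_at_top_dense[THEN iffD1, rule_format, OF v]) simp
  then have bound: "\<forall>\<^sub>F n in sequentially. norm ((\<integral>\<omega>. cis (?S n \<omega>) \<partial>P) * a - a\<^sup>2)
      \<le> (\<Sum>p\<in>UNIV. 2 * E (v n p) p + (2 + ?\<sigma> p / 2) * (\<integral>\<omega>. \<bar>visits X A (fst p) (snd p) n \<omega> / v n p - 1\<bar> \<partial>P))"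
  proof eventually_elim
    case (elim n)
    have v: "0 < v n p" for p using elim by blast
    have K: "2 * v n p \<le> K n p" "K n p \<le> 2 * v n p + 1" for p
      using v[of p] unfolding K_def by linarith+
    have "norm ((\<integral>\<omega>. cis (?S n \<omega>) \<partial>P) * a - a\<^sup>2)
      \<le> (\<Sum>p\<in>UNIV. 2 * (K n p * norm (padded_exponential.step_chf M (\<theta> n) p - complex_of_real (exp (- (?\<sigma> p / (2 * v n p)))))
            + ?\<sigma> p / 2 * \<bar>K n p / v n p - 2\<bar>)
          + (2 + ?\<sigma> p / 2) * (\<integral>\<omega>. \<bar>visits X A (fst p) (snd p) n \<omega> / v n p - 1\<bar> \<partial>P))"
      unfolding a_def
      by (rule padded_exponential.cis_exponent_bound[OF loc]) (auto simp: v K weighted_variance_nonneg)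
    also have "\<dots> \<le> (\<Sum>p\<in>UNIV. 2 * E (v n p) p + (2 + ?\<sigma> p / 2) * (\<integral>\<omega>. \<bar>visits X A (fst p) (snd p) n \<omega> / v n p - 1\<bar> \<partial>P))"
      unfolding E_def
    proof (intro sum_mono add_right_mono mult_left_mono add_mono mult_mono K)
      fix p
      show "norm (padded_exponential.step_chf M (\<theta> n) p - complex_of_real (exp (- (?\<sigma> p / (2 * v n p)))))
          \<le> D p / (v n p * sqrt (v n p)) + (?\<sigma> p)\<^sup>2 / (v n p)\<^sup>2"
        using step_chf_expansion[OF v[of p], of p c]
        by (simp add: padded_exponential.step_chf_def[OF loc] \<theta>_def D_def)
      have "K n p / v n p - 2 = (K n p - 2 * v n p) / v n p"
        using v[of p] by (simp add: field_simps)
      then show "\<bar>K n p / v n p - 2\<bar> \<le> 1 / v n p"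
        using v[of p] K[of p] by (simp add: divide_right_mono)
    qed (use v weighted_variance_nonneg in \<open>auto simp: less_imp_le\<close>)
    finally show ?case .
  qed
  have E_lim: "(\<lambda>n. E (v n p) p) \<longlonglongrightarrow> 0" for p
  proof -
    have "E x p = D p * ((2 * x + 1) / (x * sqrt x)) + (?\<sigma> p)\<^sup>2 * ((2 * x + 1) / x\<^sup>2) + ?\<sigma> p / 2 * (1 / x)" for x
      by (simp add: E_def algebra_simps)
    moreover have "((\<lambda>x::real. (2 * x + 1) / (x * sqrt x)) \<longlongrightarrow> 0) at_top" "((\<lambda>x::real. (2 * x + 1) / x\<^sup>2) \<longlongrightarrow> 0) at_top"
      "((\<lambda>x::real. 1 / x) \<longlongrightarrow> 0) at_top"
      by real_asymp+
    ultimately have "((\<lambda>x. E x p) \<longlongrightarrow> D p * 0 + (?\<sigma> p)\<^sup>2 * 0 + ?\<sigma> p / 2 * 0) at_top"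
      by (simp only:) (intro tendsto_intros)
    then have "((\<lambda>x. E x p) \<longlongrightarrow> 0) at_top" by simp
    then show ?thesis using v[of p] by (rule filterlim_compose)
  qed
  have "(\<lambda>n. \<Sum>p\<in>UNIV. 2 * E (v n p) p + (2 + ?\<sigma> p / 2) * (\<integral>\<omega>. \<bar>visits X A (fst p) (snd p) n \<omega> / v n p - 1\<bar> \<partial>P))
      \<longlonglongrightarrow> (\<Sum>p\<in>UNIV. 2 * 0 + (2 + ?\<sigma> p / 2) * 0)"
    by (intro tendsto_intros E_lim lln)
  then have "(\<lambda>n. (\<integral>\<omega>. cis (?S n \<omega>) \<partial>P) * a - a\<^sup>2) \<longlonglongrightarrow> 0"
    by (intro Lim_null_comparison[OF bound]) simp
  then have "(\<lambda>n. ((\<integral>\<omega>. cis (?S n \<omega>) \<partial>P) * a - a\<^sup>2) / a + a) \<longlonglongrightarrow> 0 / a + a"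
    by (intro tendsto_intros a_nonzero)
  moreover have "((\<integral>\<omega>. cis (?S n \<omega>) \<partial>P) * a - a\<^sup>2) / a + a = (\<integral>\<omega>. cis (?S n \<omega>) \<partial>P)" for n
    using a_nonzero by (simp add: field_simps power2_eq_square)
  ultimately show ?thesis
    by (simp add: S a_def)
qed

text \<open>The visit ratios tend to 1 in mean and \<open>cis\<close> is Lipschitz, so in the limit
  they contribute a constant factor. They are carried along because the statistics divide by
  them.\<close>

lemma joint_chf_tendsto:
  fixes c :: "'s \<Rightarrow> 'a \<Rightarrow> 's \<Rightarrow> real" and v :: "nat \<Rightarrow> 's \<times> 'a \<Rightarrow> real" and r :: "'s \<times> 'a \<Rightarrow> real"
  assumes v: "\<And>p. filterlim (\<lambda>n. v n p) at_top sequentially"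
    and lln: "\<And>p. (\<lambda>n. \<integral>\<omega>. \<bar>visits X A (fst p) (snd p) n \<omega> / v n p - 1\<bar> \<partial>P) \<longlonglongrightarrow> 0"
  shows "(\<lambda>n. \<integral>\<omega>. cis ((\<Sum>p\<in>UNIV. \<Sum>t\<in>UNIV. c (fst p) (snd p) t *
        ((transitions X A (fst p) (snd p) t n \<omega> - visits X A (fst p) (snd p) n \<omega> * M (fst p) (snd p) t) / sqrt (v n p)))
      + (\<Sum>p\<in>UNIV. r p * (visits X A (fst p) (snd p) n \<omega> / v n p))) \<partial>P)
    \<longlonglongrightarrow> (\<Prod>p\<in>UNIV. complex_of_real (exp (- (weighted_variance c p / 2)))) * cis (\<Sum>p\<in>UNIV. r p)"
proof -
  let ?S = "\<lambda>n \<omega>. \<Sum>p\<in>UNIV. \<Sum>t\<in>UNIV. c (fst p) (snd p) t *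
        ((transitions X A (fst p) (snd p) t n \<omega> - visits X A (fst p) (snd p) n \<omega> * M (fst p) (snd p) t) / sqrt (v n p))"
  let ?R = "\<lambda>n \<omega>. \<Sum>p\<in>UNIV. r p * (visits X A (fst p) (snd p) n \<omega> / v n p)"
  let ?r = "\<Sum>p\<in>UNIV. r p"
  have m: "(\<lambda>\<omega>. real (visits X A s l n \<omega>)) \<in> borel_measurable P"
    "(\<lambda>\<omega>. real (transitions X A s l t n \<omega>)) \<in> borel_measurable P" for s l t n
    by measurable
  have cis_m: "cis \<in> borel_measurable borel"
    by (intro borel_measurable_continuous_onI continuous_intros)
  have i1: "integrable P (\<lambda>\<omega>. cis (?S n \<omega> + ?R n \<omega>))" and i2: "integrable P (\<lambda>\<omega>. cis (?S n \<omega>))" for n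
  proof -
    have S_m: "?S n \<in> borel_measurable P" and R_m: "?R n \<in> borel_measurable P"
      by (intro borel_measurable_sum borel_measurable_times borel_measurable_divide
          borel_measurable_diff borel_measurable_const m)+
    show "integrable P (\<lambda>\<omega>. cis (?S n \<omega> + ?R n \<omega>))"
      by (rule integrable_const_bound[where B=1])
        (simp, rule measurable_compose[OF borel_measurable_add[OF S_m R_m] cis_m])
    show "integrable P (\<lambda>\<omega>. cis (?S n \<omega>))"
      by (rule integrable_const_bound[where B=1]) (simp, rule measurable_compose[OF S_m cis_m])
  qed
  have bound: "norm ((\<integral>\<omega>. cis (?S n \<omega> + ?R n \<omega>) \<partial>P) - (\<integral>\<omega>. cis (?S n \<omega>) \<partial>P) * cis ?r)
      \<le> (\<Sum>p\<in>UNIV. \<bar>r p\<bar> * (\<integral>\<omega>. \<bar>visits X A (fst p) (snd p) n \<omega> / v n p - 1\<bar> \<partial>P))" for n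
  proof -
    have "norm ((\<integral>\<omega>. cis (?S n \<omega> + ?R n \<omega>) \<partial>P) - (\<integral>\<omega>. cis (?S n \<omega>) \<partial>P) * cis ?r)
        = norm (\<integral>\<omega>. cis (?S n \<omega> + ?R n \<omega>) - cis (?S n \<omega>) * cis ?r \<partial>P)"
      using i1 i2 by (simp only: Bochner_Integration.integral_diff integrable_mult_left
          integral_mult_left_zero)
    also have "\<dots> \<le> (\<integral>\<omega>. norm (cis (?S n \<omega> + ?R n \<omega>) - cis (?S n \<omega>) * cis ?r) \<partial>P)"
      by (rule integral_norm_bound)
    also have "\<dots> \<le> (\<integral>\<omega>. (\<Sum>p\<in>UNIV. \<bar>r p\<bar> * \<bar>visits X A (fst p) (snd p) n \<omega> / v n p - 1\<bar>) \<partial>P)"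
    proof (rule integral_mono)
      show "integrable P (\<lambda>\<omega>. norm (cis (?S n \<omega> + ?R n \<omega>) - cis (?S n \<omega>) * cis ?r))"
        by (intro integrable_norm Bochner_Integration.integrable_diff i1 integrable_mult_left i2)
      show "integrable P (\<lambda>\<omega>. \<Sum>p\<in>UNIV. \<bar>r p\<bar> * \<bar>visits X A (fst p) (snd p) n \<omega> / v n p - 1\<bar>)"
        by (intro Bochner_Integration.integrable_sum integrable_mult_right integrable_visits_deviation)
      fix \<omega>
      have "norm (cis (?S n \<omega> + ?R n \<omega>) - cis (?S n \<omega>) * cis ?r) \<le> \<bar>?R n \<omega> - ?r\<bar>"
        using norm_cis_diff_le[of "?S n \<omega> + ?R n \<omega>" "?S n \<omega> + ?r"] unfolding cis_mult by (simp only: add_diff_cancel_left)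
      also have "?R n \<omega> - ?r = (\<Sum>p\<in>UNIV. r p * (visits X A (fst p) (snd p) n \<omega> / v n p - 1))"
        by (simp add: right_diff_distrib sum_subtractf)
      also have "\<bar>\<dots>\<bar> \<le> (\<Sum>p\<in>UNIV. \<bar>r p\<bar> * \<bar>visits X A (fst p) (snd p) n \<omega> / v n p - 1\<bar>)"
        unfolding abs_mult[symmetric] by (rule sum_abs)
      finally show "norm (cis (?S n \<omega> + ?R n \<omega>) - cis (?S n \<omega>) * cis ?r)
          \<le> (\<Sum>p\<in>UNIV. \<bar>r p\<bar> * \<bar>visits X A (fst p) (snd p) n \<omega> / v n p - 1\<bar>)" .
    qed
    also have "\<dots> = (\<Sum>p\<in>UNIV. \<bar>r p\<bar> * (\<integral>\<omega>. \<bar>visits X A (fst p) (snd p) n \<omega> / v n p - 1\<bar> \<partial>P))"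
      by (simp only: Bochner_Integration.integral_sum integrable_mult_right integrable_visits_deviation integral_mult_right_zero)
    finally show ?thesis .
  qed
  have "(\<lambda>n. \<Sum>p\<in>UNIV. \<bar>r p\<bar> * (\<integral>\<omega>. \<bar>visits X A (fst p) (snd p) n \<omega> / v n p - 1\<bar> \<partial>P)) \<longlonglongrightarrow> (\<Sum>p\<in>UNIV. \<bar>r p\<bar> * 0)"
    by (intro tendsto_sum tendsto_mult tendsto_const lln)
  then have "(\<lambda>n. (\<integral>\<omega>. cis (?S n \<omega> + ?R n \<omega>) \<partial>P) - (\<integral>\<omega>. cis (?S n \<omega>) \<partial>P) * cis ?r) \<longlonglongrightarrow> 0"
    by (intro Lim_null_comparison[OF always_eventually[OF allI[OF bound]]]) (simp only: mult_zero_right sum.neutral_const)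
  from tendsto_add[OF this tendsto_mult[OF cis_sum_tendsto[OF v lln, of c] tendsto_const[of "cis ?r"]]]
  show ?thesis by simp
qed

end

section \<open>Growth of the number of visits\<close>

lemma visit_time_0 [simp]: "visit_time X A s l 0 \<omega> = 0"
  by (simp add: visit_time_def)

lemma visit_time_Suc: "visit_time X A s l (Suc k) \<omega> = visit_time X A s l k \<omega> + return_time X A s l (Suc k) \<omega>"
  by (simp add: visit_time_def)

lemma return_time_Suc:
  "return_time X A s l (Suc k) \<omega> =
    (case visit_time X A s l k \<omega> of
       enat v \<Rightarrow> Inf {enat m |m. 0 < m \<and> X (v + m) \<omega> = s \<and> A (v + m) \<omega> = l}
     | \<infinity> \<Rightarrow> \<infinity>)"
  by (subst return_time.simps) (simp add: visit_time_def atLeastLessThanSuc_atLeastAtMost)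

lemma Inf_enat_le_iff: "Inf {enat m |m. Q m} \<le> enat q \<longleftrightarrow> (\<exists>m\<le>q. Q m)"
proof
  assume le: "Inf {enat m |m. Q m} \<le> enat q"
  then have "{enat m |m. Q m} \<noteq> {}"
    by (auto simp: Inf_enat_def split: if_splits)
  then have "Inf {enat m |m. Q m} \<in> {enat m |m. Q m}"
    unfolding Inf_enat_def by (auto intro: LeastI)
  with le show "\<exists>m\<le>q. Q m" by auto
next
  assume "\<exists>m\<le>q. Q m"
  then obtain m where "m \<le> q" "Q m" by auto
  then have "Inf {enat m |m. Q m} \<le> enat m" by (auto intro: Inf_lower)
  then show "Inf {enat m |m. Q m} \<le> enat q" using \<open>m \<le> q\<close> by (auto intro: order_trans)
qed

lemma card_filter_eq_sum: "finite S \<Longrightarrow> card {i \<in> S. Q i} = (\<Sum>i\<in>S. if Q i then 1 else 0)"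
  by (simp add: sum.If_cases Int_def)

lemma visit_time_Suc_le_iff:
  "visit_time X A s l (Suc k) \<omega> \<le> enat m \<longleftrightarrow>
    (\<exists>v j. visit_time X A s l k \<omega> = enat v \<and> v < j \<and> j \<le> m \<and> X j \<omega> = s \<and> A j \<omega> = l)"
proof (cases "visit_time X A s l k \<omega>")
  case (enat v)
  let ?I = "Inf {enat d |d. 0 < d \<and> X (v + d) \<omega> = s \<and> A (v + d) \<omega> = l}"
  have "enat v + ?I \<le> enat m \<longleftrightarrow> v \<le> m \<and> ?I \<le> enat (m - v)"
    by (cases ?I) auto
  also have "\<dots> \<longleftrightarrow> (\<exists>j. v < j \<and> j \<le> m \<and> X j \<omega> = s \<and> A j \<omega> = l)"
    unfolding Inf_enat_le_iff
  proof safe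
    fix d assume "v \<le> m" "d \<le> m - v" "0 < d" "s = X (v + d) \<omega>" "l = A (v + d) \<omega>"
    then show "\<exists>j>v. j \<le> m \<and> X j \<omega> = X (v + d) \<omega> \<and> A j \<omega> = A (v + d) \<omega>"
      by (intro exI[of _ "v + d"]) auto
  next
    fix j assume "v < j" "j \<le> m"
    then show "\<exists>d\<le>m - v. 0 < d \<and> X (v + d) \<omega> = X j \<omega> \<and> A (v + d) \<omega> = A j \<omega>"
      by (intro exI[of _ "j - v"]) auto
  qed auto
  finally show ?thesis
    by (simp add: visit_time_Suc return_time_Suc enat)
qed (simp add: visit_time_Suc)

text \<open>The duality between visit times and counts. Time 0 is left out of the count because the
  first return time is measured from 0 whether or not the pair is present there.\<close>

lemma visit_time_le_iff:
  "visit_time X A s l k \<omega> \<le> enat m \<longleftrightarrow> k \<le> card {i \<in> {1..m}. X i \<omega> = s \<and> A i \<omega> = l}"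
proof (induction k arbitrary: m)
  case 0
  then show ?case by (simp add: zero_enat_def[symmetric])
next
  case (Suc k)
  let ?V = "\<lambda>m. {i \<in> {1..m}. X i \<omega> = s \<and> A i \<omega> = l}"
  show ?case
  proof
    assume "visit_time X A s l (Suc k) \<omega> \<le> enat m"
    then obtain v j where vj: "visit_time X A s l k \<omega> = enat v" "v < j" "j \<le> m" "X j \<omega> = s" "A j \<omega> = l"
      by (auto simp: visit_time_Suc_le_iff)
    have "Suc k \<le> card (insert j (?V v))"
      using vj Suc.IH[of v] by simp
    also have "\<dots> \<le> card (?V m)"
      using vj by (intro card_mono) auto
    finally show "Suc k \<le> card (?V m)" .
  next
    assume k: "Suc k \<le> card (?V m)"
    then have "visit_time X A s l k \<omega> \<le> enat m"
      using Suc.IH[of m] by simp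
    then obtain v where v: "visit_time X A s l k \<omega> = enat v" "v \<le> m"
      by (cases "visit_time X A s l k \<omega>") auto
    \<comment> \<open>Minimality of \<open>v\<close>: fewer than \<open>k\<close> visits occur
      strictly before the \<open>k\<close>-th visit time, and \<open>v\<close> itself adds at most
      one.\<close>
    have "card (?V v) \<le> k"
    proof (cases v)
      case (Suc u)
      then have "card (?V u) < k"
        using Suc.IH[of u] v(1) by (simp add: not_le[symmetric])
      moreover have "?V v \<subseteq> insert v (?V u)" using Suc by auto
      then have "card (?V v) \<le> card (insert v (?V u))" by (intro card_mono) auto
      ultimately show ?thesis
        by (simp add: card_insert_if split: if_splits)
    qed simp
    then have "card (?V v) < card (?V m)" using k by simp
    then have "\<not> ?V m \<subseteq> ?V v"
      using card_mono[of "?V v" "?V m"] by auto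
    then obtain j where "j \<in> ?V m" "j \<notin> ?V v" by auto
    then show "visit_time X A s l (Suc k) \<omega> \<le> enat m"
      unfolding visit_time_Suc_le_iff using v(1) by (intro exI[of _ v] exI[of _ j]) auto
  qed
qed

text \<open>In general only an inequality: \<open>visits\<close> also counts a visit at time 0,
  which is no return.\<close>

lemma visits_ge_if_visit_time_le:
  assumes "visit_time X A s l k \<omega> \<le> enat m" "m < n"
  shows "k \<le> visits X A s l n \<omega>"
proof -
  have "k \<le> card {i \<in> {1..m}. X i \<omega> = s \<and> A i \<omega> = l}"
    using assms(1) by (simp add: visit_time_le_iff)
  also have "\<dots> \<le> card {i \<in> {..<n}. X i \<omega> = s \<and> A i \<omega> = l}"
    using assms(2) by (intro card_mono) auto
  also have "\<dots> = visits X A s l n \<omega>"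
    unfolding visits_def of_bool_def by (rule card_filter_eq_sum) simp
  finally show ?thesis .
qed

lemma visits_le: "visits X A s l n \<omega> \<le> n"
  by (induction n) (simp_all add: visits_def of_bool_def del: sum_of_bool_eq)

section \<open>Measurability of return times and the past of a visit\<close>

context observed_process
begin

lemma measurable_visit_time_le [measurable]:
  "Measurable.pred P (\<lambda>\<omega>. visit_time X A s l k \<omega> \<le> enat m)"
proof -
  have "(\<lambda>\<omega>. \<Sum>i\<in>{1..m}. if X i \<omega> = s \<and> A i \<omega> = l then 1 else 0) \<in> P \<rightarrow>\<^sub>M count_space (UNIV :: nat set)"
    by measurable
  then show ?thesis
    unfolding visit_time_le_iff by (simp add: card_filter_eq_sum)
qed

lemma measurable_return_time [measurable]: "return_time X A s l (Suc k) \<in> P \<rightarrow>\<^sub>M count_space UNIV"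
proof -
  let ?R = "return_time X A s l (Suc k)" and ?V = "visit_time X A s l"
  have le: "Measurable.pred P (\<lambda>\<omega>. ?R \<omega> \<le> enat m)" for m
  proof -
    \<comment> \<open>The witness \<open>v\<close> is the value of the \<open>k\<close>-th visit
      time, described by comparisons so that only events of the form
      \<open>visit_time \<le> enat u\<close> occur.\<close>
    have eq: "?R \<omega> \<le> enat m \<longleftrightarrow>
        (\<exists>v. ?V k \<omega> \<le> enat v \<and> (\<forall>u<v. \<not> ?V k \<omega> \<le> enat u) \<and> ?V (Suc k) \<omega> \<le> enat (v + m))" for \<omega>
    proof (cases "?V k \<omega>")
      case (enat v)
      have "?R \<omega> \<le> enat m \<longleftrightarrow> ?V (Suc k) \<omega> \<le> enat (v + m)"
        unfolding visit_time_Suc enat by (cases "?R \<omega>") auto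
      moreover have "w = v" if "enat v \<le> enat w" "\<forall>u<w. \<not> enat v \<le> enat u" for w
        using that by (metis enat_ord_simps(1) le_neq_implies_less order_refl)
      ultimately show ?thesis unfolding enat by (auto simp: not_le)
    qed (simp add: return_time_Suc)
    show ?thesis unfolding eq by measurable
  qed
  have "Measurable.pred P (\<lambda>\<omega>. ?R \<omega> = x)" for x
  proof (cases x)
    case (enat m)
    have "?R \<omega> = x \<longleftrightarrow> ?R \<omega> \<le> enat m \<and> (\<forall>j<m. \<not> ?R \<omega> \<le> enat j)" for \<omega>
      unfolding enat by (cases "?R \<omega>") (auto simp: not_le le_less)
    then show ?thesis using le by simp
  next
    case infinity
    have "?R \<omega> = x \<longleftrightarrow> (\<forall>j. \<not> ?R \<omega> \<le> enat j)" for \<omega>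
      unfolding infinity by (cases "?R \<omega>") auto
    then show ?thesis using le by simp
  qed
  then show ?thesis
    by (intro measurable_count_space_eq_countable[THEN iffD2]) (auto simp: pred_def vimage_def Int_def conj_commute)
qed

abbreviation "past k s l \<equiv> filtration.pre_sigma (space P) (history_filtration P X A) (visit_time X A s l k)"

lemma space_history_filtration: "space (history_filtration P X A j) = space P"
  by (rule filtration.space_F[OF filtration_history_filtration])

lemma pred_history_filtration:
  assumes "enat i \<le> j"
  shows "Measurable.pred (history_filtration P X A j) (\<lambda>\<omega>. X i \<omega> = s \<and> A i \<omega> = l)"
proof -
  have "{\<omega> \<in> space P. X i \<omega> = s \<and> A i \<omega> = l} \<in> sets (history_filtration P X A j)"
    unfolding history_filtration_def using assms by (intro in_measure_of) auto
  then show ?thesis by (simp add: pred_def space_history_filtration)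
qed

lemma sets_history_filtration: "sets (history_filtration P X A j) \<subseteq> sets P"
  unfolding history_filtration_def
proof (subst sets_measure_of)
  show "sigma_sets (space P) {{\<omega> \<in> space P. X i \<omega> = s \<and> A i \<omega> = l} |i s l. enat i \<le> j} \<subseteq> sets P"
  proof (rule sets.sigma_sets_subset, safe)
    fix i s l
    show "{\<omega> \<in> space P. X i \<omega> = s \<and> A i \<omega> = l} \<in> sets P" by measurable
  qed
qed blast

lemma past_generators:
  "{E. \<forall>t. {\<omega> \<in> E. visit_time X A s l k \<omega> \<le> t} \<in> sets (history_filtration P X A t)} \<subseteq> Pow (space P)"
proof safe
  fix E \<omega> assume E: "\<forall>t. {\<omega> \<in> E. visit_time X A s l k \<omega> \<le> t} \<in> sets (history_filtration P X A t)" "\<omega> \<in> E"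
  \<comment> \<open>At the index \<open>\<infinity>\<close> the constraint on the visit time is
    void, so \<open>E\<close> itself belongs to the \<sigma>-algebra of the whole process.\<close>
  then have "{\<omega> \<in> E. visit_time X A s l k \<omega> \<le> \<infinity>} \<in> sets (history_filtration P X A \<infinity>)" by blast
  from sets.sets_into_space[OF this] E(2) show "\<omega> \<in> space P"
    unfolding space_history_filtration by (auto simp only: enat_ord_code)
qed

lemma subalgebra_past: "subalgebra P (past k s l)"
proof -
  have "sets (past k s l) \<subseteq> sets P"
    unfolding filtration.pre_sigma_def[OF filtration_history_filtration]
  proof (subst sets_measure_of[OF past_generators])
    show "sigma_sets (space P) {E. \<forall>t. {\<omega> \<in> E. visit_time X A s l k \<omega> \<le> t} \<in> sets (history_filtration P X A t)} \<subseteq> sets P"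
    proof (rule sets.sigma_sets_subset, safe)
      fix E assume "\<forall>t. {\<omega> \<in> E. visit_time X A s l k \<omega> \<le> t} \<in> sets (history_filtration P X A t)"
      then have "{\<omega> \<in> E. visit_time X A s l k \<omega> \<le> \<infinity>} \<in> sets (history_filtration P X A \<infinity>)" by blast
      then show "E \<in> sets P" using sets_history_filtration by auto
    qed
  qed
  then show ?thesis
    by (simp add: subalgebra_def filtration.space_pre_sigma[OF filtration_history_filtration])
qed

text \<open>The initial pair is known at every visit time. Hence the conditional bounds on the
  return times may be integrated over an initial event, which carries them over to the conditioned
  measures.\<close>

lemma initial_event_past:
  "{\<omega> \<in> space P. X 0 \<omega> = s0 \<and> A 0 \<omega> = l0} \<in> sets (past k s l)"
proof -
  let ?B = "{\<omega> \<in> space P. X 0 \<omega> = s0 \<and> A 0 \<omega> = l0}"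
  let ?F = "history_filtration P X A"
  have "{\<omega> \<in> ?B. visit_time X A s l k \<omega> \<le> t} \<in> sets (?F t)" for t
  proof (cases t)
    case (enat m)
    have [measurable]: "Measurable.pred (?F (enat m)) (\<lambda>\<omega>. X i \<omega> = s \<and> A i \<omega> = l)" if "i \<le> m" for i s l
      using that by (intro pred_history_filtration) simp
    have "(\<lambda>\<omega>. \<Sum>i\<in>{1..m}. if X i \<omega> = s \<and> A i \<omega> = l then 1 else 0) \<in> ?F (enat m) \<rightarrow>\<^sub>M count_space (UNIV :: nat set)"
      by measurable
    then have [measurable]: "Measurable.pred (?F (enat m)) (\<lambda>\<omega>. visit_time X A s l k \<omega> \<le> enat m)"
      unfolding visit_time_le_iff by (simp add: card_filter_eq_sum)
    have "{\<omega> \<in> space P. X 0 \<omega> = s0 \<and> A 0 \<omega> = l0} \<inter> {\<omega> \<in> space P. visit_time X A s l k \<omega> \<le> enat m} \<in> sets (?F (enat m))"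
      using pred_history_filtration[of 0 "enat m" s0 l0]
        \<open>Measurable.pred (?F (enat m)) (\<lambda>\<omega>. visit_time X A s l k \<omega> \<le> enat m)\<close>
      by (intro sets.Int) (simp_all add: pred_def space_history_filtration)
    also have "{\<omega> \<in> space P. X 0 \<omega> = s0 \<and> A 0 \<omega> = l0} \<inter> {\<omega> \<in> space P. visit_time X A s l k \<omega> \<le> enat m}
        = {\<omega> \<in> ?B. visit_time X A s l k \<omega> \<le> t}"
      unfolding enat by blast
    finally show ?thesis
      unfolding enat .
  next
    case infinity
    have "Measurable.pred (?F \<infinity>) (\<lambda>\<omega>. X 0 \<omega> = s0 \<and> A 0 \<omega> = l0)"
      by (intro pred_history_filtration) simp
    then show ?thesis
      by (simp add: pred_def space_history_filtration infinity)
  qed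
  then show ?thesis
    unfolding filtration.pre_sigma_def[OF filtration_history_filtration]
    by (intro in_measure_of past_generators) simp
qed

end

text \<open>The finitely many exceptional indices are absorbed into the constant, which is possible
  because \<open>i powr \<alpha>\<close> is at least 1 for \<open>i \<ge> 1\<close>.\<close>

lemma bigo_powr_bound:
  fixes T :: "nat \<Rightarrow> real"
  assumes "T \<in> O(\<lambda>i. real i powr \<alpha>)" "0 \<le> \<alpha>"
  obtains c where "0 < c" "\<And>i. 1 \<le> i \<Longrightarrow> T i \<le> c * real i powr \<alpha>"
proof -
  obtain c' where c': "0 < c'" "\<forall>\<^sub>F i in sequentially. norm (T i) \<le> c' * norm (real i powr \<alpha>)"
    using landau_o.bigE[OF assms(1)] by blast
  then obtain n0 where n0: "\<And>i. n0 \<le> i \<Longrightarrow> \<bar>T i\<bar> \<le> c' * real i powr \<alpha>"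
    by (auto simp: eventually_sequentially)
  define c where "c = c' + (\<Sum>i<n0. \<bar>T i\<bar>)"
  have "T i \<le> c * real i powr \<alpha>" if i: "1 \<le> i" for i
  proof (cases "i < n0")
    case True
    then have "\<bar>T i\<bar> \<le> (\<Sum>i<n0. \<bar>T i\<bar>)"
      by (intro member_le_sum) auto
    then have "T i \<le> c * 1" using c'(1) by (simp add: c_def)
    also have "\<dots> \<le> c * real i powr \<alpha>"
      using i assms(2) c'(1) by (intro mult_left_mono ge_one_powr_ge_zero) (auto simp: c_def intro!: add_nonneg_nonneg sum_nonneg)
    finally show ?thesis .
  next
    case False
    then have "T i \<le> c' * real i powr \<alpha>" using n0[of i] by simp
    also have "\<dots> \<le> c * real i powr \<alpha>"
      by (intro mult_right_mono) (auto simp: c_def intro!: sum_nonneg)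
    finally show ?thesis .
  qed
  moreover have "0 < c" using c'(1) by (auto simp: c_def intro!: add_pos_nonneg sum_nonneg)
  ultimately show ?thesis using that by blast
qed

section \<open>Expected number of visits from a given initial pair\<close>

context observed_process
begin

definition initial_event :: "'s \<Rightarrow> 'a \<Rightarrow> 'w set" where
  "initial_event s0 l0 = {\<omega> \<in> space P. X 0 \<omega> = s0 \<and> A 0 \<omega> = l0}"

lemma sets_initial_event [measurable]: "initial_event s0 l0 \<in> sets P"
  unfolding initial_event_def by measurable

lemma return_time_integral_le:
  assumes "AE \<omega> in P. nn_cond_exp P (past k s l) (\<lambda>\<omega>. ennreal_of_enat (return_time X A s l (Suc k) \<omega>)) \<omega> \<le> t"
  shows "(\<integral>\<^sup>+\<omega>. indicator (initial_event s0 l0) \<omega> * ennreal_of_enat (return_time X A s l (Suc k) \<omega>) \<partial>P)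
    \<le> t * emeasure P (initial_event s0 l0)"
proof -
  let ?B = "initial_event s0 l0" and ?\<tau> = "\<lambda>\<omega>. ennreal_of_enat (return_time X A s l (Suc k) \<omega>)"
  interpret F: finite_measure_subalgebra P "past k s l"
    by unfold_locales (rule subalgebra_past)
  have [measurable]: "?\<tau> \<in> borel_measurable P"
    by (rule measurable_compose[OF measurable_return_time]) simp
  have "(\<integral>\<^sup>+\<omega>. indicator ?B \<omega> * ?\<tau> \<omega> \<partial>P) = (\<integral>\<^sup>+\<omega>. indicator ?B \<omega> * nn_cond_exp P (past k s l) ?\<tau> \<omega> \<partial>P)"
  proof (rule F.nn_cond_exp_intg[symmetric])
    have "?B \<in> sets (past k s l)"
      unfolding initial_event_def by (rule initial_event_past)
    then show "(indicator ?B :: 'w \<Rightarrow> ennreal) \<in> borel_measurable (past k s l)"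
      by simp
  qed simp
  also have "\<dots> \<le> (\<integral>\<^sup>+\<omega>. t * indicator ?B \<omega> \<partial>P)"
    using assms by (intro nn_integral_mono_AE) (auto simp: indicator_def)
  also have "\<dots> = t * emeasure P ?B"
    by (rule nn_integral_cmult_indicator) simp
  finally show ?thesis .
qed

text \<open>Markov's inequality: the visit time is a sum of \<open>k\<close> return times, each with
  integral over the initial event at most \<open>c * k powr \<alpha>\<close> times the probability
  of that event, and exceeding \<open>m\<close> means being at least \<open>Suc m\<close>.\<close>

lemma visit_time_tail:
  assumes T: "\<And>k. AE \<omega> in P. nn_cond_exp P (past k s l) (\<lambda>\<omega>. ennreal_of_enat (return_time X A s l (Suc k) \<omega>)) \<omega> \<le> ennreal (T (Suc k))"
    and le: "\<And>i. 1 \<le> i \<Longrightarrow> T i \<le> c * real i powr \<alpha>" and c: "0 < c" "0 \<le> \<alpha>"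
  shows "prob {\<omega> \<in> initial_event s0 l0. \<not> visit_time X A s l k \<omega> \<le> enat m} * real (Suc m)
    \<le> c * real k powr (1 + \<alpha>) * prob (initial_event s0 l0)"
proof -
  let ?B = "initial_event s0 l0"
  let ?D = "{\<omega> \<in> ?B. \<not> visit_time X A s l k \<omega> \<le> enat m}"
  have B: "emeasure P ?B = ennreal (prob ?B)" by (simp add: emeasure_eq_measure)
  have D [measurable]: "?D \<in> sets P" unfolding initial_event_def by measurable
  have meas: "(\<lambda>\<omega>. ennreal_of_enat (return_time X A s l i \<omega>)) \<in> borel_measurable P" if "1 \<le> i" for i
    using that by (cases i) (auto intro!: measurable_compose[OF measurable_return_time])
  have "ennreal (prob ?D * real (Suc m)) = (\<integral>\<^sup>+\<omega>. of_nat (Suc m) * indicator ?D \<omega> \<partial>P)"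
    by (subst nn_integral_cmult_indicator)
      (simp_all add: emeasure_eq_measure ennreal_mult mult.commute ennreal_of_nat_eq_real_of_nat)
  also have "\<dots> \<le> (\<integral>\<^sup>+\<omega>. (\<Sum>i\<in>{1..k}. indicator ?B \<omega> * ennreal_of_enat (return_time X A s l i \<omega>)) \<partial>P)"
  proof (rule nn_integral_mono)
    fix \<omega>
    show "of_nat (Suc m) * indicator ?D \<omega> \<le> (\<Sum>i\<in>{1..k}. indicator ?B \<omega> * ennreal_of_enat (return_time X A s l i \<omega>))"
    proof (cases "\<omega> \<in> ?D")
      case True
      then have "enat (Suc m) \<le> visit_time X A s l k \<omega>"
        by (cases "visit_time X A s l k \<omega>") auto
      then have "ennreal_of_enat (enat (Suc m)) \<le> ennreal_of_enat (visit_time X A s l k \<omega>)"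
        by (simp only: ennreal_of_enat_le_iff)
      then have "of_nat (Suc m) \<le> ennreal_of_enat (visit_time X A s l k \<omega>)"
        by (simp only: ennreal_of_enat_enat)
      then show ?thesis
        using True by (simp add: visit_time_def)
    qed simp
  qed
  also have "\<dots> = (\<Sum>i\<in>{1..k}. \<integral>\<^sup>+\<omega>. indicator ?B \<omega> * ennreal_of_enat (return_time X A s l i \<omega>) \<partial>P)"
    using meas by (intro nn_integral_sum borel_measurable_times_ennreal borel_measurable_indicator) auto
  also have "\<dots> \<le> (\<Sum>i\<in>{1..k}. ennreal (c * real k powr \<alpha> * prob ?B))"
  proof (rule sum_mono)
    fix i assume i: "i \<in> {1..k}"
    then obtain j where j: "i = Suc j" by (cases i) auto
    have "(\<integral>\<^sup>+\<omega>. indicator ?B \<omega> * ennreal_of_enat (return_time X A s l i \<omega>) \<partial>P) \<le> ennreal (T i) * emeasure P ?B"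
      unfolding j by (rule return_time_integral_le[OF T])
    also have "\<dots> \<le> ennreal (c * real k powr \<alpha>) * ennreal (prob ?B)"
    proof -
      have "T i \<le> c * real i powr \<alpha>" using i le by simp
      also have "\<dots> \<le> c * real k powr \<alpha>"
        using i c by (intro mult_left_mono powr_mono2) auto
      finally show ?thesis unfolding B by (intro mult_right_mono ennreal_leI) auto
    qed
    also have "\<dots> = ennreal (c * real k powr \<alpha> * prob ?B)"
      using c by (simp add: ennreal_mult)
    finally show "(\<integral>\<^sup>+\<omega>. indicator ?B \<omega> * ennreal_of_enat (return_time X A s l i \<omega>) \<partial>P)
        \<le> ennreal (c * real k powr \<alpha> * prob ?B)" .
  qed
  also have "\<dots> = ennreal (real k * (c * real k powr \<alpha> * prob ?B))"
    using c by (simp add: ennreal_mult ennreal_of_nat_eq_real_of_nat)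
  also have "real k * (c * real k powr \<alpha> * prob ?B) = c * real k powr (1 + \<alpha>) * prob ?B"
    by (cases "k = 0") (auto simp: powr_add)
  finally show ?thesis
    using c by (subst (asm) ennreal_le_iff) auto
qed

lemma initial_visits_lower_bound:
  assumes T: "\<And>k. AE \<omega> in P. nn_cond_exp P (past k s l) (\<lambda>\<omega>. ennreal_of_enat (return_time X A s l (Suc k) \<omega>)) \<omega> \<le> ennreal (T (Suc k))"
    and le: "\<And>i. 1 \<le> i \<Longrightarrow> T i \<le> c * real i powr \<alpha>" and c: "0 < c" "0 \<le> \<alpha>"
    and B: "0 < prob (initial_event s0 l0)" and n: "1 \<le> n"
  shows "((n / (2 * c)) powr (1 / (1 + \<alpha>)) - 1) / 2
    \<le> (\<integral>\<omega>. real (visits X A s l n \<omega>) * indicator (initial_event s0 l0) \<omega> \<partial>P) / prob (initial_event s0 l0)"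
proof -
  let ?B = "initial_event s0 l0"
  \<comment> \<open>The solution of \<open>c * x powr (1 + \<alpha>) = n / 2\<close>. With
    \<open>k\<close> its integer part, the tail bound shows that given the initial event the
    \<open>k\<close>-th visit occurs before time \<open>n\<close> with probability at least one
    half; the 1 subtracted in the claim pays for rounding.\<close>
  define x where "x = (n / (2 * c)) powr (1 / (1 + \<alpha>))"
  define k where "k = nat \<lfloor>x\<rfloor>"
  let ?D = "{\<omega> \<in> ?B. \<not> visit_time X A s l k \<omega> \<le> enat (n - 1)}"
  have x: "0 \<le> x" by (simp add: x_def)
  have k: "real k \<le> x" "x - 1 \<le> k"
    using x unfolding k_def by linarith+
  have D [measurable]: "?D \<in> sets P" unfolding initial_event_def by measurable
  have "c * real k powr (1 + \<alpha>) \<le> c * x powr (1 + \<alpha>)"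
    using c k by (intro mult_left_mono powr_mono2) auto
  also have "x powr (1 + \<alpha>) = n / (2 * c)"
    using c n by (simp add: x_def powr_powr)
  finally have "c * real k powr (1 + \<alpha>) \<le> n / 2"
    using c by simp
  then have "c * real k powr (1 + \<alpha>) * prob ?B \<le> n / 2 * prob ?B"
    by (intro mult_right_mono) auto
  moreover have "prob ?D * n \<le> c * real k powr (1 + \<alpha>) * prob ?B"
    using visit_time_tail[OF T le c, of s0 l0 k "n - 1"] n by simp
  moreover have "n / 2 * prob ?B = prob ?B / 2 * n"
    by simp
  ultimately have "prob ?D * n \<le> prob ?B / 2 * n"
    by linarith
  then have D_le: "prob ?D \<le> prob ?B / 2"
    using n by simp
  have "k * (prob ?B / 2) \<le> k * (prob ?B - prob ?D)"
    using D_le by (intro mult_left_mono) auto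
  also have "prob ?B - prob ?D = prob (?B - ?D)"
    by (rule finite_measure_Diff[symmetric]) auto
  also have "k * prob (?B - ?D) = (\<integral>\<omega>. real k * indicator (?B - ?D) \<omega> \<partial>P)"
    by simp
  also have "\<dots> \<le> (\<integral>\<omega>. real (visits X A s l n \<omega>) * indicator ?B \<omega> \<partial>P)"
  proof (rule integral_mono)
    show "integrable P (\<lambda>\<omega>. real k * indicator (?B - ?D) \<omega>)"
      by (intro integrable_mult_right integrable_real_indicator) (auto simp: emeasure_eq_measure)
    show "integrable P (\<lambda>\<omega>. real (visits X A s l n \<omega>) * indicator ?B \<omega>)"
      by (rule integrable_const_bound[where B=n]) (auto simp: visits_le indicator_def)
    show "real k * indicator (?B - ?D) \<omega> \<le> real (visits X A s l n \<omega>) * indicator ?B \<omega>" for \<omega>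
      using visits_ge_if_visit_time_le[of X A s l k \<omega> "n - 1" n] n by (auto simp: indicator_def)
  qed
  finally have "k / 2 \<le> (\<integral>\<omega>. real (visits X A s l n \<omega>) * indicator ?B \<omega> \<partial>P) / prob ?B"
    using B by (simp add: field_simps)
  moreover have "(x - 1) / 2 \<le> k / 2" using k by simp
  ultimately show ?thesis unfolding x_def[symmetric] by (rule order_trans[rotated])
qed

lemma initial_visits_growth:
  assumes "return_time_condition P X A" and B: "0 < prob (initial_event s0 l0)"
  shows "filterlim (\<lambda>n. (\<integral>\<omega>. real (visits X A s l n \<omega>) * indicator (initial_event s0 l0) \<omega> \<partial>P)
    / prob (initial_event s0 l0) / sqrt n) at_top sequentially"
proof -
  obtain \<alpha> T where \<alpha>: "0 < \<alpha>" "\<alpha> < 1" and T: "T \<in> O(\<lambda>i. real i powr \<alpha>)"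
    and ae: "\<And>i. 1 \<le> i \<Longrightarrow> AE \<omega> in P. nn_cond_exp P (past (i - 1) s l)
        (\<lambda>\<omega>. ennreal_of_enat (return_time X A s l i \<omega>)) \<omega> \<le> ennreal (T i)"
    using assms(1) unfolding return_time_condition_def by metis
  obtain c where c: "0 < c" "\<And>i. 1 \<le> i \<Longrightarrow> T i \<le> c * real i powr \<alpha>"
    using bigo_powr_bound[OF T] \<alpha> by auto
  define \<beta> where "\<beta> = 1 / (1 + \<alpha>)"
  \<comment> \<open>Here \<open>\<alpha> < 1\<close> enters: it makes the mean outgrow the standard
    deviation, which is of order at most \<open>sqrt n\<close>.\<close>
  have \<beta>: "1 / 2 < \<beta>" using \<alpha> by (simp add: \<beta>_def field_simps)
  define d where "d = 1 / (2 * c)"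
  have d: "0 < d" using c by (simp add: d_def)
  have "filterlim (\<lambda>n. ((real n * d) powr \<beta> - 1) / 2 / sqrt (real n)) at_top sequentially"
    using \<beta> d by real_asymp
  moreover have "\<forall>\<^sub>F n in sequentially. ((real n * d) powr \<beta> - 1) / 2 / sqrt (real n)
      \<le> (\<integral>\<omega>. real (visits X A s l n \<omega>) * indicator (initial_event s0 l0) \<omega> \<partial>P) / prob (initial_event s0 l0) / sqrt n"
    using eventually_ge_at_top[of 1]
  proof eventually_elim
    case (elim n)
    have "((n / (2 * c)) powr (1 / (1 + \<alpha>)) - 1) / 2
        \<le> (\<integral>\<omega>. real (visits X A s l n \<omega>) * indicator (initial_event s0 l0) \<omega> \<partial>P) / prob (initial_event s0 l0)"
      using ae[of "Suc _"] \<alpha> by (intro initial_visits_lower_bound[where T=T] c B elim) auto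
    then show ?case
      by (intro divide_right_mono) (auto simp: \<beta>_def d_def)
  qed
  ultimately show ?thesis by (rule filterlim_at_top_mono)
qed

end

section \<open>Variance of the number of visits\<close>

text \<open>Division by \<open>0\<close> is harmless here: children of weight \<open>0\<close> have vanishing first and second
  moments.\<close>

lemma second_moment_step:
  fixes p F G :: "'c \<Rightarrow> real"
  assumes S: "finite S" and p: "\<And>a. a \<in> S \<Longrightarrow> 0 \<le> p a" and pos: "0 < sum p S"
    and null: "\<And>a. a \<in> S \<Longrightarrow> p a = 0 \<Longrightarrow> F a = 0 \<and> G a = 0"
    and IH: "\<And>a. a \<in> S \<Longrightarrow> 0 < p a \<Longrightarrow> G a - (F a)\<^sup>2 / p a \<le> D * p a"
    and osc: "\<And>a b. a \<in> S \<Longrightarrow> b \<in> S \<Longrightarrow> 0 < p a \<Longrightarrow> 0 < p b \<Longrightarrow> \<bar>F a / p a - F b / p b\<bar> \<le> C"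
  shows "sum G S - (sum F S)\<^sup>2 / sum p S \<le> (D + C\<^sup>2) * sum p S"
proof -
  let ?p = "sum p S"
  \<comment> \<open>Read \<open>S\<close> as the one-step extensions of a history, with
    \<open>p\<close>, \<open>F\<close> and \<open>G\<close> their unnormalised probabilities, first
    and second moments. Then \<open>f\<close> is the conditional mean at the parent, an average of
    the means \<open>F a / p a\<close>.\<close>
  define f where "f = sum F S / ?p"
  have F: "p a * (F a / p a) = F a" if "a \<in> S" for a
    using null[OF that] by auto
  have dev: "\<bar>F a / p a - f\<bar> \<le> C" if a: "a \<in> S" "0 < p a" for a
  proof -
    have "(\<Sum>b\<in>S. p b * (F a / p a - F b / p b)) = ?p * (F a / p a) - sum F S"
    proof -
      have "(\<Sum>b\<in>S. p b * (F a / p a - F b / p b)) = (\<Sum>b\<in>S. p b * (F a / p a) - F b)"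
        by (rule sum.cong) (simp_all only: right_diff_distrib F)
      then show ?thesis by (simp only: sum_subtractf sum_distrib_right)
    qed
    then have "?p * (F a / p a - f) = (\<Sum>b\<in>S. p b * (F a / p a - F b / p b))"
      using pos by (simp add: f_def right_diff_distrib)
    also have "\<bar>\<dots>\<bar> \<le> (\<Sum>b\<in>S. p b * C)"
    proof (rule order_trans[OF sum_abs sum_mono])
      fix b assume b: "b \<in> S"
      show "\<bar>p b * (F a / p a - F b / p b)\<bar> \<le> p b * C"
        using p[OF b] osc[OF a(1) b a(2)] by (cases "p b = 0") (auto simp: abs_mult intro: mult_left_mono)
    qed
    finally have "\<bar>?p * (F a / p a - f)\<bar> \<le> ?p * C"
      by (simp only: sum_distrib_right)
    then show ?thesis
      using pos by (simp only: abs_mult abs_of_pos mult_le_cancel_left_pos)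
  qed
  \<comment> \<open>The squared mean of a child is expanded around \<open>f\<close>, and its squared
    deviation from \<open>f\<close> costs \<open>C\<^sup>2\<close>. The terms linear in
    \<open>F\<close> and \<open>p\<close> add up to the squared mean of the parent.\<close>
  have "G a \<le> 2 * f * F a - f\<^sup>2 * p a + (D + C\<^sup>2) * p a" if a: "a \<in> S" for a
  proof (cases "p a = 0")
    case False
    then have pa: "0 < p a" using p[OF a] by simp
    have "(F a / p a - f)\<^sup>2 \<le> C\<^sup>2"
      using power_mono[OF dev[OF a pa], of 2] by simp
    then have "p a * (F a / p a - f)\<^sup>2 \<le> p a * C\<^sup>2"
      using pa by (intro mult_left_mono) auto
    moreover have "p a * (F a / p a - f)\<^sup>2 = (F a)\<^sup>2 / p a - 2 * f * F a + f\<^sup>2 * p a"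
      using pa by (simp add: power2_eq_square field_simps)
    ultimately show ?thesis
      using IH[OF a pa] by (simp add: algebra_simps)
  qed (use null[OF a] in auto)
  then have "sum G S \<le> (\<Sum>a\<in>S. 2 * f * F a - f\<^sup>2 * p a + (D + C\<^sup>2) * p a)"
    by (rule sum_mono)
  also have "\<dots> = 2 * f * sum F S - f\<^sup>2 * ?p + (D + C\<^sup>2) * ?p"
    by (simp add: sum.distrib sum_subtractf sum_distrib_left)
  also have "2 * f * sum F S - f\<^sup>2 * ?p = (sum F S)\<^sup>2 / ?p"
    using pos by (simp add: f_def power2_eq_square field_simps)
  finally show ?thesis by simp
qed

context observed_process
begin

definition history_prob :: "('s \<times> 'a) list \<Rightarrow> real" where
  "history_prob h = prob {\<omega> \<in> space P. history (length h) \<omega> = h}"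

text \<open>Moments restricted to a history rather than conditioned on it: those of the one-step
  extensions add up, and null histories need no division.\<close>

definition visits_moment :: "nat \<Rightarrow> 's \<Rightarrow> 'a \<Rightarrow> nat \<Rightarrow> ('s \<times> 'a) list \<Rightarrow> real" where
  "visits_moment r s l n h = (\<integral>\<omega>. real (visits X A s l n \<omega>) ^ r * of_bool (history (length h) \<omega> = h) \<partial>P)"

lemma integrable_visits_moment:
  "integrable P (\<lambda>\<omega>. real (visits X A s l n \<omega>) ^ r * of_bool (history m \<omega> = h))"
proof (rule integrable_history_determined)
  show "history_determined (max n m) (\<lambda>\<omega>. real (visits X A s l n \<omega>) ^ r * of_bool (history m \<omega> = h))"
    unfolding history_determined_def
  proof (intro allI impI)
    fix \<omega> \<omega>' assume eq: "history (max n m) \<omega> = history (max n m) \<omega>'"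
    have "visits X A s l n \<omega> = visits X A s l n \<omega>'"
      by (rule history_determinedD[OF history_determined_visits eq]) simp
    moreover have "history m \<omega> = history m \<omega>'"
      using eq by (auto simp: trajectory_eq_iff)
    ultimately show "real (visits X A s l n \<omega>) ^ r * of_bool (history m \<omega> = h)
        = real (visits X A s l n \<omega>') ^ r * of_bool (history m \<omega>' = h)"
      by (simp only:)
  qed
qed

lemma history_prob_eq: "history_prob h = visits_moment 0 s l n h"
proof -
  have "history_prob h = (\<integral>\<omega>. indicator {\<omega> \<in> space P. history (length h) \<omega> = h} \<omega> \<partial>P)"
    by (simp add: history_prob_def)
  also have "\<dots> = visits_moment 0 s l n h"
    unfolding visits_moment_def by (intro Bochner_Integration.integral_cong) auto
  finally show ?thesis .
qed

lemma visits_moment_children: "visits_moment r s l n h = (\<Sum>a\<in>UNIV. visits_moment r s l n (h @ [a]))"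
proof -
  have "of_bool (history (length h) \<omega> = h) = (\<Sum>a\<in>UNIV. of_bool (history (Suc (length h)) \<omega> = h @ [a]) :: real)" for \<omega>
    by (subst sum.remove[of _ "(X (length h) \<omega>, A (length h) \<omega>)"]) (auto simp: trajectory_Suc intro!: sum.neutral)
  then have "real (visits X A s l n \<omega>) ^ r * of_bool (history (length h) \<omega> = h)
      = (\<Sum>a\<in>UNIV. real (visits X A s l n \<omega>) ^ r * of_bool (history (length (h @ [a])) \<omega> = h @ [a]))" for \<omega>
    by (simp only: sum_distrib_left length_append list.size add_0_right add_Suc_right)
  then show ?thesis
    unfolding visits_moment_def
    by (simp only: Bochner_Integration.integral_sum integrable_visits_moment)
qed

lemma visits_moment_null:
  assumes "history_prob h = 0"
  shows "visits_moment r s l n h = 0"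
proof -
  have "AE \<omega> in P. history (length h) \<omega> \<noteq> h"
    using assms by (subst (asm) history_prob_def, subst (asm) prob_eq_0) (auto simp: AE_iff_measurable)
  then have "AE \<omega> in P. real (visits X A s l n \<omega>) ^ r * of_bool (history (length h) \<omega> = h) = 0"
    by eventually_elim simp
  then show ?thesis
    unfolding visits_moment_def by (rule integral_eq_zero_AE)
qed

lemma visits_moment_1:
  "visits_moment 1 s l n h
    = (\<Sum>j<n. prob {\<omega> \<in> space P. (X j \<omega> = s \<and> A j \<omega> = l) \<and> history (length h) \<omega> = h})"
proof -
  have "visits_moment 1 s l n h
      = (\<integral>\<omega>. (\<Sum>j<n. indicator {\<omega> \<in> space P. (X j \<omega> = s \<and> A j \<omega> = l) \<and> history (length h) \<omega> = h} \<omega>) \<partial>P)"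
    unfolding visits_moment_def
  proof (intro Bochner_Integration.integral_cong refl)
    fix \<omega> assume "\<omega> \<in> space P"
    then show "real (visits X A s l n \<omega>) ^ 1 * of_bool (history (length h) \<omega> = h)
        = (\<Sum>j<n. indicator {\<omega> \<in> space P. (X j \<omega> = s \<and> A j \<omega> = l) \<and> history (length h) \<omega> = h} \<omega>)"
      by (cases "history (length h) \<omega> = h")
        (auto simp: visits_def indicator_def simp del: sum_of_bool_eq intro!: sum.cong)
  qed
  also have "\<dots> = (\<Sum>j<n. prob {\<omega> \<in> space P. (X j \<omega> = s \<and> A j \<omega> = l) \<and> history (length h) \<omega> = h})"
    by (subst Bochner_Integration.integral_sum)
      (simp_all only: integrable_indicator_iff integral_indicator, auto simp: emeasure_eq_measure intro!: sum.cong arg_cong[where f=prob])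
  finally show ?thesis .
qed

lemma cond_prob_bounds:
  assumes "Measurable.pred P Q" "Measurable.pred P R"
  shows "0 \<le> cond_prob P Q R \<and> cond_prob P Q R \<le> 1"
proof -
  have "prob {\<omega> \<in> space P. Q \<omega> \<and> R \<omega>} \<le> prob {\<omega> \<in> space P. R \<omega>}"
    using assms(2) by (intro finite_measure_mono) (auto simp: pred_def)
  moreover have "0 \<le> prob {\<omega> \<in> space P. Q \<omega> \<and> R \<omega>}" "0 \<le> prob {\<omega> \<in> space P. R \<omega>}"
    by (rule measure_nonneg)+
  ultimately show ?thesis
    unfolding cond_prob_def by (auto simp: divide_le_eq_1 less_le)
qed

text \<open>A visit at time \<open>j\<close> is an event on the first entry of the future
  trajectory, hence one of the sets in the supremum. All competing differences are at most 1, so the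
  real supremum is a genuine upper bound, and the two given histories supply a member, hence
  nonnegativity.\<close>

lemma mixing_coeff_bound:
  assumes "i < j" "j \<le> n" "length h = i" "0 < history_prob (h @ [a])" "0 < history_prob (h @ [b])"
  shows "\<bar>prob {\<omega> \<in> space P. (X j \<omega> = s \<and> A j \<omega> = l) \<and> history (Suc i) \<omega> = h @ [a]} / history_prob (h @ [a])
      - prob {\<omega> \<in> space P. (X j \<omega> = s \<and> A j \<omega> = l) \<and> history (Suc i) \<omega> = h @ [b]} / history_prob (h @ [b])\<bar>
    \<le> weak_mixing_coeff P X A n i j" (is "?d \<le> _")
    and "0 \<le> weak_mixing_coeff P X A n i j"
proof -
  let ?S = "{\<bar>\<P>(\<omega> in P. trajectory X A j (Suc n) \<omega> \<in> \<T> \<bar> X i \<omega> = s1 \<and> A i \<omega> = l1 \<and> trajectory X A 0 i \<omega> = h)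
          - \<P>(\<omega> in P. trajectory X A j (Suc n) \<omega> \<in> \<T> \<bar> X i \<omega> = s2 \<and> A i \<omega> = l2 \<and> trajectory X A 0 i \<omega> = h)\<bar>
         |\<T> s1 s2 l1 l2 h.
           \<T> \<subseteq> {x. length x = n - j + 1} \<and> length h = i \<and>
           \<P>(\<omega> in P. X i \<omega> = s1 \<and> A i \<omega> = l1 \<and> trajectory X A 0 i \<omega> = h) > 0 \<and>
           \<P>(\<omega> in P. X i \<omega> = s2 \<and> A i \<omega> = l2 \<and> trajectory X A 0 i \<omega> = h) > 0}"
  have cond: "X i \<omega> = fst c \<and> A i \<omega> = snd c \<and> trajectory X A 0 i \<omega> = h \<longleftrightarrow> history (Suc i) \<omega> = h @ [c]" for c \<omega>
    by (auto simp: trajectory_Suc prod_eq_iff)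
  define \<T> where "\<T> = {x :: ('s \<times> 'a) list. length x = n - j + 1 \<and> hd x = (s, l)}"
  have hd_T: "trajectory X A j (Suc n) \<omega> \<in> \<T> \<longleftrightarrow> X j \<omega> = s \<and> A j \<omega> = l" for \<omega>
    using assms(2) by (auto simp: \<T>_def trajectory_def upt_conv_Cons simp del: upt_Suc)
  have bdd: "bdd_above ?S"
  proof (rule bdd_aboveI[where M=1])
    have m1: "Measurable.pred P (\<lambda>\<omega>. trajectory X A j (Suc n) \<omega> \<in> \<T>)"
      and m2: "Measurable.pred P (\<lambda>\<omega>. X i \<omega> = s \<and> A i \<omega> = l \<and> trajectory X A 0 i \<omega> = h)" for \<T> s l h
      by measurable
    fix x assume "x \<in> ?S"
    then obtain \<T> s1 s2 l1 l2 h where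
      x: "x = \<bar>\<P>(\<omega> in P. trajectory X A j (Suc n) \<omega> \<in> \<T> \<bar> X i \<omega> = s1 \<and> A i \<omega> = l1 \<and> trajectory X A 0 i \<omega> = h)
          - \<P>(\<omega> in P. trajectory X A j (Suc n) \<omega> \<in> \<T> \<bar> X i \<omega> = s2 \<and> A i \<omega> = l2 \<and> trajectory X A 0 i \<omega> = h)\<bar>"
      by blast
    show "x \<le> 1"
      unfolding x using cond_prob_bounds[OF m1 m2, of \<T> s1 l1 h] cond_prob_bounds[OF m1 m2, of \<T> s2 l2 h] by linarith
  qed
  have "?d = \<bar>\<P>(\<omega> in P. trajectory X A j (Suc n) \<omega> \<in> \<T> \<bar> X i \<omega> = fst a \<and> A i \<omega> = snd a \<and> trajectory X A 0 i \<omega> = h)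
          - \<P>(\<omega> in P. trajectory X A j (Suc n) \<omega> \<in> \<T> \<bar> X i \<omega> = fst b \<and> A i \<omega> = snd b \<and> trajectory X A 0 i \<omega> = h)\<bar>"
    unfolding cond_prob_def hd_T cond using assms(3) by (simp add: history_prob_def)
  moreover have "\<P>(\<omega> in P. X i \<omega> = fst c \<and> A i \<omega> = snd c \<and> trajectory X A 0 i \<omega> = h) = history_prob (h @ [c])" for c
    unfolding cond using assms(3) by (simp add: history_prob_def)
  ultimately have "?d \<in> ?S"
    using assms by (intro CollectI exI[of _ \<T>] exI[of _ "fst a"] exI[of _ "snd a"] exI[of _ "fst b"] exI[of _ "snd b"] exI[of _ h])
      (auto simp: \<T>_def)
  then show "?d \<le> weak_mixing_coeff P X A n i j"
    unfolding weak_mixing_coeff_def using bdd by (rule cSup_upper)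
  then show "0 \<le> weak_mixing_coeff P X A n i j"
    by (rule order_trans[rotated]) simp
qed

text \<open>For two histories that differ only in their last pair, at time \<open>i\<close>, visits
  before \<open>i\<close> agree, the visit at \<open>i\<close> contributes at most 1, and each later
  one its mixing coefficient. The total is one of the sums in the mixing norm, whose maximum starts
  at index 1; hence \<open>1 \<le> i\<close>.\<close>

lemma conditional_visits_oscillation:
  assumes "1 \<le> i" "i < n" "length h = i" "0 < history_prob (h @ [a])" "0 < history_prob (h @ [b])"
  shows "\<bar>visits_moment 1 s l n (h @ [a]) / history_prob (h @ [a])
      - visits_moment 1 s l n (h @ [b]) / history_prob (h @ [b])\<bar> \<le> mixing_norm P X A n"
proof -
  let ?p = "\<lambda>j c. prob {\<omega> \<in> space P. (X j \<omega> = s \<and> A j \<omega> = l) \<and> history (Suc i) \<omega> = h @ [c]} / history_prob (h @ [c])"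
  let ?\<eta> = "weak_mixing_coeff P X A n i"
  have bound: "\<bar>?p j a - ?p j b\<bar> \<le> (if j < i then 0 else if j = i then 1 else ?\<eta> j)" if "j < n" for j
  proof -
    consider "j < i" | "j = i" | "i < j" by linarith
    then show ?thesis
    proof cases
      case 1
      have "{\<omega> \<in> space P. (X j \<omega> = s \<and> A j \<omega> = l) \<and> history (Suc i) \<omega> = h @ [c]}
          = (if h ! j = (s, l) then {\<omega> \<in> space P. history (Suc i) \<omega> = h @ [c]} else {})" for c
      proof -
        have "X j \<omega> = fst (h ! j) \<and> A j \<omega> = snd (h ! j)" if hc: "history (Suc i) \<omega> = h @ [c]" for \<omega>
        proof -
          have "(X j \<omega>, A j \<omega>) = (h @ [c]) ! j"
            unfolding hc[symmetric] using 1 by (subst nth_trajectory) auto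
          also have "\<dots> = h ! j" using 1 assms(3) by (simp add: nth_append)
          finally show ?thesis by (metis fst_conv snd_conv)
        qed
        then show ?thesis by (cases "h ! j") auto
      qed
      then show ?thesis
        using 1 assms by (simp add: history_prob_def)
    next
      case 2
      have "0 \<le> ?p j c \<and> ?p j c \<le> 1" for c
      proof -
        have "?p j c = \<P>(\<omega> in P. X j \<omega> = s \<and> A j \<omega> = l \<bar> history (Suc i) \<omega> = h @ [c])"
          using assms(3) by (simp add: cond_prob_def history_prob_def)
        also have "0 \<le> \<dots> \<and> \<dots> \<le> 1"
          by (rule cond_prob_bounds) measurable
        finally show ?thesis .
      qed
      from this[of a] this[of b] have "\<bar>?p j a - ?p j b\<bar> \<le> 1"
        by linarith
      then show ?thesis using 2 by simp
    next
      case 3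
      then show ?thesis
        using mixing_coeff_bound(1)[of i j n h a b s l] assms that by simp
    qed
  qed
  have "visits_moment 1 s l n (h @ [c]) / history_prob (h @ [c]) = (\<Sum>j<n. ?p j c)" for c
    using assms(3) by (simp only: visits_moment_1 sum_divide_distrib length_append list.size add_0_right add_Suc_right)
  then have "\<bar>visits_moment 1 s l n (h @ [a]) / history_prob (h @ [a])
      - visits_moment 1 s l n (h @ [b]) / history_prob (h @ [b])\<bar> = \<bar>\<Sum>j<n. ?p j a - ?p j b\<bar>"
    by (simp only: sum_subtractf)
  also have "\<dots> \<le> (\<Sum>j<n. if j < i then 0 else if j = i then 1 else ?\<eta> j)"
    using bound by (intro order_trans[OF sum_abs sum_mono]) auto
  also have "\<dots> = (\<Sum>j\<in>{i..<n}. if j = i then 1 else ?\<eta> j)"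
    by (rule sum.mono_neutral_cong_right) auto
  also have "\<dots> = 1 + (\<Sum>j\<in>{i<..<n}. ?\<eta> j)"
    using assms(2) by (subst sum.remove[of _ i]) (auto intro!: arg_cong[where f="sum _"] sum.cong)
  \<comment> \<open>Visits are counted strictly before \<open>n\<close>; the coefficient at
    \<open>j = n\<close> is nonnegative and completes the sum.\<close>
  also have "\<dots> \<le> 1 + (\<Sum>j\<in>{i<..n}. ?\<eta> j)"
    using mixing_coeff_bound(2)[of i _ n h a b] assms by (intro add_left_mono sum_mono2) auto
  also have "\<dots> \<le> mixing_norm P X A n"
    unfolding mixing_norm_def using assms by (intro Max_ge) auto
  finally show ?thesis .
qed

text \<open>Induction on the number of pairs still to be revealed. A complete history determines the
  visits, and one more pair moves the conditional mean by at most \<open>C\<close>, at a cost of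
  \<open>C\<^sup>2\<close>. Starting at length 1 leaves out the step from the empty history, over
  which the mixing norm has no control.\<close>

lemma conditional_visits_variance:
  assumes "1 \<le> length h" "length h \<le> n" "0 < history_prob h" and C: "mixing_norm P X A n \<le> C"
  shows "visits_moment 2 s l n h - (visits_moment 1 s l n h)\<^sup>2 / history_prob h
    \<le> real (n - length h) * C\<^sup>2 * history_prob h"
  using assms(1-3)
proof (induction "n - length h" arbitrary: h)
  case 0
  then have len: "length h = n" by simp
  have "\<exists>N::nat. \<forall>\<omega>. history n \<omega> = h \<longrightarrow> visits X A s l n \<omega> = N"
    using history_determinedD[OF history_determined_visits[OF order_refl, of n s l]]
    by (metis (no_types))
  then obtain N :: nat where N: "\<And>\<omega>. history n \<omega> = h \<Longrightarrow> visits X A s l n \<omega> = N" by blast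
  have "visits_moment r s l n h = real N ^ r * history_prob h" for r
  proof -
    have "visits_moment r s l n h = (\<integral>\<omega>. real N ^ r * indicator {\<omega> \<in> space P. history n \<omega> = h} \<omega> \<partial>P)"
      unfolding visits_moment_def len by (intro Bochner_Integration.integral_cong) (auto simp: N)
    then show ?thesis by (simp add: history_prob_def len)
  qed
  then show ?case
    using 0 by (simp add: power2_eq_square field_simps)
next
  case (Suc k)
  then have len: "length h < n" and k: "real (n - length h) = real k + 1" "k = n - length (h @ [a])" for a by auto
  have hp: "history_prob h = (\<Sum>a\<in>UNIV. history_prob (h @ [a]))"
    unfolding history_prob_eq[of _ s l n] by (rule visits_moment_children)
  have "visits_moment 2 s l n h - (visits_moment 1 s l n h)\<^sup>2 / history_prob h
      \<le> (k * C\<^sup>2 + C\<^sup>2) * history_prob h"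
    unfolding hp visits_moment_children[of _ s l n h]
  proof (rule second_moment_step)
    show "0 \<le> history_prob (h @ [a])" for a by (simp add: history_prob_def)
    show "0 < (\<Sum>a\<in>UNIV. history_prob (h @ [a]))"
      using Suc.prems by (simp add: hp)
    show "visits_moment 2 s l n (h @ [a]) - (visits_moment 1 s l n (h @ [a]))\<^sup>2 / history_prob (h @ [a])
        \<le> k * C\<^sup>2 * history_prob (h @ [a])" if "0 < history_prob (h @ [a])" for a
      using Suc.hyps(1)[OF k(2), of a] that len k(2)[of a] by simp
    show "\<bar>visits_moment 1 s l n (h @ [a]) / history_prob (h @ [a])
        - visits_moment 1 s l n (h @ [b]) / history_prob (h @ [b])\<bar> \<le> C"
      if "0 < history_prob (h @ [a])" "0 < history_prob (h @ [b])" for a b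
      using conditional_visits_oscillation[OF Suc.prems(1) len refl that] C by (rule order_trans)
  qed (auto simp: visits_moment_null)
  then show ?case
    unfolding k(1) by (simp add: distrib_right)
qed

end

section \<open>Conditioning on the initial state and action\<close>

sublocale controlled_markov_chain \<subseteq> observed_process
  by unfold_locales (rule X_measurable A_measurable)+

lemma (in controlled_markov_chain) kernel_process:
  assumes "transition_kernel M" "null_hypothesis P X A M"
  shows "kernel_process P X A M"
proof unfold_locales
  show "transition_kernel M" by fact
  fix m and h :: "('s \<times> 'a) list" and t
  assume "length h = Suc m"
  then obtain g s l where h: "h = g @ [(s, l)]" "length g = m"
    by (metis append_butlast_last_id length_butlast diff_Suc_1 list.size(3) nat.distinct(1) surj_pair)
  have ev: "history (Suc m) \<omega> = h \<longleftrightarrow> history m \<omega> = g \<and> X m \<omega> = s \<and> A m \<omega> = l" for \<omega>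
    by (simp add: h trajectory_Suc)
  let ?p = "prob {\<omega> \<in> space P. history m \<omega> = g \<and> X m \<omega> = s \<and> A m \<omega> = l}"
  let ?q = "prob {\<omega> \<in> space P. (history m \<omega> = g \<and> X m \<omega> = s \<and> A m \<omega> = l) \<and> X (Suc m) \<omega> = t}"
  have "?q = ?p * M s l t"
  proof (cases "?p = 0")
    case True
    have "?q \<le> ?p" by (rule finite_measure_mono) auto
    then show ?thesis using True by (simp add: measure_le_0_iff)
  next
    case False
    then have pos: "0 < ?p" by (simp add: zero_less_measure_iff)
    have "?p \<le> prob {\<omega> \<in> space P. X m \<omega> = s \<and> A m \<omega> = l}"
      by (rule finite_measure_mono) auto
    then have "M s l t = \<P>(\<omega> in P. X (Suc m) \<omega> = t \<bar> X m \<omega> = s \<and> A m \<omega> = l)"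
      using pos assms(2) by (simp add: null_hypothesis_def)
    also have "\<dots> = \<P>(\<omega> in P. X (Suc m) \<omega> = t \<bar> history m \<omega> = g \<and> X m \<omega> = s \<and> A m \<omega> = l)"
      by (rule markov[OF pos, symmetric])
    also have "\<dots> = ?q / ?p"
      by (simp add: cond_prob_def conj_commute conj_left_commute)
    finally show ?thesis using pos by simp
  qed
  then show "prob {\<omega> \<in> space P. history (Suc m) \<omega> = h \<and> X (Suc m) \<omega> = t}
      = prob {\<omega> \<in> space P. history (Suc m) \<omega> = h} * M (fst (last h)) (snd (last h)) t"
    unfolding ev by (simp add: h)
qed

context observed_process
begin

definition conditioned :: "'s \<Rightarrow> 'a \<Rightarrow> 'w measure" where
  "conditioned s0 l0 = uniform_measure P (initial_event s0 l0)"

lemma sets_conditioned [simp, measurable_cong]: "sets (conditioned s0 l0) = sets P"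
  and space_conditioned [simp]: "space (conditioned s0 l0) = space P"
  by (simp_all add: conditioned_def)

lemma prob_space_conditioned:
  assumes "0 < prob (initial_event s0 l0)"
  shows "prob_space (conditioned s0 l0)"
  unfolding conditioned_def using assms
  by (intro prob_space_uniform_measure) (auto simp: emeasure_eq_measure)

lemma integral_conditioned:
  fixes f :: "'w \<Rightarrow> real"
  assumes B: "0 < prob (initial_event s0 l0)" and f [measurable]: "f \<in> borel_measurable P"
  shows "(\<integral>\<omega>. f \<omega> \<partial>conditioned s0 l0)
    = (\<integral>\<omega>. f \<omega> * indicator (initial_event s0 l0) \<omega> \<partial>P) / prob (initial_event s0 l0)"
proof -
  let ?B = "initial_event s0 l0"
  have "conditioned s0 l0 = density P (\<lambda>\<omega>. ennreal (indicator ?B \<omega> / prob ?B))"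
    unfolding conditioned_def uniform_measure_def
    using B by (intro arg_cong[where f="density P"])
      (auto simp: fun_eq_iff indicator_def emeasure_eq_measure divide_ennreal simp flip: ennreal_1)
  then have "(\<integral>\<omega>. f \<omega> \<partial>conditioned s0 l0) = (\<integral>\<omega>. (indicator ?B \<omega> / prob ?B) *\<^sub>R f \<omega> \<partial>P)"
    by (simp add: integral_density)
  then show ?thesis
    by (simp add: mult.commute)
qed

lemma observed_process_conditioned:
  assumes "0 < prob (initial_event s0 l0)"
  shows "observed_process (conditioned s0 l0) X A"
proof -
  interpret Q: prob_space "conditioned s0 l0" by (rule prob_space_conditioned[OF assms])
  show ?thesis by unfold_locales auto
qed

lemma sum_initial_events:
  fixes f :: "'w \<Rightarrow> real"
  assumes "integrable P f"
  shows "(\<integral>\<omega>. f \<omega> \<partial>P) = (\<Sum>p\<in>UNIV. \<integral>\<omega>. f \<omega> * indicator (initial_event (fst p) (snd p)) \<omega> \<partial>P)"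
proof -
  have "(\<integral>\<omega>. f \<omega> \<partial>P) = (\<integral>\<omega>. (\<Sum>p\<in>UNIV. f \<omega> * indicator (initial_event (fst p) (snd p)) \<omega>) \<partial>P)"
  proof (rule Bochner_Integration.integral_cong[OF refl])
    fix \<omega> assume "\<omega> \<in> space P"
    then show "f \<omega> = (\<Sum>p\<in>UNIV. f \<omega> * indicator (initial_event (fst p) (snd p)) \<omega>)"
      by (subst sum.remove[of _ "(X 0 \<omega>, A 0 \<omega>)"])
        (auto simp: initial_event_def indicator_def prod_eq_iff intro!: sum.neutral)
  qed
  also have "\<dots> = (\<Sum>p\<in>UNIV. \<integral>\<omega>. f \<omega> * indicator (initial_event (fst p) (snd p)) \<omega> \<partial>P)"
    using assms by (intro Bochner_Integration.integral_sum integrable_real_mult_indicator) auto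
  finally show ?thesis .
qed

text \<open>The initial event is a history of length 1, so the variance bound applies. Nonnegativity
  of the variance of the absolute deviation passes from the second to the first moment, and the
  bound is arranged to decay with the growth of \<open>v / sqrt n\<close>.\<close>

lemma conditioned_visits_deviation:
  assumes B: "0 < prob (initial_event s0 l0)" and n: "1 \<le> n" and C: "mixing_norm P X A n \<le> C" "0 \<le> C"
    and v: "v = (\<integral>\<omega>. real (visits X A s l n \<omega>) \<partial>conditioned s0 l0)" "0 < v"
  shows "(\<integral>\<omega>. \<bar>real (visits X A s l n \<omega>) / v - 1\<bar> \<partial>conditioned s0 l0) \<le> C / (v / sqrt n)"
proof -
  let ?B = "initial_event s0 l0" and ?h = "[(s0, l0)]"
  let ?N = "\<lambda>\<omega>. real (visits X A s l n \<omega>)"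
  interpret Q: observed_process "conditioned s0 l0" X A
    by (rule observed_process_conditioned[OF B])
  have ev: "history (length ?h) \<omega> = ?h \<longleftrightarrow> X 0 \<omega> = s0 \<and> A 0 \<omega> = l0" for \<omega>
    by (simp add: trajectory_def)
  have hp: "history_prob ?h = prob ?B"
    unfolding history_prob_def ev by (simp add: initial_event_def)
  have moment: "visits_moment r s l n ?h = (\<integral>\<omega>. ?N \<omega> ^ r * indicator ?B \<omega> \<partial>P)" for r
    unfolding visits_moment_def ev
    by (intro Bochner_Integration.integral_cong) (auto simp: initial_event_def indicator_def)
  have Q_moment: "(\<integral>\<omega>. ?N \<omega> ^ r \<partial>conditioned s0 l0) = visits_moment r s l n ?h / prob ?B" for r
    unfolding moment by (rule integral_conditioned[OF B]) measurable
  have v_eq: "v = visits_moment 1 s l n ?h / prob ?B"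
    using Q_moment[of 1] v(1) by simp
  have int: "integrable (conditioned s0 l0) (\<lambda>\<omega>. ?N \<omega> ^ r)" for r
    by (rule Q.integrable_history_determined[OF Q.history_determined_comp[OF Q.history_determined_visits[OF order_refl]]])
  have "(\<integral>\<omega>. (?N \<omega> - v)\<^sup>2 \<partial>conditioned s0 l0)
      = visits_moment 2 s l n ?h / prob ?B - v\<^sup>2"
    using Q.variance_eq[of ?N] int[of 1] int[of 2] Q_moment[of 2] v(1) by simp
  also have "\<dots> = (visits_moment 2 s l n ?h - (visits_moment 1 s l n ?h)\<^sup>2 / prob ?B) / prob ?B"
    using B by (simp add: v_eq diff_divide_distrib power2_eq_square)
  also have "\<dots> \<le> (real (n - 1) * C\<^sup>2 * prob ?B) / prob ?B"
    using conditional_visits_variance[of ?h n C s l] n C B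
    by (intro divide_right_mono) (auto simp: hp)
  also have "\<dots> \<le> real n * C\<^sup>2"
    using B by (simp add: mult_right_mono)
  finally have var: "(\<integral>\<omega>. (?N \<omega> - v)\<^sup>2 \<partial>conditioned s0 l0) \<le> real n * C\<^sup>2" .
  let ?Y = "\<lambda>\<omega>. \<bar>?N \<omega> - v\<bar>"
  have det: "Q.history_determined n (\<lambda>\<omega>. f (?N \<omega>))" for f :: "real \<Rightarrow> real"
    by (rule Q.history_determined_comp[OF Q.history_determined_visits[OF order_refl]])
  have iY: "integrable (conditioned s0 l0) (\<lambda>\<omega>. f (?N \<omega>))" for f :: "real \<Rightarrow> real"
    by (rule Q.integrable_history_determined[OF det])
  have "(\<integral>\<omega>. ?Y \<omega> \<partial>conditioned s0 l0)\<^sup>2 \<le> (\<integral>\<omega>. (?Y \<omega>)\<^sup>2 \<partial>conditioned s0 l0)"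
    using Q.variance_positive[of ?Y] Q.variance_eq[OF iY[of "\<lambda>x. \<bar>x - v\<bar>"] iY[of "\<lambda>x. \<bar>x - v\<bar>\<^sup>2"]]
    by linarith
  also have "\<dots> \<le> (sqrt n * C)\<^sup>2"
    using var by (simp add: power_mult_distrib)
  finally have "(\<integral>\<omega>. ?Y \<omega> \<partial>conditioned s0 l0) \<le> sqrt n * C"
    by (rule power2_le_imp_le) (use C(2) in simp)
  moreover have "(\<integral>\<omega>. \<bar>?N \<omega> / v - 1\<bar> \<partial>conditioned s0 l0) = (\<integral>\<omega>. ?Y \<omega> \<partial>conditioned s0 l0) / v"
  proof -
    have "\<bar>?N \<omega> / v - 1\<bar> = ?Y \<omega> / v" for \<omega>
    proof -
      have "?N \<omega> / v - 1 = (?N \<omega> - v) / v"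
        using v(2) by (simp add: diff_divide_distrib)
      then show ?thesis using v(2) by (simp only: abs_divide abs_of_pos)
    qed
    then show ?thesis by (simp only: integral_divide_zero)
  qed
  ultimately show ?thesis
    using v(2) by (simp only:) (simp add: divide_right_mono mult.commute)
qed

lemma conditioned_visits_lln:
  assumes B: "0 < prob (initial_event s0 l0)" and ret: "return_time_condition P X A"
    and C: "\<And>n. 1 \<le> n \<Longrightarrow> mixing_norm P X A n \<le> C" "0 \<le> C"
  defines "v \<equiv> \<lambda>n p. \<integral>\<omega>. real (visits X A (fst p) (snd p) n \<omega>) \<partial>conditioned s0 l0"
  shows "filterlim (\<lambda>n. v n p) at_top sequentially"
    and "(\<lambda>n. \<integral>\<omega>. \<bar>real (visits X A (fst p) (snd p) n \<omega>) / v n p - 1\<bar> \<partial>conditioned s0 l0) \<longlonglongrightarrow> 0"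
proof -
  have v: "v n p = (\<integral>\<omega>. real (visits X A (fst p) (snd p) n \<omega>) * indicator (initial_event s0 l0) \<omega> \<partial>P)
      / prob (initial_event s0 l0)" for n p
    unfolding v_def by (rule integral_conditioned[OF B]) measurable
  have growth: "filterlim (\<lambda>n. v n p / sqrt n) at_top sequentially"
    unfolding v by (rule initial_visits_growth[OF ret B])
  have "filterlim (\<lambda>n. v n p / sqrt n * sqrt n) at_top sequentially"
    by (rule filterlim_at_top_mult_at_top[OF growth]) real_asymp
  moreover have "\<forall>\<^sub>F n in sequentially. v n p / sqrt n * sqrt n \<le> v n p"
    using eventually_gt_at_top[of 0] by eventually_elim simp
  ultimately show v_top: "filterlim (\<lambda>n. v n p) at_top sequentially"
    by (rule filterlim_at_top_mono)
  have lim: "(\<lambda>n. C / (v n p / sqrt n)) \<longlonglongrightarrow> 0"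
    by (rule tendsto_divide_0[OF tendsto_const filterlim_at_top_imp_at_infinity[OF growth]])
  have "\<forall>\<^sub>F n in sequentially. 0 < v n p"
    using v_top by (auto simp: filterlim_at_top_dense)
  then have "\<forall>\<^sub>F n in sequentially.
      norm (\<integral>\<omega>. \<bar>real (visits X A (fst p) (snd p) n \<omega>) / v n p - 1\<bar> \<partial>conditioned s0 l0) \<le> C / (v n p / sqrt n)"
    using eventually_ge_at_top[of 1]
  proof eventually_elim
    case (elim n)
    then show ?case
      using conditioned_visits_deviation[OF B elim(2) C(1)[OF elim(2)] C(2), of "v n p" "fst p" "snd p"]
      by (simp add: v_def)
  qed
  then show "(\<lambda>n. \<integral>\<omega>. \<bar>real (visits X A (fst p) (snd p) n \<omega>) / v n p - 1\<bar> \<partial>conditioned s0 l0) \<longlonglongrightarrow> 0"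
    using lim by (rule Lim_null_comparison)
qed

end

text \<open>Conditioning on the initial pair either excludes a history or divides its probability by
  a fixed constant, so the product identity survives. Return times and mixing are not transferred:
  the visits under the conditioned measure are controlled from \<open>P\<close>.\<close>

lemma (in kernel_process) kernel_process_conditioned:
  assumes B: "0 < prob (initial_event s0 l0)"
  shows "kernel_process (conditioned s0 l0) X A M"
proof -
  interpret Q: observed_process "conditioned s0 l0" X A
    by (rule observed_process_conditioned[OF B])
  show ?thesis
  proof unfold_locales
    show "transition_kernel M" by (rule kernel)
    fix m and h :: "('s \<times> 'a) list" and t
    assume len: "length h = Suc m"
    have Q: "measure (conditioned s0 l0) {\<omega> \<in> space (conditioned s0 l0). history (Suc m) \<omega> = h \<and> R \<omega>}
        = (if hd h = (s0, l0) then prob {\<omega> \<in> space P. history (Suc m) \<omega> = h \<and> R \<omega>} / prob (initial_event s0 l0) else 0)"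
      if "Measurable.pred P R" for R
    proof -
      have meas: "{\<omega> \<in> space P. history (Suc m) \<omega> = h \<and> R \<omega>} \<in> sets P"
        using that by measurable
      have "X 0 \<omega> = fst (hd h) \<and> A 0 \<omega> = snd (hd h)" if "history (Suc m) \<omega> = h" for \<omega>
        unfolding that[symmetric] by (simp add: trajectory_def upt_conv_Cons del: upt_Suc)
      then have "initial_event s0 l0 \<inter> {\<omega> \<in> space P. history (Suc m) \<omega> = h \<and> R \<omega>}
          = (if hd h = (s0, l0) then {\<omega> \<in> space P. history (Suc m) \<omega> = h \<and> R \<omega>} else {})"
        unfolding initial_event_def by (cases "hd h = (s0, l0)") (auto simp: prod_eq_iff)
      then show ?thesis
        using B meas unfolding conditioned_def
        by (subst measure_uniform_measure) (auto simp: emeasure_eq_measure)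
    qed
    show "measure (conditioned s0 l0) {\<omega> \<in> space (conditioned s0 l0). history (Suc m) \<omega> = h \<and> X (Suc m) \<omega> = t}
        = measure (conditioned s0 l0) {\<omega> \<in> space (conditioned s0 l0). history (Suc m) \<omega> = h} * M (fst (last h)) (snd (last h)) t"
      using Q[of "\<lambda>\<omega>. X (Suc m) \<omega> = t"] Q[of "\<lambda>_. True"] history_transition[OF len, of t] by simp
  qed
qed

section \<open>Chi-square limits\<close>

text \<open>The reflection exchanging the unit vector \<open>m\<close> with the \<open>t0\<close>-th unit vector. If the two
  coincide then the denominator is \<open>0\<close>, and the convention \<open>x / 0 = 0\<close> gives the identity.\<close>

definition reflection :: "('s::finite \<Rightarrow> real) \<Rightarrow> 's \<Rightarrow> ('s \<Rightarrow> real) \<Rightarrow> 's \<Rightarrow> real" where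
  "reflection m t0 x t = x t - (\<Sum>u\<in>UNIV. (m u - of_bool (u = t0)) * x u) / (1 - m t0) * (m t - of_bool (t = t0))"

context
  fixes m :: "'s::finite \<Rightarrow> real" and t0 :: 's
  assumes unit: "(\<Sum>t\<in>UNIV. (m t)\<^sup>2) = 1"
begin

private abbreviation "r t \<equiv> m t - of_bool (t = t0)"

private lemma r_dot: "(\<Sum>t\<in>UNIV. r t * x t) = (\<Sum>t\<in>UNIV. m t * x t) - x t0"
proof -
  have "(\<Sum>t\<in>UNIV. of_bool (t = t0) * x t) = x t0"
    by (subst sum.remove[of _ t0]) (auto intro!: sum.neutral)
  then show ?thesis by (simp add: left_diff_distrib sum_subtractf)
qed

private lemma r_m: "(\<Sum>t\<in>UNIV. r t * m t) = 1 - m t0"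
  using r_dot[of m] unit by (simp add: power2_eq_square)

text \<open>The squared length of the reflecting vector is \<open>2 * (1 - m t0)\<close>, so the
  usual factor 2 over the squared length becomes the factor \<open>1 / (1 - m t0)\<close> in
  \<open>reflection\<close>.\<close>

private lemma r_r: "(\<Sum>t\<in>UNIV. r t * r t) = 2 * (1 - m t0)"
  using r_dot[of r] r_m by (simp add: mult.commute)

private lemma r_zero: "m t0 = 1 \<Longrightarrow> r t = 0"
  using r_r sum_nonneg_eq_0_iff[of UNIV "\<lambda>t. r t * r t"] by simp

lemma reflection_norm: "(\<Sum>t\<in>UNIV. (reflection m t0 x t)\<^sup>2) = (\<Sum>t\<in>UNIV. (x t)\<^sup>2)"
proof (cases "m t0 = 1")
  case False
  define k where "k = (\<Sum>u\<in>UNIV. r u * x u) / (1 - m t0)"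
  have "(\<Sum>t\<in>UNIV. (reflection m t0 x t)\<^sup>2) = (\<Sum>t\<in>UNIV. (x t)\<^sup>2 - 2 * k * (r t * x t) + k\<^sup>2 * (r t * r t))"
    unfolding reflection_def k_def[symmetric] by (intro sum.cong) (auto simp: power2_eq_square algebra_simps)
  also have "\<dots> = (\<Sum>t\<in>UNIV. (x t)\<^sup>2) - 2 * k * (\<Sum>t\<in>UNIV. r t * x t) + k\<^sup>2 * (\<Sum>t\<in>UNIV. r t * r t)"
    by (simp only: sum.distrib sum_subtractf sum_distrib_left)
  also have "(\<Sum>t\<in>UNIV. r t * x t) = k * (1 - m t0)"
    using False by (simp add: k_def)
  finally show ?thesis
    by (simp only: r_r) (simp add: power2_eq_square algebra_simps)
qed (simp add: reflection_def)

private lemma sum_mult_reflection: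
  "(\<Sum>t\<in>UNIV. u t * reflection m t0 x t)
    = (\<Sum>t\<in>UNIV. u t * x t) - (\<Sum>t\<in>UNIV. r t * x t) / (1 - m t0) * (\<Sum>t\<in>UNIV. r t * u t)"
proof -
  define k where "k = (\<Sum>t\<in>UNIV. r t * x t) / (1 - m t0)"
  have "(\<Sum>t\<in>UNIV. u t * reflection m t0 x t) = (\<Sum>t\<in>UNIV. u t * x t - k * (r t * u t))"
    unfolding reflection_def k_def[symmetric] by (intro sum.cong refl) (simp add: algebra_simps)
  then show ?thesis
    by (simp only: sum_subtractf sum_distrib_left k_def)
qed

lemma reflection_symmetric:
  "(\<Sum>t\<in>UNIV. u t * reflection m t0 x t) = (\<Sum>t\<in>UNIV. reflection m t0 u t * x t)"
  using sum_mult_reflection[of u x] sum_mult_reflection[of x u] by (simp add: mult.commute)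

text \<open>The reflection is symmetric and takes \<open>m\<close> to the \<open>t0\<close>-th unit
  vector, so inner products with \<open>m\<close> become \<open>t0\<close>-th coordinates.\<close>

lemma reflection_dot: "(\<Sum>t\<in>UNIV. m t * reflection m t0 u t) = u t0"
proof (cases "m t0 = 1")
  case True
  then have "m = (\<lambda>t. of_bool (t = t0))"
    using r_zero by (auto simp: fun_eq_iff)
  then have "(\<Sum>t\<in>UNIV. m t * u t) = u t0"
    using r_dot[of u] by simp
  then show ?thesis using True by (simp add: reflection_def)
next
  case False
  then show ?thesis
    using r_dot[of u] by (simp only: sum_mult_reflection r_m) simp
qed

end

lemma reflection_outside: "m t = 0 \<Longrightarrow> t \<noteq> t0 \<Longrightarrow> reflection m t0 x t = x t"
  by (simp add: reflection_def)

section \<open>Standardised residuals after the reflection\<close>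

context kernel_process
begin

text \<open>The coordinate that absorbs the linear constraint on the residuals. It is taken in the
  support, so that dropping it costs one degree of freedom.\<close>

definition base_point :: "'s \<times> 'a \<Rightarrow> 's" where
  "base_point p = (SOME t. 0 < M (fst p) (snd p) t)"

lemma base_point: "0 < M (fst p) (snd p) (base_point p)"
  unfolding base_point_def
proof (rule someI_ex, rule ccontr)
  assume "\<nexists>t. 0 < M (fst p) (snd p) t"
  then have "M (fst p) (snd p) t = 0" for t
    using M_nonneg[of "fst p" "snd p" t] by (simp add: less_le)
  then show False using M_sum[of "fst p" "snd p"] by simp
qed

definition free_coords :: "'s \<times> 'a \<Rightarrow> 's set" where
  "free_coords p = {t. 0 < M (fst p) (snd p) t} - {base_point p}"

lemma card_free_coords: "card (free_coords p) = support_size M (fst p) (snd p) - 1"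
  using base_point[of p] by (simp add: free_coords_def support_size_def)

lemma support_size_pos: "1 \<le> support_size M s l"
  using base_point[of "(s, l)"] unfolding support_size_def
  by (simp add: card_gt_0_iff Suc_le_eq) blast

definition root :: "'s \<times> 'a \<Rightarrow> 's \<Rightarrow> real" where
  "root p t = sqrt (M (fst p) (snd p) t)"

lemma root_unit: "(\<Sum>t\<in>UNIV. (root p t)\<^sup>2) = 1"
  by (simp add: root_def M_nonneg M_sum)

text \<open>The coefficients of the centred counts in a linear functional of the rotated residuals:
  symmetry moves the reflection over to \<open>u\<close>, and the standardisation is absorbed. Where
  \<open>root\<close> vanishes the coefficient is 0.\<close>

definition rotated_coeff :: "(('s \<times> 'a) \<times> 's \<Rightarrow> real) \<Rightarrow> 's \<Rightarrow> 'a \<Rightarrow> 's \<Rightarrow> real" where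
  "rotated_coeff u s l t = reflection (root (s, l)) (base_point (s, l)) (\<lambda>t. u ((s, l), t)) t / root (s, l) t"

text \<open>The reflection is an isometry and leaves coordinates outside the support alone, so the
  second moment is the sum of the squares of \<open>u\<close> over the support. The mean is the
  value of \<open>u\<close> at the base point, and subtracting its square leaves the free
  coordinates: the quadratic form of independent standard normal variables.\<close>

lemma weighted_variance_rotated:
  "weighted_variance (rotated_coeff u) p = (\<Sum>t\<in>free_coords p. (u (p, t))\<^sup>2)"
proof -
  let ?M = "M (fst p) (snd p)" and ?h = "reflection (root p) (base_point p) (\<lambda>t. u (p, t))"
  have sq: "?M t = root p t * root p t" for t
    by (simp add: root_def M_nonneg)
  have c: "rotated_coeff u (fst p) (snd p) t = ?h t / root p t" for t
    by (simp add: rotated_coeff_def)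
  have "weighted_mean (rotated_coeff u) p = (\<Sum>t\<in>UNIV. root p t * ?h t)"
    unfolding weighted_mean_def c sq by (intro sum.cong) auto
  then have mean: "weighted_mean (rotated_coeff u) p = u (p, base_point p)"
    using reflection_dot[OF root_unit, of p] by simp
  have pos: "0 < ?M t \<longleftrightarrow> root p t \<noteq> 0" for t
    using M_nonneg[of "fst p" "snd p" t] by (auto simp: root_def)
  have bp: "root p (base_point p) \<noteq> 0"
    using base_point[of p] pos by blast
  have "(\<Sum>t\<in>UNIV. ?M t * (rotated_coeff u (fst p) (snd p) t)\<^sup>2) = (\<Sum>t\<in>{t. root p t \<noteq> 0}. (?h t)\<^sup>2)"
    unfolding c sq by (rule sum.mono_neutral_cong_right) (auto simp: power2_eq_square)
  also have "\<dots> = (\<Sum>t\<in>UNIV. (?h t)\<^sup>2) - (\<Sum>t\<in>{t. root p t = 0}. (?h t)\<^sup>2)"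
    using sum.union_disjoint[of "{t. root p t \<noteq> 0}" "{t. root p t = 0}" "\<lambda>t. (?h t)\<^sup>2"]
    by (simp add: Un_def) (simp add: disjoint_iff Un_def)
  also have "(\<Sum>t\<in>UNIV. (?h t)\<^sup>2) = (\<Sum>t\<in>UNIV. (u (p, t))\<^sup>2)"
    by (rule reflection_norm[OF root_unit])
  also have "(\<Sum>t\<in>{t. root p t = 0}. (?h t)\<^sup>2) = (\<Sum>t\<in>{t. root p t = 0}. (u (p, t))\<^sup>2)"
    using bp by (intro sum.cong refl arg_cong[where f="\<lambda>y. y\<^sup>2"] reflection_outside) auto
  also have "(\<Sum>t\<in>UNIV. (u (p, t))\<^sup>2) - \<dots> = (\<Sum>t\<in>{t. root p t \<noteq> 0}. (u (p, t))\<^sup>2)"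
    using sum.union_disjoint[of "{t. root p t \<noteq> 0}" "{t. root p t = 0}" "\<lambda>t. (u (p, t))\<^sup>2"]
    by (simp add: Un_def) (simp add: disjoint_iff Un_def)
  also have "{t. root p t \<noteq> 0} = insert (base_point p) (free_coords p)"
    using base_point[of p] by (auto simp: free_coords_def pos[symmetric])
  also have "(\<Sum>t\<in>insert (base_point p) (free_coords p). (u (p, t))\<^sup>2)
      = (u (p, base_point p))\<^sup>2 + (\<Sum>t\<in>free_coords p. (u (p, t))\<^sup>2)"
    by (subst sum.insert) (auto simp: free_coords_def)
  finally show ?thesis
    by (simp add: weighted_variance_eq mean)
qed

text \<open>Normalising by the deterministic \<open>v p\<close> rather than by the visits keeps
  linear functionals within reach of the characteristic function argument.\<close>

definition residual :: "('s \<times> 'a \<Rightarrow> real) \<Rightarrow> nat \<Rightarrow> 'w \<Rightarrow> 's \<times> 'a \<Rightarrow> 's \<Rightarrow> real" where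
  "residual v n \<omega> p t =
    (transitions X A (fst p) (snd p) t n \<omega> - visits X A (fst p) (snd p) n \<omega> * M (fst p) (snd p) t) / sqrt (v p) / root p t"

definition rotated :: "('s \<times> 'a \<Rightarrow> real) \<Rightarrow> nat \<Rightarrow> 'w \<Rightarrow> real ^ (('s \<times> 'a) \<times> 's)" where
  "rotated v n \<omega> = (\<chi> q. reflection (root (fst q)) (base_point (fst q)) (residual v n \<omega> (fst q)) (snd q))"

definition visit_ratio :: "('s \<times> 'a \<Rightarrow> real) \<Rightarrow> nat \<Rightarrow> 'w \<Rightarrow> real ^ ('s \<times> 'a)" where
  "visit_ratio v n \<omega> = (\<chi> p. visits X A (fst p) (snd p) n \<omega> / v p)"

lemma sum_pairs: "(\<Sum>q\<in>UNIV. f q) = (\<Sum>p\<in>UNIV. \<Sum>t\<in>UNIV. f (p, t))"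
  for f :: "('b::finite \<times> 'c::finite) \<Rightarrow> real"
  by (simp add: sum.cartesian_product split_def)

lemma inner_rotated:
  "u \<bullet> rotated v n \<omega> = (\<Sum>p\<in>UNIV. \<Sum>t\<in>UNIV. rotated_coeff (\<lambda>q. u $ q) (fst p) (snd p) t *
    ((transitions X A (fst p) (snd p) t n \<omega> - visits X A (fst p) (snd p) n \<omega> * M (fst p) (snd p) t) / sqrt (v p)))"
proof -
  have "u \<bullet> rotated v n \<omega> = (\<Sum>p\<in>UNIV. \<Sum>t\<in>UNIV. u $ (p, t) * reflection (root p) (base_point p) (residual v n \<omega> p) t)"
    by (simp add: inner_vec_def sum_pairs rotated_def)
  also have "\<dots> = (\<Sum>p\<in>UNIV. \<Sum>t\<in>UNIV. reflection (root p) (base_point p) (\<lambda>t. u $ (p, t)) t * residual v n \<omega> p t)"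
    by (simp only: reflection_symmetric[OF root_unit])
  finally show ?thesis
    by (simp add: rotated_coeff_def residual_def mult.commute)
qed

text \<open>The reflection preserves the sum of squares, so only the normalisation has to be changed
  from \<open>v p\<close> back to the visits. Vanishing visits or kernel entries agree with the
  convention for division by 0.\<close>

lemma statistic_eq:
  assumes "0 < v p"
  shows "chi_square_statistic X A M (fst p) (snd p) n \<omega>
    = (\<Sum>t\<in>UNIV. (rotated v n \<omega> $ (p, t))\<^sup>2) / visit_ratio v n \<omega> $ p"
proof -
  let ?T = "\<lambda>t. real (transitions X A (fst p) (snd p) t n \<omega>)" and ?N = "real (visits X A (fst p) (snd p) n \<omega>)"
  let ?M = "M (fst p) (snd p)"
  have "(\<Sum>t\<in>UNIV. (rotated v n \<omega> $ (p, t))\<^sup>2) = (\<Sum>t\<in>UNIV. (residual v n \<omega> p t)\<^sup>2)"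
    by (simp add: rotated_def reflection_norm[OF root_unit])
  also have "\<dots> / (visit_ratio v n \<omega> $ p) = (\<Sum>t\<in>UNIV. (?T t - ?N * ?M t)\<^sup>2 / (?N * ?M t))"
    unfolding sum_divide_distrib
    using assms M_nonneg[of "fst p" "snd p"]
    by (intro sum.cong refl) (simp add: residual_def visit_ratio_def root_def power_divide power_mult_distrib)
  finally show ?thesis
    by (simp add: chi_square_statistic_def)
qed

end

section \<open>Gaussian vectors and chi-square laws\<close>

lemma borel_measurable_vec_lambda:
  fixes f :: "'w \<Rightarrow> 'i::finite \<Rightarrow> real"
  assumes "\<And>i. (\<lambda>x. f x i) \<in> borel_measurable M"
  shows "(\<lambda>x. \<chi> i. f x i) \<in> borel_measurable M"
proof (subst borel_measurable_euclidean_space, rule ballI)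
  fix b :: "real ^ 'i" assume "b \<in> Basis"
  then obtain i where "b = axis i 1" by (auto simp: Basis_vec_def)
  then show "(\<lambda>x. (\<chi> i. f x i) \<bullet> b) \<in> borel_measurable M"
    using assms by (simp add: inner_axis)
qed

lemma cis_sum: "finite I \<Longrightarrow> cis (\<Sum>i\<in>I. f i) = (\<Prod>i\<in>I. cis (f i))"
  by (induction I rule: finite_induct) (simp_all add: cis_mult[symmetric])

abbreviation gauss :: "'i set \<Rightarrow> ('i \<Rightarrow> real) measure" where
  "gauss I \<equiv> (\<Pi>\<^sub>M i\<in>I. std_normal_distribution)"

lemma prob_space_std_normal: "prob_space std_normal_distribution"
  using real_dist_normal_dist by (simp add: real_distribution_def)

lemma product_prob_space_gauss: "product_prob_space (\<lambda>_. std_normal_distribution)"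
  by (rule product_prob_spaceI) (rule prob_space_std_normal)

lemma prob_space_gauss: "prob_space (gauss I)"
  by (rule prob_space_PiM) (rule prob_space_std_normal)

lemma measurable_gauss_component [measurable]: "i \<in> I \<Longrightarrow> (\<lambda>\<xi>. \<xi> i) \<in> borel_measurable (gauss I)"
  using measurable_component_singleton[of i I "\<lambda>_. std_normal_distribution"]
  by (simp add: measurable_cong_sets[of _ _ std_normal_distribution borel])

lemma integral_gauss_prod:
  fixes f :: "'i \<Rightarrow> real \<Rightarrow> complex"
  assumes "finite I" "\<And>i. i \<in> I \<Longrightarrow> f i \<in> borel_measurable borel" "\<And>i x. i \<in> I \<Longrightarrow> norm (f i x) \<le> 1"
  shows "(\<integral>\<xi>. (\<Prod>i\<in>I. f i (\<xi> i)) \<partial>gauss I) = (\<Prod>i\<in>I. \<integral>x. f i x \<partial>std_normal_distribution)"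
proof -
  interpret N: product_prob_space "\<lambda>_. std_normal_distribution"
    by (rule product_prob_space_gauss)
  show ?thesis
    using assms by (intro N.product_integral_prod
        finite_measure.integrable_const_bound[OF prob_space.finite_measure[OF prob_space_std_normal], where B=1]) auto
qed

lemma char_sum_squares:
  assumes "finite I" "J \<subseteq> I"
  shows "char (distr (gauss I) borel (\<lambda>\<xi>. \<Sum>i\<in>J. (\<xi> i)\<^sup>2)) u
    = (\<integral>x. cis (u * x\<^sup>2) \<partial>std_normal_distribution) ^ card J"
proof -
  interpret S: prob_space std_normal_distribution by (rule prob_space_std_normal)
  have cis_m: "cis \<in> borel_measurable borel"
    by (intro borel_measurable_continuous_onI continuous_intros)
  have fin: "finite J" using assms finite_subset by blast
  have meas: "(\<lambda>\<xi>. \<Sum>i\<in>J. (\<xi> i)\<^sup>2) \<in> borel_measurable (gauss I)"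
    using assms by (intro borel_measurable_sum borel_measurable_power measurable_gauss_component) auto
  have "char (distr (gauss I) borel (\<lambda>\<xi>. \<Sum>i\<in>J. (\<xi> i)\<^sup>2)) u
      = (\<integral>\<xi>. cis (u * (\<Sum>i\<in>J. (\<xi> i)\<^sup>2)) \<partial>gauss I)"
    unfolding char_def cis_conv_exp[symmetric]
    by (rule integral_distr[OF meas]) (intro borel_measurable_continuous_onI continuous_intros)
  also have "\<dots> = (\<integral>\<xi>. (\<Prod>i\<in>I. if i \<in> J then cis (u * (\<xi> i)\<^sup>2) else 1) \<partial>gauss I)"
  proof (intro Bochner_Integration.integral_cong refl)
    fix \<xi> :: "'a \<Rightarrow> real"
    show "cis (u * (\<Sum>i\<in>J. (\<xi> i)\<^sup>2)) = (\<Prod>i\<in>I. if i \<in> J then cis (u * (\<xi> i)\<^sup>2) else 1)"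
      using assms fin by (simp add: sum_distrib_left cis_sum prod.If_cases Int_absorb1)
  qed
  also have "\<dots> = (\<Prod>i\<in>I. \<integral>x. (if i \<in> J then cis (u * x\<^sup>2) else 1) \<partial>std_normal_distribution)"
  proof (rule integral_gauss_prod[OF assms(1), of "\<lambda>i x. if i \<in> J then cis (u * x\<^sup>2) else 1"])
    show "(\<lambda>x. if i \<in> J then cis (u * x\<^sup>2) else 1) \<in> borel_measurable borel" for i
      by (cases "i \<in> J") (simp_all, intro borel_measurable_continuous_onI continuous_intros)
  qed simp
  also have "\<dots> = (\<Prod>i\<in>I. if i \<in> J then \<integral>x. cis (u * x\<^sup>2) \<partial>std_normal_distribution else 1)"
    using S.prob_space by (intro prod.cong) auto
  also have "\<dots> = (\<integral>x. cis (u * x\<^sup>2) \<partial>std_normal_distribution) ^ card J"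
    using assms by (simp add: prod.If_cases Int_absorb1)
  finally show ?thesis .
qed

text \<open>The characteristic function depends on \<open>J\<close> only through its cardinality, so
  the coordinates may be renumbered by \<open>{..<card J}\<close>.\<close>

lemma distr_sum_squares:
  assumes "finite I" "J \<subseteq> I"
  shows "distr (gauss I) borel (\<lambda>\<xi>. \<Sum>i\<in>J. (\<xi> i)\<^sup>2) = chi_square_distribution (card J)"
proof -
  have rd: "real_distribution (distr (gauss I) borel (\<lambda>\<xi>. \<Sum>i\<in>J. (\<xi> i)\<^sup>2))" if "J \<subseteq> I" for I J :: "'i set"
    using that by (intro prob_space.real_distribution_distr[OF prob_space_gauss]
        borel_measurable_sum borel_measurable_power measurable_gauss_component) auto
  show ?thesis
    unfolding chi_square_distribution_def
    using char_sum_squares[OF assms] char_sum_squares[of "{..<card J}" "{..<card J}"] assms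
    by (intro Levy_uniqueness rd) (auto simp: fun_eq_iff)
qed

section \<open>Convergence under a law of large numbers for the visits\<close>

context kernel_process
begin

abbreviation noise :: "(('s \<times> 'a) \<times> 's \<Rightarrow> real) measure" where
  "noise \<equiv> gauss UNIV"

definition limit_statistics :: "(('s \<times> 'a) \<times> 's \<Rightarrow> real) \<Rightarrow> real ^ ('s \<times> 'a)" where
  "limit_statistics \<xi> = (\<chi> p. \<Sum>t\<in>free_coords p. (\<xi> (p, t))\<^sup>2)"

text \<open>The Gaussian limit of \<open>rotated\<close>: base points and states outside the support
  carry variance 0.\<close>

definition masked :: "(('s \<times> 'a) \<times> 's \<Rightarrow> real) \<Rightarrow> real ^ (('s \<times> 'a) \<times> 's)" where
  "masked \<xi> = (\<chi> q. if snd q \<in> free_coords (fst q) then \<xi> q else 0)"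

definition statistics :: "nat \<Rightarrow> 'w \<Rightarrow> real ^ ('s \<times> 'a)" where
  "statistics n \<omega> = (\<chi> p. chi_square_statistic X A M (fst p) (snd p) n \<omega>)"

lemma measurable_limit_statistics [measurable]: "limit_statistics \<in> borel_measurable noise"
  unfolding limit_statistics_def
  by (intro borel_measurable_vec_lambda borel_measurable_sum borel_measurable_power measurable_gauss_component UNIV_I)

lemma measurable_masked [measurable]: "masked \<in> borel_measurable noise"
  unfolding masked_def
proof (rule borel_measurable_vec_lambda)
  show "(\<lambda>\<xi>. if snd q \<in> free_coords (fst q) then \<xi> q else 0) \<in> borel_measurable noise" for q
    by (cases "snd q \<in> free_coords (fst q)") (simp_all add: measurable_gauss_component)
qed

lemma history_determined_statistics: "history_determined (Suc n) (statistics n)"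
  and history_determined_rotated: "history_determined (Suc n) (rotated v n)"
  and history_determined_visit_ratio: "history_determined (Suc n) (visit_ratio v n)"
proof -
  have T: "transitions X A s l t n \<omega> = transitions X A s l t n \<omega>'"
    and N: "visits X A s l n \<omega> = visits X A s l n \<omega>'"
    if "history (Suc n) \<omega> = history (Suc n) \<omega>'" for s l t \<omega> \<omega>'
    using history_determinedD[OF history_determined_transitions[OF lessI] that]
      history_determinedD[OF history_determined_visits[OF le_SucI[OF order_refl]] that] by blast+
  show "history_determined (Suc n) (statistics n)"
    unfolding history_determined_def
  proof (intro allI impI)
    fix \<omega> \<omega>' assume "history (Suc n) \<omega> = history (Suc n) \<omega>'"
    then show "statistics n \<omega> = statistics n \<omega>'"
      by (simp only: statistics_def chi_square_statistic_def T[of \<omega> \<omega>'] N[of \<omega> \<omega>'])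
  qed
  show "history_determined (Suc n) (rotated v n)"
    unfolding history_determined_def
  proof (intro allI impI)
    fix \<omega> \<omega>' assume "history (Suc n) \<omega> = history (Suc n) \<omega>'"
    then have "residual v n \<omega> = residual v n \<omega>'"
      by (intro ext) (simp only: residual_def T[of \<omega> \<omega>'] N[of \<omega> \<omega>'])
    then show "rotated v n \<omega> = rotated v n \<omega>'"
      by (simp only: rotated_def)
  qed
  show "history_determined (Suc n) (visit_ratio v n)"
    unfolding history_determined_def
  proof (intro allI impI)
    fix \<omega> \<omega>' assume "history (Suc n) \<omega> = history (Suc n) \<omega>'"
    then show "visit_ratio v n \<omega> = visit_ratio v n \<omega>'"
      by (simp only: visit_ratio_def N[of \<omega> \<omega>'])
  qed
qed

lemma history_determined_pair: "history_determined (Suc n) (\<lambda>\<omega>. (rotated v n \<omega>, visit_ratio v n \<omega>))"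
  unfolding history_determined_def
proof (intro allI impI)
  fix \<omega> \<omega>' assume eq: "history (Suc n) \<omega> = history (Suc n) \<omega>'"
  show "(rotated v n \<omega>, visit_ratio v n \<omega>) = (rotated v n \<omega>', visit_ratio v n \<omega>')"
    using history_determinedD[OF history_determined_rotated eq] history_determinedD[OF history_determined_visit_ratio eq]
    by (rule arg_cong2[where f=Pair])
qed

lemma masked_chf:
  "(\<integral>\<xi>. cis (u \<bullet> masked \<xi>) \<partial>noise) = (\<Prod>p\<in>UNIV. complex_of_real (exp (- ((\<Sum>t\<in>free_coords p. (u $ (p, t))\<^sup>2) / 2))))"
proof -
  let ?c = "\<lambda>q. if snd q \<in> free_coords (fst q) then u $ q else 0"
  have "(\<integral>\<xi>. cis (u \<bullet> masked \<xi>) \<partial>noise) = (\<integral>\<xi>. (\<Prod>q\<in>UNIV. cis (?c q * \<xi> q)) \<partial>noise)"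
  proof (intro Bochner_Integration.integral_cong refl)
    fix \<xi> :: "('s \<times> 'a) \<times> 's \<Rightarrow> real"
    have "u \<bullet> masked \<xi> = (\<Sum>q\<in>UNIV. ?c q * \<xi> q)"
      unfolding inner_vec_def masked_def by (intro sum.cong) auto
    then show "cis (u \<bullet> masked \<xi>) = (\<Prod>q\<in>UNIV. cis (?c q * \<xi> q))"
      by (simp only: cis_sum[OF finite])
  qed
  also have "\<dots> = (\<Prod>q\<in>UNIV. \<integral>x. cis (?c q * x) \<partial>std_normal_distribution)"
  proof (rule integral_gauss_prod[of UNIV "\<lambda>q x. cis (?c q * x)"])
    show "(\<lambda>x. cis (?c q * x)) \<in> borel_measurable borel" for q
      by (intro borel_measurable_continuous_onI continuous_intros)
  qed simp_all
  also have "\<dots> = (\<Prod>q\<in>UNIV. complex_of_real (exp (- ((?c q)\<^sup>2) / 2)))"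
  proof (rule prod.cong[OF refl])
    fix q
    show "(\<integral>x. cis (?c q * x) \<partial>std_normal_distribution) = complex_of_real (exp (- ((?c q)\<^sup>2) / 2))"
      using fun_cong[OF char_std_normal_distribution, of "?c q"] by (simp only: char_def cis_conv_exp)
  qed
  also have "\<dots> = complex_of_real (exp (\<Sum>q\<in>UNIV. - ((?c q)\<^sup>2) / 2))"
    by (simp only: exp_sum[OF finite] of_real_prod)
  also have "(\<Sum>q\<in>UNIV. - ((?c q)\<^sup>2) / 2) = (\<Sum>p\<in>UNIV. \<Sum>t\<in>UNIV. - ((?c (p, t))\<^sup>2) / 2)"
    by (rule sum_pairs)
  also have "\<dots> = (\<Sum>p\<in>UNIV. - ((\<Sum>t\<in>free_coords p. (u $ (p, t))\<^sup>2) / 2))"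
  proof (rule sum.cong[OF refl])
    fix p
    have "(\<Sum>t\<in>UNIV. - ((?c (p, t))\<^sup>2) / 2) = (\<Sum>t\<in>free_coords p. - ((u $ (p, t))\<^sup>2) / 2)"
      by (rule sum.mono_neutral_cong_right) auto
    then show "(\<Sum>t\<in>UNIV. - ((?c (p, t))\<^sup>2) / 2) = - ((\<Sum>t\<in>free_coords p. (u $ (p, t))\<^sup>2) / 2)"
      by (simp add: sum_negf sum_divide_distrib)
  qed
  finally show ?thesis
    by (simp only: exp_sum[OF finite] of_real_prod)
qed

lemma statistics_tendsto:
  assumes v: "\<And>p. filterlim (\<lambda>n. v n p) at_top sequentially"
    and lln: "\<And>p. (\<lambda>n. \<integral>\<omega>. \<bar>visits X A (fst p) (snd p) n \<omega> / v n p - 1\<bar> \<partial>P) \<longlonglongrightarrow> 0"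
    and f: "continuous_on UNIV f" "\<And>x. \<bar>f x\<bar> \<le> B"
  shows "(\<lambda>n. \<integral>\<omega>. f (statistics n \<omega>) \<partial>P) \<longlonglongrightarrow> (\<integral>\<xi>. f (limit_statistics \<xi>) \<partial>noise :: real)"
proof -
  interpret G: prob_space noise by (rule prob_space_gauss)
  let ?V = "\<lambda>n \<omega>. (rotated (v n) n \<omega>, visit_ratio (v n) n \<omega>)"
  let ?L = "\<lambda>\<xi>. (masked \<xi>, \<chi> p. 1) :: (real ^ (('s \<times> 'a) \<times> 's)) \<times> (real ^ ('s \<times> 'a))"
  \<comment> \<open>The floor \<open>1 / 2\<close> makes the quotient continuous. It is inactive at
    the limit, where all ratios are 1, and matters before the limit only if some ratio falls below
    \<open>1 / 2\<close>.\<close>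
  define F where "F z = f (\<chi> p. (\<Sum>t\<in>UNIV. (fst z $ (p, t))\<^sup>2) / max (snd z $ p) (1 / 2))"
    for z :: "(real ^ (('s \<times> 'a) \<times> 's)) \<times> (real ^ ('s \<times> 'a))"
  have max_nonzero: "max x (1 / 2) \<noteq> 0" for x :: real
    by (simp add: max_def)
  have F_cont: "continuous_on UNIV F"
    unfolding F_def
    by (rule continuous_on_compose2[OF f(1)], intro continuous_intros) (simp_all add: max_nonzero)
  have F_bd: "\<bar>F z\<bar> \<le> B" for z
    unfolding F_def by (rule f(2))
  have V_m: "?V n \<in> borel_measurable P" for n
    by (rule measurable_history_determined[OF history_determined_pair]) simp
  have L_m: "?L \<in> borel_measurable noise"
    by (intro borel_measurable_Pair measurable_masked borel_measurable_const)
  have cis_m: "(\<lambda>x. cis (u \<bullet> x)) \<in> borel_measurable borel" for u :: "(real ^ (('s \<times> 'a) \<times> 's)) \<times> (real ^ ('s \<times> 'a))"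
    by (intro borel_measurable_continuous_onI continuous_intros)
  have "(\<lambda>n. \<integral>x. F x \<partial>distr P borel (?V n)) \<longlonglongrightarrow> (\<integral>x. F x \<partial>distr noise borel ?L)"
  proof (rule levy_continuity_euclidean[OF _ _ _ _ _ F_cont F_bd])
    show "prob_space (distr P borel (?V n))" for n by (rule prob_space_distr[OF V_m])
    show "prob_space (distr noise borel ?L)" by (rule G.prob_space_distr[OF L_m])
    fix u :: "(real ^ (('s \<times> 'a) \<times> 's)) \<times> (real ^ ('s \<times> 'a))"
    obtain a b where u: "u = (a, b)" by (cases u)
    have lhs: "(\<integral>x. cis (u \<bullet> x) \<partial>distr P borel (?V n))
        = (\<integral>\<omega>. cis (a \<bullet> rotated (v n) n \<omega> + (\<Sum>p\<in>UNIV. b $ p * (visits X A (fst p) (snd p) n \<omega> / v n p))) \<partial>P)" for n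
      by (subst integral_distr[OF V_m cis_m]) (simp add: u inner_vec_def[of b] visit_ratio_def)
    have "(\<integral>x. cis (u \<bullet> x) \<partial>distr noise borel ?L) = (\<integral>\<xi>. cis (a \<bullet> masked \<xi>) * cis (\<Sum>p\<in>UNIV. b $ p) \<partial>noise)"
      by (subst integral_distr[OF L_m cis_m]) (simp add: u inner_vec_def[of b] cis_mult)
    also have "\<dots> = (\<Prod>p\<in>UNIV. complex_of_real (exp (- ((\<Sum>t\<in>free_coords p. (a $ (p, t))\<^sup>2) / 2)))) * cis (\<Sum>p\<in>UNIV. b $ p)"
      by (simp only: integral_mult_left_zero masked_chf)
    finally have rhs: "(\<integral>x. cis (u \<bullet> x) \<partial>distr noise borel ?L) = \<dots>" .
    show "(\<lambda>n. \<integral>x. cis (u \<bullet> x) \<partial>distr P borel (?V n)) \<longlonglongrightarrow> (\<integral>x. cis (u \<bullet> x) \<partial>distr noise borel ?L)"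
      unfolding lhs rhs inner_rotated
      using joint_chf_tendsto[OF v lln, of "rotated_coeff (\<lambda>q. a $ q)" "\<lambda>p. b $ p"]
      by (simp only: weighted_variance_rotated)
  qed auto
  moreover have "(\<integral>x. F x \<partial>distr P borel (?V n)) = (\<integral>\<omega>. F (?V n \<omega>) \<partial>P)" for n
    by (rule integral_distr[OF V_m borel_measurable_continuous_onI[OF F_cont]])
  moreover have "(\<integral>x. F x \<partial>distr noise borel ?L) = (\<integral>\<xi>. f (limit_statistics \<xi>) \<partial>noise)"
  proof -
    have "(\<Sum>t\<in>UNIV. (masked \<xi> $ (p, t))\<^sup>2) = (\<Sum>t\<in>free_coords p. (\<xi> (p, t))\<^sup>2)" for \<xi> p
      unfolding masked_def by (rule sum.mono_neutral_cong_right) auto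
    then have "F (?L \<xi>) = f (limit_statistics \<xi>)" for \<xi>
      by (simp add: F_def limit_statistics_def max_def)
    then show ?thesis
      by (subst integral_distr[OF L_m borel_measurable_continuous_onI[OF F_cont]]) simp
  qed
  ultimately have lim: "(\<lambda>n. \<integral>\<omega>. F (?V n \<omega>) \<partial>P) \<longlonglongrightarrow> (\<integral>\<xi>. f (limit_statistics \<xi>) \<partial>noise)"
    by (simp only:)
  have i1: "integrable P (\<lambda>\<omega>. f (statistics n \<omega>))" for n
    by (rule integrable_history_determined[OF history_determined_comp[OF history_determined_statistics]])
  have i2: "integrable P (\<lambda>\<omega>. F (?V n \<omega>))" for n
    by (rule integrable_history_determined[OF history_determined_comp[OF history_determined_pair]])
  have "\<forall>\<^sub>F n in sequentially. \<forall>p\<in>UNIV. 0 < v n p"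
    by (intro eventually_ball_finite ballI filterlim_at_top_dense[THEN iffD1, rule_format, OF v]) simp
  then have bound: "\<forall>\<^sub>F n in sequentially. norm ((\<integral>\<omega>. f (statistics n \<omega>) \<partial>P) - (\<integral>\<omega>. F (?V n \<omega>) \<partial>P))
      \<le> (\<Sum>p\<in>UNIV. 4 * B * (\<integral>\<omega>. \<bar>visits X A (fst p) (snd p) n \<omega> / v n p - 1\<bar> \<partial>P))"
  proof eventually_elim
    case (elim n)
    have B: "0 \<le> B" using f(2)[of 0] by linarith
    have "norm ((\<integral>\<omega>. f (statistics n \<omega>) \<partial>P) - (\<integral>\<omega>. F (?V n \<omega>) \<partial>P))
        = norm (\<integral>\<omega>. f (statistics n \<omega>) - F (?V n \<omega>) \<partial>P)"
      by (simp only: Bochner_Integration.integral_diff i1 i2)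
    also have "\<dots> \<le> (\<integral>\<omega>. norm (f (statistics n \<omega>) - F (?V n \<omega>)) \<partial>P)"
      by (rule integral_norm_bound)
    also have "\<dots> \<le> (\<integral>\<omega>. (\<Sum>p\<in>UNIV. 4 * B * \<bar>visits X A (fst p) (snd p) n \<omega> / v n p - 1\<bar>) \<partial>P)"
    proof (rule integral_mono)
      show "integrable P (\<lambda>\<omega>. norm (f (statistics n \<omega>) - F (?V n \<omega>)))"
        by (intro integrable_norm Bochner_Integration.integrable_diff i1 i2)
      show "integrable P (\<lambda>\<omega>. \<Sum>p\<in>UNIV. 4 * B * \<bar>visits X A (fst p) (snd p) n \<omega> / v n p - 1\<bar>)"
        by (intro Bochner_Integration.integrable_sum integrable_mult_right integrable_visits_deviation)
      fix \<omega>
      show "norm (f (statistics n \<omega>) - F (?V n \<omega>)) \<le> (\<Sum>p\<in>UNIV. 4 * B * \<bar>visits X A (fst p) (snd p) n \<omega> / v n p - 1\<bar>)"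
      proof (cases "\<forall>p. 1 / 2 \<le> visit_ratio (v n) n \<omega> $ p")
        case True
        have "statistics n \<omega> = (\<chi> p. (\<Sum>t\<in>UNIV. (fst (?V n \<omega>) $ (p, t))\<^sup>2) / max (snd (?V n \<omega>) $ p) (1 / 2))"
          unfolding statistics_def vec_eq_iff
        proof (intro allI)
          fix p
          have "0 < v n p" using elim by blast
          moreover have "max (visit_ratio (v n) n \<omega> $ p) (1 / 2) = visit_ratio (v n) n \<omega> $ p"
            using True by (intro max_absorb1) blast
          ultimately show "(\<chi> p. chi_square_statistic X A M (fst p) (snd p) n \<omega>) $ p
              = (\<chi> p. (\<Sum>t\<in>UNIV. (fst (?V n \<omega>) $ (p, t))\<^sup>2) / max (snd (?V n \<omega>) $ p) (1 / 2)) $ p"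
            by (simp only: vec_lambda_beta fst_conv snd_conv statistic_eq[where v="v n"])
        qed
        then have "f (statistics n \<omega>) = F (?V n \<omega>)"
          unfolding F_def by (rule arg_cong)
        moreover have "0 \<le> (\<Sum>p\<in>UNIV. 4 * B * \<bar>visits X A (fst p) (snd p) n \<omega> / v n p - 1\<bar>)"
          by (intro sum_nonneg mult_nonneg_nonneg abs_ge_zero B) simp
        ultimately show ?thesis
          by (simp only: diff_self norm_zero)
      next
        case False
        then obtain p where p: "visits X A (fst p) (snd p) n \<omega> / v n p < 1 / 2"
          by (auto simp: visit_ratio_def not_le)
        have "norm (f (statistics n \<omega>) - F (?V n \<omega>)) \<le> 2 * B"
          using f(2)[of "statistics n \<omega>"] F_bd[of "?V n \<omega>"] unfolding real_norm_def by linarith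
        \<comment> \<open>A ratio below \<open>1 / 2\<close> deviates from 1 by more than
          \<open>1 / 2\<close>, so the trivial bound \<open>2 * B\<close> is at most
          \<open>4 * B\<close> times the deviation, whose mean tends to 0.\<close>
        also have "\<dots> \<le> 4 * B * \<bar>visits X A (fst p) (snd p) n \<omega> / v n p - 1\<bar>"
        proof -
          have "1 / 2 \<le> \<bar>visits X A (fst p) (snd p) n \<omega> / v n p - 1\<bar>"
            using p by linarith
          from mult_left_mono[OF this, of "4 * B"] show ?thesis using B by simp
        qed
        also have "\<dots> \<le> (\<Sum>p\<in>UNIV. 4 * B * \<bar>visits X A (fst p) (snd p) n \<omega> / v n p - 1\<bar>)"
          using B by (intro member_le_sum[where f="\<lambda>p. 4 * B * \<bar>visits X A (fst p) (snd p) n \<omega> / v n p - 1\<bar>"]) auto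
        finally show ?thesis .
      qed
    qed
    also have "\<dots> = (\<Sum>p\<in>UNIV. 4 * B * (\<integral>\<omega>. \<bar>visits X A (fst p) (snd p) n \<omega> / v n p - 1\<bar> \<partial>P))"
      by (simp only: Bochner_Integration.integral_sum integrable_mult_right integrable_visits_deviation integral_mult_right_zero)
    finally show ?case .
  qed
  have "(\<lambda>n. \<Sum>p\<in>UNIV. 4 * B * (\<integral>\<omega>. \<bar>visits X A (fst p) (snd p) n \<omega> / v n p - 1\<bar> \<partial>P)) \<longlonglongrightarrow> (\<Sum>p\<in>(UNIV :: ('s \<times> 'a) set). 4 * B * 0)"
    by (intro tendsto_sum tendsto_mult tendsto_const lln)
  then have "(\<lambda>n. (\<integral>\<omega>. f (statistics n \<omega>) \<partial>P) - (\<integral>\<omega>. F (?V n \<omega>) \<partial>P)) \<longlonglongrightarrow> 0"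
    by (intro Lim_null_comparison[OF bound]) (simp only: mult_zero_right sum.neutral_const)
  from tendsto_add[OF this lim] show ?thesis by simp
qed

text \<open>Limits for different pairs are functions of disjoint blocks of independent coordinates.
  The remaining steps carry this from the noise space to the law of the vector, through the product
  form of the joint law.\<close>

lemma indep_limit_statistics:
  "prob_space.indep_vars (distr noise borel limit_statistics) (\<lambda>_. borel) (\<lambda>p z. z $ p) UNIV"
proof -
  interpret G: prob_space noise by (rule prob_space_gauss)
  let ?S = "\<lambda>_. std_normal_distribution"
  have "G.indep_vars ?S (\<lambda>q \<xi>. \<xi> q) UNIV"
  proof (subst G.indep_vars_iff_distr_eq_PiM)
    show "(\<lambda>\<xi>. \<xi> q) \<in> noise \<rightarrow>\<^sub>M std_normal_distribution" for q
      by (rule measurable_component_singleton) simp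
    have "distr noise (\<Pi>\<^sub>M q\<in>UNIV. std_normal_distribution) (\<lambda>\<xi>. \<lambda>q\<in>UNIV. \<xi> q) = noise"
      by (simp only: restrict_UNIV distr_id)
    also have "\<dots> = (\<Pi>\<^sub>M q\<in>UNIV. distr noise std_normal_distribution (\<lambda>\<xi>. \<xi> q))"
      by (intro PiM_cong refl distr_PiM_component[symmetric] prob_space_std_normal) auto
    finally show "distr noise (\<Pi>\<^sub>M q\<in>UNIV. std_normal_distribution) (\<lambda>\<xi>. \<lambda>q\<in>UNIV. \<xi> q)
        = (\<Pi>\<^sub>M q\<in>UNIV. distr noise std_normal_distribution (\<lambda>\<xi>. \<xi> q))" .
  qed simp
  then have "G.indep_vars (\<lambda>p. gauss (Pair p ` free_coords p)) (\<lambda>p \<xi>. restrict (\<lambda>q. \<xi> q) (Pair p ` free_coords p)) UNIV"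
    by (rule G.indep_vars_restrict) (auto simp: disjoint_family_on_def)
  then have "G.indep_vars (\<lambda>_. borel)
      (\<lambda>p \<xi>. (\<lambda>g. \<Sum>t\<in>free_coords p. (g (p, t))\<^sup>2) (restrict (\<lambda>q. \<xi> q) (Pair p ` free_coords p))) UNIV"
    by (rule G.indep_vars_compose2)
      (intro borel_measurable_sum borel_measurable_power measurable_gauss_component, auto)
  then have indep: "G.indep_vars (\<lambda>_. borel) (\<lambda>p \<xi>. limit_statistics \<xi> $ p) UNIV"
    by (simp add: limit_statistics_def)
  interpret N: prob_space "distr noise borel limit_statistics"
    by (rule G.prob_space_distr) simp
  have vec_m [measurable]: "(\<lambda>z :: real ^ ('s \<times> 'a). z $ p) \<in> borel_measurable borel" for p
    by (intro borel_measurable_continuous_onI continuous_intros)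
  have comp_m: "(\<lambda>\<xi>. limit_statistics \<xi> $ p) \<in> borel_measurable noise" for p
    by (rule measurable_compose[OF measurable_limit_statistics vec_m])
  have "distr (distr noise borel limit_statistics) (\<Pi>\<^sub>M p\<in>UNIV. borel) (\<lambda>z. \<lambda>p\<in>UNIV. z $ p)
      = distr noise (\<Pi>\<^sub>M p\<in>UNIV. borel) (\<lambda>\<xi>. \<lambda>p\<in>UNIV. limit_statistics \<xi> $ p)"
    by (subst distr_distr) (auto simp: comp_def intro!: measurable_restrict)
  also have "\<dots> = (\<Pi>\<^sub>M p\<in>UNIV. distr noise borel (\<lambda>\<xi>. limit_statistics \<xi> $ p))"
    by (rule iffD1[OF G.indep_vars_iff_distr_eq_PiM[OF UNIV_not_empty comp_m] indep])
  also have "\<dots> = (\<Pi>\<^sub>M p\<in>UNIV. distr (distr noise borel limit_statistics) borel (\<lambda>z. z $ p))"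
    by (simp only: distr_distr[OF vec_m measurable_limit_statistics] comp_def)
  finally have eq: "distr (distr noise borel limit_statistics) (\<Pi>\<^sub>M p\<in>UNIV. borel) (\<lambda>z. \<lambda>p\<in>UNIV. z $ p) = \<dots>" .
  have "(\<lambda>z. z $ p) \<in> borel_measurable (distr noise borel limit_statistics)" for p
    using vec_m by simp
  from iffD2[OF N.indep_vars_iff_distr_eq_PiM[OF UNIV_not_empty this] eq]
  show ?thesis .
qed

end

section \<open>Removing the condition on the initial pair\<close>

context kernel_process
begin

text \<open>Under \<open>P\<close> the integral is a mixture over the initial pairs, and all pairs
  of positive probability lead to the same limit; null initial events contribute 0 for every
  \<open>n\<close>.\<close>

lemma statistics_tendsto_unconditioned:
  assumes ret: "return_time_condition P X A"
    and C: "\<And>n. 1 \<le> n \<Longrightarrow> mixing_norm P X A n \<le> C" "0 \<le> C"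
    and f: "continuous_on UNIV f" "\<And>x. \<bar>f x\<bar> \<le> B"
  shows "(\<lambda>n. \<integral>\<omega>. f (statistics n \<omega>) \<partial>P) \<longlonglongrightarrow> (\<integral>\<xi>. f (limit_statistics \<xi>) \<partial>noise :: real)"
proof -
  let ?B = "\<lambda>p. initial_event (fst p) (snd p)" and ?L = "\<integral>\<xi>. f (limit_statistics \<xi>) \<partial>noise"
  have det: "history_determined (Suc n) (\<lambda>\<omega>. f (statistics n \<omega>))" for n
    by (rule history_determined_comp[OF history_determined_statistics])
  have int: "integrable P (\<lambda>\<omega>. f (statistics n \<omega>))" for n
    by (rule integrable_history_determined[OF det])
  have part: "(\<lambda>n. \<integral>\<omega>. f (statistics n \<omega>) * indicator (?B p) \<omega> \<partial>P) \<longlonglongrightarrow> prob (?B p) * ?L" for p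
  proof (cases "prob (?B p) = 0")
    case True
    then have "AE \<omega> in P. \<omega> \<notin> ?B p"
      by (simp add: prob_eq_0)
    then have "AE \<omega> in P. f (statistics n \<omega>) * indicator (?B p) \<omega> = 0" for n
      by eventually_elim simp
    then have "(\<integral>\<omega>. f (statistics n \<omega>) * indicator (?B p) \<omega> \<partial>P) = 0" for n
      by (rule integral_eq_zero_AE)
    then show ?thesis using True by simp
  next
    case False
    then have pos: "0 < prob (?B p)" by (simp add: zero_less_measure_iff)
    interpret Q: kernel_process "conditioned (fst p) (snd p)" X A M
      by (rule kernel_process_conditioned[OF pos])
    have "(\<lambda>n. \<integral>\<omega>. f (statistics n \<omega>) \<partial>conditioned (fst p) (snd p)) \<longlonglongrightarrow> ?L"
      by (rule Q.statistics_tendsto[OF conditioned_visits_lln[OF pos ret C] f])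
    then have "(\<lambda>n. prob (?B p) * (\<integral>\<omega>. f (statistics n \<omega>) \<partial>conditioned (fst p) (snd p))) \<longlonglongrightarrow> prob (?B p) * ?L"
      by (rule tendsto_mult_left)
    moreover have "prob (?B p) * (\<integral>\<omega>. f (statistics n \<omega>) \<partial>conditioned (fst p) (snd p))
        = (\<integral>\<omega>. f (statistics n \<omega>) * indicator (?B p) \<omega> \<partial>P)" for n
      using pos by (subst integral_conditioned[OF pos borel_measurable_integrable[OF int]]) simp
    ultimately show ?thesis by (simp only:)
  qed
  have "(\<Sum>p\<in>UNIV. prob (?B p)) = 1"
    using sum_initial_events[of "\<lambda>_. 1"] by (simp add: prob_space)
  then have "(\<Sum>p\<in>UNIV. prob (?B p) * ?L) = ?L"
    by (simp only: sum_distrib_right[symmetric] mult_1)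
  moreover have "(\<lambda>n. \<Sum>p\<in>UNIV. \<integral>\<omega>. f (statistics n \<omega>) * indicator (?B p) \<omega> \<partial>P) \<longlonglongrightarrow> (\<Sum>p\<in>UNIV. prob (?B p) * ?L)"
    by (rule tendsto_sum) (rule part)
  ultimately show ?thesis
    by (simp only: sum_initial_events[OF int])
qed

text \<open>The continuous mapping principle; a coordinate projection gives the single statistics,
  the sum of all coordinates the total.\<close>

lemma statistics_weak_conv:
  assumes ret: "return_time_condition P X A"
    and C: "\<And>n. 1 \<le> n \<Longrightarrow> mixing_norm P X A n \<le> C" "0 \<le> C"
    and g: "continuous_on UNIV (g :: real ^ ('s \<times> 'a) \<Rightarrow> real)"
  shows "weak_conv_m (\<lambda>n. distr P borel (\<lambda>\<omega>. g (statistics n \<omega>))) (distr noise borel (\<lambda>\<xi>. g (limit_statistics \<xi>)))"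
proof (rule integral_bdd_continuous_conv_imp_weak_conv)
  have m1: "(\<lambda>\<omega>. g (statistics n \<omega>)) \<in> borel_measurable P" for n
    by (rule measurable_history_determined[OF history_determined_comp[OF history_determined_statistics]]) simp
  have m2: "(\<lambda>\<xi>. g (limit_statistics \<xi>)) \<in> borel_measurable noise"
    by (rule measurable_compose[OF measurable_limit_statistics borel_measurable_continuous_onI[OF g]])
  show "real_distribution (distr P borel (\<lambda>\<omega>. g (statistics n \<omega>)))" for n
    by (rule real_distribution_distr[OF m1])
  show "real_distribution (distr noise borel (\<lambda>\<xi>. g (limit_statistics \<xi>)))"
    by (rule prob_space.real_distribution_distr[OF prob_space_gauss m2])
  fix f :: "real \<Rightarrow> real" assume "\<And>x. isCont f x" and bd: "\<And>x. \<bar>f x\<bar> \<le> 1"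
  then have f: "continuous_on UNIV f" by (simp add: continuous_on_eq_continuous_at)
  have f_m: "f \<in> borel_measurable borel" by (rule borel_measurable_continuous_onI[OF f])
  have "(\<lambda>n. \<integral>\<omega>. f (g (statistics n \<omega>)) \<partial>P) \<longlonglongrightarrow> (\<integral>\<xi>. f (g (limit_statistics \<xi>)) \<partial>noise)"
    by (rule statistics_tendsto_unconditioned[OF ret C, of "\<lambda>x. f (g x)"])
      (auto intro: continuous_on_compose2[OF f g] bd)
  then show "(\<lambda>n. integral\<^sup>L (distr P borel (\<lambda>\<omega>. g (statistics n \<omega>))) f)
      \<longlonglongrightarrow> integral\<^sup>L (distr noise borel (\<lambda>\<xi>. g (limit_statistics \<xi>))) f"
    by (simp only: integral_distr[OF m1 f_m] integral_distr[OF m2 f_m])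
qed

lemma statistics_asymptotically_independent:
  assumes ret: "return_time_condition P X A"
    and C: "\<And>n. 1 \<le> n \<Longrightarrow> mixing_norm P X A n \<le> C" "0 \<le> C"
  shows "asymptotically_independent P statistics"
  unfolding asymptotically_independent_def
proof (intro exI conjI)
  let ?\<nu> = "distr noise borel limit_statistics"
  show "prob_space ?\<nu>"
    by (rule prob_space.prob_space_distr[OF prob_space_gauss measurable_limit_statistics])
  show "prob_space.indep_vars ?\<nu> (\<lambda>_. borel) (\<lambda>i z. z $ i) UNIV"
    by (rule indep_limit_statistics)
  show "weak_conv_vec (\<lambda>n. distr P borel (statistics n)) ?\<nu>"
    unfolding weak_conv_vec_def
  proof (intro allI impI, elim conjE)
    fix f :: "real ^ ('s \<times> 'a) \<Rightarrow> real" assume f: "continuous_on UNIV f" and "bounded (range f)"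
    then obtain B where B: "\<And>x. \<bar>f x\<bar> \<le> B" by (auto simp: bounded_iff)
    have f_m: "f \<in> borel_measurable borel" by (rule borel_measurable_continuous_onI[OF f])
    have m: "statistics n \<in> borel_measurable P" for n
      by (rule measurable_history_determined[OF history_determined_statistics]) simp
    show "(\<lambda>n. integral\<^sup>L (distr P borel (statistics n)) f) \<longlonglongrightarrow> integral\<^sup>L ?\<nu> f"
      unfolding integral_distr[OF m f_m] integral_distr[OF measurable_limit_statistics f_m]
      by (rule statistics_tendsto_unconditioned[OF ret C f B])
  qed
qed simp

lemma distr_limit_component:
  "distr noise borel (\<lambda>\<xi>. limit_statistics \<xi> $ p) = chi_square_distribution (support_size M (fst p) (snd p) - 1)"
proof -
  have "limit_statistics \<xi> $ p = (\<Sum>q\<in>Pair p ` free_coords p. (\<xi> q)\<^sup>2)" for \<xi>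
    by (simp add: limit_statistics_def sum.reindex inj_on_def)
  then have "distr noise borel (\<lambda>\<xi>. limit_statistics \<xi> $ p) = chi_square_distribution (card (Pair p ` free_coords p))"
    by (simp only: distr_sum_squares[OF finite subset_UNIV])
  then show ?thesis
    by (simp add: card_image inj_on_def card_free_coords)
qed

lemma distr_limit_sum:
  "distr noise borel (\<lambda>\<xi>. \<Sum>p\<in>UNIV. limit_statistics \<xi> $ p)
    = chi_square_distribution ((\<Sum>(s, l)\<in>UNIV. support_size M s l) - CARD('s) * CARD('a))"
proof -
  let ?J = "SIGMA p:UNIV. free_coords p"
  have "(\<Sum>p\<in>UNIV. limit_statistics \<xi> $ p) = (\<Sum>q\<in>?J. (\<xi> q)\<^sup>2)" for \<xi>
    by (simp add: limit_statistics_def sum.Sigma split_def)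
  then have "distr noise borel (\<lambda>\<xi>. \<Sum>p\<in>UNIV. limit_statistics \<xi> $ p) = chi_square_distribution (card ?J)"
    by (simp only: distr_sum_squares[OF finite subset_UNIV])
  also have "card ?J = (\<Sum>p\<in>UNIV. support_size M (fst p) (snd p) - 1)"
    by (simp add: card_free_coords)
  \<comment> \<open>Every support is nonempty, so no truncation occurs and the subtraction on
    naturals commutes with the sum.\<close>
  also have "\<dots> = (\<Sum>p\<in>UNIV. support_size M (fst p) (snd p)) - (\<Sum>p\<in>(UNIV :: ('s \<times> 'a) set). 1)"
    by (rule sum_subtractf_nat) (rule support_size_pos)
  finally show ?thesis
    by (simp add: split_def)
qed

end

theorem proposition9:
  fixes P :: "'w measure"
    and X :: "nat \<Rightarrow> 'w \<Rightarrow> 's::finite"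
    and A :: "nat \<Rightarrow> 'w \<Rightarrow> 'a::finite"
    and M :: "'s \<Rightarrow> 'a \<Rightarrow> 's \<Rightarrow> real"
  assumes "controlled_markov_chain P X A"
    and "transition_kernel M"
    and "null_hypothesis P X A M"
    and "return_time_condition P X A"
    and "\<exists>C>1. \<forall>n\<ge>1. mixing_norm P X A n \<le> C"
  shows "(\<forall>s l. weak_conv_m (\<lambda>n. distr P borel (chi_square_statistic X A M s l n))
             (chi_square_distribution (support_size M s l - 1)))
    \<and> asymptotically_independent P
        (\<lambda>n \<omega>. \<chi> p :: 's \<times> 'a. chi_square_statistic X A M (fst p) (snd p) n \<omega>)
    \<and> weak_conv_m
        (\<lambda>n. distr P borel (\<lambda>\<omega>. \<Sum>(s, l)\<in>UNIV. chi_square_statistic X A M s l n \<omega>))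
        (chi_square_distribution
          ((\<Sum>(s, l)\<in>UNIV. support_size M s l) - CARD('s) * CARD('a)))"
proof -
  interpret kernel_process P X A M
    by (rule controlled_markov_chain.kernel_process[OF assms(1-3)])
  obtain C where C: "\<And>n. 1 \<le> n \<Longrightarrow> mixing_norm P X A n \<le> C" "0 \<le> C"
    using assms(5) by (meson less_imp_le order_trans zero_le_one)
  have "weak_conv_m (\<lambda>n. distr P borel (chi_square_statistic X A M s l n))
      (chi_square_distribution (support_size M s l - 1))" for s l
    using statistics_weak_conv[OF assms(4) C, of "\<lambda>z. z $ (s, l)"] distr_limit_component[of "(s, l)"]
    by (simp add: statistics_def continuous_on_component continuous_on_id)
  moreover have "asymptotically_independent P
      (\<lambda>n \<omega>. \<chi> p :: 's \<times> 'a. chi_square_statistic X A M (fst p) (snd p) n \<omega>)"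
    using statistics_asymptotically_independent[OF assms(4) C] by (simp add: statistics_def[abs_def])
  moreover have "weak_conv_m
      (\<lambda>n. distr P borel (\<lambda>\<omega>. \<Sum>(s, l)\<in>UNIV. chi_square_statistic X A M s l n \<omega>))
      (chi_square_distribution ((\<Sum>(s, l)\<in>UNIV. support_size M s l) - CARD('s) * CARD('a)))"
    using statistics_weak_conv[OF assms(4) C, of "\<lambda>z. \<Sum>p\<in>UNIV. z $ p"] distr_limit_sum
    by (simp add: statistics_def split_def continuous_on_sum continuous_on_component continuous_on_id)
  ultimately show ?thesis by blast
qed

end
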